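(* Let $n\ge 1$, $R>0$, $c_1,\dots,c_n\in\mathbb{C}$ and $r_1,\dots,r_n>0$ be such that $|c_i|+r_i<R$ for all $1\le i\le n$ and the closed disks $\overline{D(c_1,r_1)},\dots,\overline{D(c_n,r_n)}$ are pairwise disjoint. Then $$K_R\big((c_1,r_1),\dots,(c_n,r_n)\big)\le \frac{n+1}{2}+\sqrt{\frac{(n+1)^2}{4}+n}.$$
   Context: $D(c,r)$ denotes the open disk in $\mathbb{C}$ with center $c$ and radius $r$. Given $R>0$ and disks $D(c_1,r_1),\dots,D(c_n,r_n)$ with pairwise disjoint closures and $|c_i|+r_i<R$ for all $i$, define $$D_R\big((c_1,r_1),\dots,(c_n,r_n)\big)=D(0,R)\setminus\bigcup_{1\le i\le n}\overline{D(c_i,r_i)}.$$ The Badea-Beckermann-Crouzeix class $\mathscr{D}_R\big((c_1,r_1),\dots,(c_n,r_n)\big)$ is the set of all square complex matrices $A\in\mathbb{C}^{d\times d}$ (of any size $d\ge 1$) such that $\|A\|<R$ and, for each $1\le i\le n$, $A-c_iI$ is invertible with $\|(A-c_iI)^{-1}\|<r_i^{-1}$. Here $\|\cdot\|$ is the operator norm induced by the Euclidean norm. Every such $A$ has spectrum in $D_R\big((c_1,r_1),\dots,(c_n,r_n)\big)$, so $f(A)$ is defined by the holomorphic functional calculus for every $f$ holomorphic on that domain. The spectral constant $K_R\big((c_1,r_1),\dots,(c_n,r_n)\big)$ is the smallest constant $K$ such that $$\|f(A)\|\le K\sup_{z\in D_R((c_1,r_1),\dots,(c_n,r_n))}|f(z)|$$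 for all $A\in\mathscr{D}_R\big((c_1,r_1),\dots,(c_n,r_n)\big)$ and all $f$ holomorphic in $D_R\big((c_1,r_1),\dots,(c_n,r_n)\big)$ (the inequality being vacuous if the supremum is infinite). *)

theory Defs
  imports
    "HOL-Library.Disjoint_Sets"
    "HOL-Library.Extended_Real"
    "HOL-Complex_Analysis.Complex_Analysis"
    "Jordan_Normal_Form.Spectral_Radius"
begin

unbundle no vec_syntax and no fps_syntax

definition eucl_norm :: "complex vec \<Rightarrow> real" where
  "eucl_norm v = L2_set (\<lambda>i. cmod (v $ i)) {..<dim_vec v}"

definition op_norm :: "complex mat \<Rightarrow> real" where
  "op_norm A = Sup {eucl_norm (A *\<^sub>v v) | v. v \<in> carrier_vec (dim_col A) \<and> eucl_norm v \<le> 1}"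

definition punctured_disk :: "nat \<Rightarrow> real \<Rightarrow> (nat \<Rightarrow> complex) \<Rightarrow> (nat \<Rightarrow> real) \<Rightarrow> complex set" where
  "punctured_disk n R c r = ball 0 R - (\<Union>i\<in>{1..n}. cball (c i) (r i))"

definition BBC_class :: "nat \<Rightarrow> real \<Rightarrow> (nat \<Rightarrow> complex) \<Rightarrow> (nat \<Rightarrow> real) \<Rightarrow> complex mat set" where
  "BBC_class n R c r = {A. \<exists>d\<ge>1. A \<in> carrier_mat d d \<and> op_norm A < R \<and>
     (\<forall>i\<in>{1..n}. invertible_mat (A - c i \<cdot>\<^sub>m 1\<^sub>m d) \<and>
        op_norm (the (mat_inverse (A - c i \<cdot>\<^sub>m 1\<^sub>m d))) < inverse (r i))}"

definition resolvent :: "complex mat \<Rightarrow> complex \<Rightarrow> complex mat" where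
  "resolvent A z = the (mat_inverse (z \<cdot>\<^sub>m 1\<^sub>m (dim_row A) - A))"

text \<open>The Riesz--Dunford integral
  \<open>f(A) = 1/(2\<pi>\<i>) \<integral>\<^sub>\<Gamma> f(z) (z I - A)\<^sup>-\<^sup>1 dz\<close>, taken entrywise, where \<open>\<Gamma>\<close> consists of sufficiently
  small positively oriented circles around the eigenvalues of \<open>A\<close>: by definition, \<^const>\<open>residue\<close> is
  \<open>1/(2\<pi>\<i>)\<close> times the integral over such a circle. Lemma \<open>hol_calc_contour_integral\<close> below shows
  that any closed path in the domain winding once around each eigenvalue and not around points outside
  the domain gives the same matrix. Only the values of \<open>f\<close> near the spectrum
  matter, so \<open>f\<close> may be arbitrary outside its domain of holomorphy.\<close>

definition hol_calc :: "(complex \<Rightarrow> complex) \<Rightarrow> complex mat \<Rightarrow> complex mat" where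
  "hol_calc f A = Matrix.mat (dim_row A) (dim_row A)
     (\<lambda>(i, j). \<Sum>\<mu>\<in>spectrum A. residue (\<lambda>z. f z * resolvent A z $$ (i, j)) \<mu>)"

text \<open>Functions with infinite supremum impose no condition, so only bounded ones are considered
  (\<^const>\<open>Sup\<close> on \<^typ>\<open>real\<close> is junk otherwise).\<close>

definition is_spectral_bound ::
  "nat \<Rightarrow> real \<Rightarrow> (nat \<Rightarrow> complex) \<Rightarrow> (nat \<Rightarrow> real) \<Rightarrow> real \<Rightarrow> bool" where
  "is_spectral_bound n R c r K \<longleftrightarrow>
     (\<forall>A\<in>BBC_class n R c r. \<forall>f. f holomorphic_on punctured_disk n R c r \<longrightarrow>
        bounded (f ` punctured_disk n R c r) \<longrightarrow>
        op_norm (hol_calc f A) \<le> K * (SUP z\<in>punctured_disk n R c r. cmod (f z)))"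

text \<open>Extended real, so that it is \<open>\<infinity>\<close> if there is no admissible constant.\<close>

definition spectral_constant ::
  "nat \<Rightarrow> real \<Rightarrow> (nat \<Rightarrow> complex) \<Rightarrow> (nat \<Rightarrow> real) \<Rightarrow> ereal" where
  "spectral_constant n R c r = Inf (ereal ` {K. is_spectral_bound n R c r K})"

text \<open>The infimum, when finite, is itself admissible, i.e. it is the smallest constant.\<close>

lemma spectral_constant_smallest:
  assumes "spectral_constant n R c r = ereal K"
    and ne: "punctured_disk n R c r \<noteq> {}"
  shows "is_spectral_bound n R c r K"
    and "is_spectral_bound n R c r K' \<Longrightarrow> K \<le> K'"
proof -
  show "K \<le> K'" if "is_spectral_bound n R c r K'" for K'
  proof -
    have "spectral_constant n R c r \<le> ereal K'"
      unfolding spectral_constant_def using that by (intro Inf_lower) auto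
    with assms(1) show ?thesis by simp
  qed
  show "is_spectral_bound n R c r K"
    unfolding is_spectral_bound_def
  proof (intro ballI allI impI)
    let ?D = "punctured_disk n R c r"
    fix A f
    assume A: "A \<in> BBC_class n R c r" and f: "f holomorphic_on ?D" "bounded (f ` ?D)"
    let ?S = "SUP z\<in>?D. cmod (f z)"
    show "op_norm (hol_calc f A) \<le> K * ?S"
    proof (rule tendsto_lowerbound)
      show "((\<lambda>e. (K + e) * ?S) \<longlongrightarrow> K * ?S) (at_right 0)"
        by (auto intro!: tendsto_eq_intros)
      show "\<forall>\<^sub>F e in at_right 0. op_norm (hol_calc f A) \<le> (K + e) * ?S"
      proof (rule eventually_at_rightI[of 0 1])
        fix e :: real assume e: "e \<in> {0<..<1}"
        have "spectral_constant n R c r < ereal (K + e)" using assms(1) e by simp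
        then obtain K' where K': "is_spectral_bound n R c r K'" "K' < K + e"
          unfolding spectral_constant_def Inf_less_iff by auto
        have le: "op_norm (hol_calc f A) \<le> K' * ?S"
          using K'(1) A f unfolding is_spectral_bound_def by blast
        have "0 \<le> ?S"
        proof -
          have "bdd_above ((\<lambda>z. cmod (f z)) ` ?D)"
            using f(2) by (force simp: bounded_iff bdd_above_def)
          with ne show ?thesis by (metis cSUP_upper2 ex_in_conv norm_ge_zero)
        qed
        then have "K' * ?S \<le> (K + e) * ?S" using K'(2) by (intro mult_right_mono) auto
        with le show "op_norm (hol_calc f A) \<le> (K + e) * ?S" by linarith
      qed auto
    qed auto
  qed
qed

lemma holomorphic_on_det:
  assumes "\<And>z. M z \<in> carrier_mat n n"
    and "\<And>i j. i < n \<Longrightarrow> j < n \<Longrightarrow> (\<lambda>z. M z $$ (i, j)) holomorphic_on S"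
  shows "(\<lambda>z. Determinant.det (M z)) holomorphic_on S"
proof -
  have "(\<lambda>z. \<Sum>p\<in>{p. p permutes {0..<n}}. signof p * (\<Prod>i = 0..<n. M z $$ (i, p i))) holomorphic_on S"
    by (intro holomorphic_intros assms) (auto simp: permutes_in_image)
  moreover have "Determinant.det (M z) = (\<Sum>p\<in>{p. p permutes {0..<n}}. signof p * (\<Prod>i = 0..<n. M z $$ (i, p i)))" for z
    using assms(1) by (rule det_def')
  ultimately show ?thesis by simp
qed

lemma resolvent_eq_adj:
  assumes A: "A \<in> carrier_mat d d" and z: "z \<notin> spectrum A"
  defines "M \<equiv> z \<cdot>\<^sub>m 1\<^sub>m d - A"
  shows "Determinant.det M \<noteq> 0"
    and "resolvent A z \<in> carrier_mat d d"
    and "resolvent A z = inverse (Determinant.det M) \<cdot>\<^sub>m adj_mat M"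
proof -
  have M: "M \<in> carrier_mat d d" unfolding M_def using A by auto
  have "M = (-1) \<cdot>\<^sub>m char_matrix A z"
    unfolding M_def char_matrix_def using A by (intro eq_matI) auto
  moreover have "Determinant.det (char_matrix A z) \<noteq> 0"
    using z eigenvalue_det[OF A] by (simp add: spectrum_def)
  ultimately show nz: "Determinant.det M \<noteq> 0"
    by simp
  obtain B where B: "mat_inverse M = Some B"
    using mat_inverse(1)[OF M] det_non_zero_imp_unit[OF M nz] by (meson not_None_eq)
  note B' = mat_inverse(2)[OF M B]
  have res: "resolvent A z = B" unfolding resolvent_def using A B by (simp add: M_def)
  show "resolvent A z \<in> carrier_mat d d" using res B' by simp
  note adj = adj_mat[OF M]
  have "adj_mat M = (B * M) * adj_mat M" using B' adj by simp
  also have "\<dots> = B * (M * adj_mat M)" using B' M adj by (intro assoc_mult_mat) auto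
  also have "\<dots> = Determinant.det M \<cdot>\<^sub>m B"
    using B' adj right_mult_one_mat[of B d d] by (simp add: mult_smult_distrib[where nr=d and n=d and nc=d])
  finally have "inverse (Determinant.det M) \<cdot>\<^sub>m adj_mat M = B"
    using nz B' by (intro eq_matI) auto
  with res show "resolvent A z = inverse (Determinant.det M) \<cdot>\<^sub>m adj_mat M" by simp
qed

lemma holomorphic_on_resolvent:
  assumes A: "A \<in> carrier_mat d d" and ij: "i < d" "j < d"
  shows "(\<lambda>z. resolvent A z $$ (i, j)) holomorphic_on - spectrum A"
proof -
  define M where "M z = z \<cdot>\<^sub>m 1\<^sub>m d - A" for z
  have M: "M z \<in> carrier_mat d d" for z unfolding M_def using A by auto
  have M_hol: "(\<lambda>z. M z $$ (i, j)) holomorphic_on S" if "i < d" "j < d" for i j S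
  proof -
    have "(\<lambda>z. M z $$ (i, j)) = (\<lambda>z. z * (if i = j then 1 else 0) - A $$ (i, j))"
      unfolding M_def using A that by auto
    then show ?thesis by (auto intro!: holomorphic_intros)
  qed
  have "(\<lambda>z. Determinant.det (mat_delete (M z) j i)) holomorphic_on S" for S
  proof (rule holomorphic_on_det[where n = "d - 1"])
    show "mat_delete (M z) j i \<in> carrier_mat (d - 1) (d - 1)" for z
      using mat_delete_carrier[OF M] by simp
    fix k l assume kl: "k < d - 1" "l < d - 1"
    have "(\<lambda>z. mat_delete (M z) j i $$ (k, l)) =
        (\<lambda>z. M z $$ (if k < j then k else Suc k, if l < i then l else Suc l))"
      using kl carrier_matD[OF M] by (auto simp: mat_delete_def fun_eq_iff)
    then show "(\<lambda>z. mat_delete (M z) j i $$ (k, l)) holomorphic_on S"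
      using kl by (auto intro!: M_hol)
  qed
  then have "(\<lambda>z. inverse (Determinant.det (M z)) *
      ((-1) ^ (j + i) * Determinant.det (mat_delete (M z) j i))) holomorphic_on - spectrum A"
    using resolvent_eq_adj(1)[OF A]
    by (intro holomorphic_intros holomorphic_on_det[OF M] M_hol) (auto simp: M_def)
  moreover have "resolvent A z $$ (i, j) = inverse (Determinant.det (M z)) *
      ((-1) ^ (j + i) * Determinant.det (mat_delete (M z) j i))" if "z \<in> - spectrum A" for z
    using resolvent_eq_adj(3)[OF A, of z] that ij M[of z]
    by (simp add: M_def[symmetric] adj_mat_def cofactor_def)
  ultimately show ?thesis by (auto intro: holomorphic_transform)
qed

lemma hol_calc_contour_integral:
  assumes A: "A \<in> carrier_mat d d" and "i < d" "j < d"
    and U: "open U" "connected U" "f holomorphic_on U" "spectrum A \<subseteq> U"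
    and \<gamma>: "valid_path \<gamma>" "pathfinish \<gamma> = pathstart \<gamma>" "path_image \<gamma> \<subseteq> U - spectrum A"
    and out: "\<And>z. z \<notin> U \<Longrightarrow> winding_number \<gamma> z = 0"
    and inside: "\<And>\<mu>. \<mu> \<in> spectrum A \<Longrightarrow> winding_number \<gamma> \<mu> = 1"
  shows "hol_calc f A $$ (i, j) =
    1 / (2 * pi * \<i>) * contour_integral \<gamma> (\<lambda>z. f z * resolvent A z $$ (i, j))"
proof -
  have "(\<lambda>z. f z * resolvent A z $$ (i, j)) holomorphic_on U - spectrum A"
    using holomorphic_on_resolvent[OF A \<open>i < d\<close> \<open>j < d\<close>] U(3)
    by (intro holomorphic_intros) auto
  then have "contour_integral \<gamma> (\<lambda>z. f z * resolvent A z $$ (i, j)) =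
      2 * pi * \<i> * (\<Sum>\<mu>\<in>spectrum A. winding_number \<gamma> \<mu> * residue (\<lambda>z. f z * resolvent A z $$ (i, j)) \<mu>)"
    using U \<gamma> out card_finite_spectrum(1)[OF A] by (intro Residue_theorem) auto
  then show ?thesis using A assms(2,3) inside by (simp add: hol_calc_def)
qed

end

theory Submission
  imports Defs
begin

text \<open>After shrinking the domain slightly, \<open>f\<close> may be taken analytic on the closed domain \<open>K\<close>. Put
  \<open>\<tau>\<^sub>0(z) = z\<close> and \<open>\<tau>\<^sub>i(z) = 1/(z - c\<^sub>i)\<close>, so that \<open>K\<close> is the set where \<open>\<bar>\<tau>\<^sub>i\<bar> \<le> \<rho>\<^sub>i\<close> for all \<open>i\<close>, and
  \<open>\<parallel>\<tau>\<^sub>i(A)\<parallel> < \<rho>\<^sub>i\<close>. Laurent decomposition and reflection in the \<open>i\<close>-th boundary circle give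
  \<open>f = \<Sum>\<^sub>i P\<^sub>i \<circ> \<tau>\<^sub>i\<close> on \<open>K\<close> and \<open>f = P\<^sub>i \<circ> \<tau>\<^sub>i + cnj (Q\<^sub>i \<circ> \<tau>\<^sub>i)\<close> on the \<open>i\<close>-th circle with analytic \<open>P\<^sub>i, Q\<^sub>i\<close>.
  With \<open>h = \<Sum>\<^sub>i Q\<^sub>i \<circ> \<tau>\<^sub>i\<close>, von Neumann's inequality for harmonic functions yields
  \<open>\<parallel>f(A) + h(A)\<^sup>*\<parallel> \<le> (n + 1) \<parallel>f\<parallel>\<close>, while on each circle all but one of the \<open>n + 1\<close> harmonic functions
  contribute to \<open>h\<close>, so \<open>\<parallel>h\<parallel> \<le> n \<parallel>f\<parallel>\<close> by the maximum principle. If \<open>k\<close> is the supremum of \<open>\<parallel>f(A)\<parallel>\<close> over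
  \<open>\<parallel>f\<parallel> \<le> 1\<close>, then expanding \<open>f(A) f(A)\<^sup>* f(A)\<close> gives \<open>k\<^sup>3 \<le> (n + 1) k\<^sup>2 + n k\<close>, which is the bound.\<close>

section \<open>The operator norm\<close>

text \<open>Von Neumann's inequality controls functions of a single contraction, and the parts P_i
  may each be much larger than f. What is bounded by sup |f| is P_i + cnj Q_i, because its values on
  the circle |w| = rho_i are values of f. The price is the adjoint of h(A), of which only sup |h| is
  known. The triple product is chosen because ||M M^* M|| = ||M||^3, while M h(A) M = (f h f)(A) is
  again a value of the calculus and hence at most n k: the adjoint has disappeared. Dividing by k
  gives k^2 <= (n + 1) k + n, whose positive root is the stated constant. The supremum k is taken
  for one fixed matrix, where it is finite because residues are bounded by sup |f|; uniformity in
  the matrix comes at the end, as the root depends on n alone. The harmonic form of von Neumann's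
  inequality is obtained without dilations, from the positive operator Poisson kernel, sampled at
  roots of unity so that integrals become finite sums.\<close>

lemma eucl_norm_nonneg [simp]: "0 \<le> eucl_norm v"
  by (simp add: eucl_norm_def)

lemma cscalar_prod_self: "v \<bullet>c v = complex_of_real ((eucl_norm v)\<^sup>2)"
  by (simp add: eucl_norm_def L2_set_def scalar_prod_def sum_nonneg complex_norm_square
      flip: of_real_power atLeast0LessThan)

lemma eucl_norm_smult: "eucl_norm (a \<cdot>\<^sub>v v) = cmod a * eucl_norm v"
  unfolding eucl_norm_def
  by (subst L2_set_right_distrib) (auto intro!: L2_set_cong simp: norm_mult)

lemma eucl_norm_triangle:
  assumes "v \<in> carrier_vec d" "w \<in> carrier_vec d"
  shows "eucl_norm (v + w) \<le> eucl_norm v + eucl_norm w"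
proof -
  have "eucl_norm (v + w) \<le> L2_set (\<lambda>i. cmod (v $ i) + cmod (w $ i)) {..<d}"
    unfolding eucl_norm_def using assms
    by (auto intro!: L2_set_mono norm_triangle_ineq)
  also have "\<dots> \<le> eucl_norm v + eucl_norm w"
    unfolding eucl_norm_def using assms L2_set_triangle_ineq by simp
  finally show ?thesis .
qed

lemma eucl_norm_eq_0_iff: "v \<in> carrier_vec d \<Longrightarrow> eucl_norm v = 0 \<longleftrightarrow> v = 0\<^sub>v d"
  by (auto simp: eucl_norm_def L2_set_eq_0_iff intro!: eq_vecI)

lemma cscalar_prod_le:
  assumes "v \<in> carrier_vec d" "w \<in> carrier_vec d"
  shows "cmod (v \<bullet>c w) \<le> eucl_norm v * eucl_norm w"
proof -
  have "cmod (v \<bullet>c w) \<le> (\<Sum>i\<in>{0..<d}. \<bar>cmod (v $ i)\<bar> * \<bar>cmod (w $ i)\<bar>)"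
    unfolding scalar_prod_def using assms
    by (auto intro!: sum_norm_le simp: norm_mult)
  also have "\<dots> \<le> eucl_norm v * eucl_norm w"
    unfolding eucl_norm_def
    using assms L2_set_mult_ineq[of "\<lambda>i. cmod (v $ i)" "\<lambda>i. cmod (w $ i)" "{..<d}"]
    by (simp add: atLeast0LessThan)
  finally show ?thesis .
qed

lemma eucl_norm_mult_mat_vec_bounded:
  assumes A: "A \<in> carrier_mat m d"
  obtains C where "\<And>v. v \<in> carrier_vec d \<Longrightarrow> eucl_norm (A *\<^sub>v v) \<le> C * eucl_norm v"
proof
  fix v :: "complex vec" assume v: "v \<in> carrier_vec d"
  have "eucl_norm (A *\<^sub>v v) \<le> (\<Sum>i<m. cmod ((A *\<^sub>v v) $ i))"
    using A by (simp add: eucl_norm_def L2_set_le_sum del: index_mult_mat_vec)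
  also have "\<dots> \<le> (\<Sum>i<m. (\<Sum>j<d. cmod (A $$ (i, j))) * eucl_norm v)"
  proof (rule sum_mono)
    fix i assume i: "i \<in> {..<m}"
    have "cmod ((A *\<^sub>v v) $ i) \<le> (\<Sum>j<d. cmod (A $$ (i, j)) * cmod (v $ j))"
      using A v i by (auto simp: scalar_prod_def atLeast0LessThan norm_mult intro!: sum_norm_le)
    also have "\<dots> \<le> (\<Sum>j<d. cmod (A $$ (i, j)) * eucl_norm v)"
      using v by (auto intro!: sum_mono mult_left_mono simp: eucl_norm_def intro: member_le_L2_set)
    finally show "cmod ((A *\<^sub>v v) $ i) \<le> (\<Sum>j<d. cmod (A $$ (i, j))) * eucl_norm v"
      by (simp add: sum_distrib_right)
  qed
  finally show "eucl_norm (A *\<^sub>v v) \<le> (\<Sum>i<m. \<Sum>j<d. cmod (A $$ (i, j))) * eucl_norm v"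
    by (simp add: sum_distrib_right)
qed

lemma op_norm_set_bdd:
  assumes "A \<in> carrier_mat m d"
  shows "bdd_above {eucl_norm (A *\<^sub>v v) | v. v \<in> carrier_vec (dim_col A) \<and> eucl_norm v \<le> 1}"
proof -
  obtain C where C: "\<And>v. v \<in> carrier_vec d \<Longrightarrow> eucl_norm (A *\<^sub>v v) \<le> C * eucl_norm v"
    using eucl_norm_mult_mat_vec_bounded[OF assms] by blast
  have "eucl_norm (A *\<^sub>v v) \<le> \<bar>C\<bar>" if "v \<in> carrier_vec d" "eucl_norm v \<le> 1" for v
    using C[OF that(1)] mult_mono[of C "\<bar>C\<bar>" "eucl_norm v" 1] that(2) by force
  with assms show ?thesis unfolding bdd_above_def by auto
qed

lemma eucl_norm_zero_vec [simp]: "eucl_norm (0\<^sub>v d) = 0"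
  using eucl_norm_eq_0_iff[of "0\<^sub>v d" d] by simp

lemma op_norm_nonneg [simp]: "0 \<le> op_norm A"
proof -
  have "A \<in> carrier_mat (dim_row A) (dim_col A)" by simp
  from op_norm_set_bdd[OF this] show ?thesis
    unfolding op_norm_def
    by (intro cSup_upper2[where x = "eucl_norm (A *\<^sub>v 0\<^sub>v (dim_col A))"]) (auto intro!: exI[of _ "0\<^sub>v (dim_col A)"])
qed

lemma eucl_norm_mult_mat_vec_le:
  assumes A: "A \<in> carrier_mat m d" and v: "v \<in> carrier_vec d"
  shows "eucl_norm (A *\<^sub>v v) \<le> op_norm A * eucl_norm v"
proof (cases "eucl_norm v = 0")
  case True
  with v have "v = 0\<^sub>v d" using eucl_norm_eq_0_iff by blast
  then have "A *\<^sub>v v = 0\<^sub>v m" using A by auto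
  then show ?thesis by simp
next
  case False
  let ?a = "complex_of_real (inverse (eucl_norm v))"
  have "eucl_norm (A *\<^sub>v (?a \<cdot>\<^sub>v v)) \<le> op_norm A"
    unfolding op_norm_def using False v A
    by (intro cSup_upper[OF _ op_norm_set_bdd[OF A]]) (auto simp: eucl_norm_smult norm_inverse)
  also have "A *\<^sub>v (?a \<cdot>\<^sub>v v) = ?a \<cdot>\<^sub>v (A *\<^sub>v v)" using A v by (rule mult_mat_vec)
  finally show ?thesis using False
    by (simp add: eucl_norm_smult norm_inverse norm_divide field_simps less_le)
qed

lemma op_norm_le:
  assumes A: "A \<in> carrier_mat m d" and b: "0 \<le> b"
    and le: "\<And>v. v \<in> carrier_vec d \<Longrightarrow> eucl_norm (A *\<^sub>v v) \<le> b * eucl_norm v"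
  shows "op_norm A \<le> b"
  unfolding op_norm_def
proof (rule cSup_least)
  show "{eucl_norm (A *\<^sub>v v) | v. v \<in> carrier_vec (dim_col A) \<and> eucl_norm v \<le> 1} \<noteq> {}"
    by (auto intro!: exI[of _ "0\<^sub>v (dim_col A)"])
  fix x assume "x \<in> {eucl_norm (A *\<^sub>v v) | v. v \<in> carrier_vec (dim_col A) \<and> eucl_norm v \<le> 1}"
  then obtain v where v: "x = eucl_norm (A *\<^sub>v v)" "v \<in> carrier_vec d" "eucl_norm v \<le> 1"
    using A by auto
  then show "x \<le> b"
    using le[of v] mult_left_mono[OF v(3) b] by simp
qed

lemma op_norm_mult_le:
  assumes A: "A \<in> carrier_mat m d" and B: "B \<in> carrier_mat d k"
  shows "op_norm (A * B) \<le> op_norm A * op_norm B"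
proof (rule op_norm_le[of _ m k])
  fix v :: "complex vec" assume v: "v \<in> carrier_vec k"
  have "eucl_norm ((A * B) *\<^sub>v v) \<le> op_norm A * eucl_norm (B *\<^sub>v v)"
    using A B v by (auto intro!: eucl_norm_mult_mat_vec_le simp: assoc_mult_mat_vec)
  also have "\<dots> \<le> op_norm A * (op_norm B * eucl_norm v)"
    using B v by (intro mult_left_mono eucl_norm_mult_mat_vec_le) auto
  finally show "eucl_norm ((A * B) *\<^sub>v v) \<le> op_norm A * op_norm B * eucl_norm v" by simp
qed (use A B in auto)

lemma op_norm_add_le:
  assumes A: "A \<in> carrier_mat m d" and B: "B \<in> carrier_mat m d"
  shows "op_norm (A + B) \<le> op_norm A + op_norm B"
proof (rule op_norm_le[of _ m d])
  fix v :: "complex vec" assume v: "v \<in> carrier_vec d"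
  have "eucl_norm ((A + B) *\<^sub>v v) \<le> eucl_norm (A *\<^sub>v v) + eucl_norm (B *\<^sub>v v)"
    using A B v by (auto intro!: eucl_norm_triangle[of _ m] simp: add_mult_distrib_mat_vec)
  also have "\<dots> \<le> (op_norm A + op_norm B) * eucl_norm v"
    using eucl_norm_mult_mat_vec_le[OF A v] eucl_norm_mult_mat_vec_le[OF B v]
    by (simp add: distrib_right)
  finally show "eucl_norm ((A + B) *\<^sub>v v) \<le> (op_norm A + op_norm B) * eucl_norm v" .
qed (use A B in \<open>auto simp: add_nonneg_nonneg\<close>)

lemma smult_mat_mult_mat_vec:
  fixes A :: "'a :: comm_ring_1 mat"
  assumes "A \<in> carrier_mat m d" "v \<in> carrier_vec d"
  shows "(a \<cdot>\<^sub>m A) *\<^sub>v v = a \<cdot>\<^sub>v (A *\<^sub>v v)"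
  using assms by (intro eq_vecI) (auto simp: scalar_prod_def sum_distrib_left mult.assoc)

lemma op_norm_smult_le:
  assumes A: "A \<in> carrier_mat m d"
  shows "op_norm (a \<cdot>\<^sub>m A) \<le> cmod a * op_norm A"
proof (rule op_norm_le[of _ m d])
  fix v :: "complex vec" assume v: "v \<in> carrier_vec d"
  have "(a \<cdot>\<^sub>m A) *\<^sub>v v = a \<cdot>\<^sub>v (A *\<^sub>v v)"
    using A v by (rule smult_mat_mult_mat_vec)
  then show "eucl_norm ((a \<cdot>\<^sub>m A) *\<^sub>v v) \<le> cmod a * op_norm A * eucl_norm v"
    using eucl_norm_mult_mat_vec_le[OF A v] by (simp add: eucl_norm_smult mult_left_mono mult.assoc)
qed (use A in auto)

text \<open>When \<open>A v\<close> is nonzero, take \<open>x\<close> and \<open>y\<close> to be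
  \<open>v\<close> and \<open>A v\<close> normalised. This reduces operator inequalities to scalar
  ones, where a matrix and the adjoint of another one are tested on the same pair of unit
  vectors.\<close>

lemma op_norm_le_cscalar_prod:
  assumes A: "A \<in> carrier_mat m d" and b: "0 \<le> b"
    and le: "\<And>x y. x \<in> carrier_vec d \<Longrightarrow> y \<in> carrier_vec m \<Longrightarrow> eucl_norm x = 1 \<Longrightarrow> eucl_norm y = 1
      \<Longrightarrow> cmod ((A *\<^sub>v x) \<bullet>c y) \<le> b"
  shows "op_norm A \<le> b"
proof (rule op_norm_le[OF A b])
  fix v :: "complex vec" assume v: "v \<in> carrier_vec d"
  show "eucl_norm (A *\<^sub>v v) \<le> b * eucl_norm v"
  proof (cases "eucl_norm (A *\<^sub>v v) = 0")
    case True
    then show ?thesis using b by simp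
  next
    case False
    define w where "w = A *\<^sub>v v"
    have w: "w \<in> carrier_vec m" "eucl_norm w > 0" using A v False by (auto simp: w_def less_le)
    have "eucl_norm v \<noteq> 0"
      using eucl_norm_mult_mat_vec_le[OF A v] False eucl_norm_nonneg[of "A *\<^sub>v v"] by (intro notI) simp
    then have nv: "eucl_norm v > 0" by (simp add: less_le)
    define x where "x = complex_of_real (inverse (eucl_norm v)) \<cdot>\<^sub>v v"
    define y where "y = complex_of_real (inverse (eucl_norm w)) \<cdot>\<^sub>v w"
    have xy: "x \<in> carrier_vec d" "y \<in> carrier_vec m" "eucl_norm x = 1" "eucl_norm y = 1"
      using v w nv by (auto simp: x_def y_def eucl_norm_smult norm_inverse)
    have "A *\<^sub>v x = complex_of_real (inverse (eucl_norm v)) \<cdot>\<^sub>v w"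
      unfolding x_def w_def using A v by (rule mult_mat_vec)
    then have "(A *\<^sub>v x) \<bullet>c y = complex_of_real (inverse (eucl_norm v) * inverse (eucl_norm w) * (eucl_norm w)\<^sup>2)"
      using w by (simp add: y_def conjugate_smult_vec cscalar_prod_self)
    also have "\<dots> = complex_of_real (eucl_norm w / eucl_norm v)"
      using w by (simp add: field_simps power2_eq_square)
    finally have "eucl_norm w / eucl_norm v \<le> b"
      using le[OF xy] w nv by (simp add: norm_divide)
    then show ?thesis using nv by (simp add: w_def field_simps)
  qed
qed

text \<open>Deliberately crude: the calculus is defined entrywise through residues, and this turns
  entrywise bounds into a norm bound whose size never enters the final constant.\<close>

lemma op_norm_le_entries:
  assumes A: "A \<in> carrier_mat m d" and b: "0 \<le> b"
    and le: "\<And>i j. i < m \<Longrightarrow> j < d \<Longrightarrow> cmod (A $$ (i, j)) \<le> b"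
  shows "op_norm A \<le> real m * real d * b"
proof (rule op_norm_le[OF A])
  fix v :: "complex vec" assume v: "v \<in> carrier_vec d"
  have "eucl_norm (A *\<^sub>v v) \<le> (\<Sum>i<m. cmod ((A *\<^sub>v v) $ i))"
    using A by (simp add: eucl_norm_def L2_set_le_sum del: index_mult_mat_vec)
  also have "\<dots> \<le> (\<Sum>i<m. real d * b * eucl_norm v)"
  proof (rule sum_mono)
    fix i assume i: "i \<in> {..<m}"
    have "cmod ((A *\<^sub>v v) $ i) \<le> (\<Sum>j<d. cmod (A $$ (i, j)) * cmod (v $ j))"
      using A v i by (auto simp: scalar_prod_def atLeast0LessThan norm_mult intro!: sum_norm_le)
    also have "\<dots> \<le> (\<Sum>j<d. b * eucl_norm v)"
      using v i b le by (intro sum_mono mult_mono) (auto simp: eucl_norm_def intro: member_le_L2_set)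
    finally show "cmod ((A *\<^sub>v v) $ i) \<le> real d * b * eucl_norm v"
      by simp
  qed
  finally show "eucl_norm (A *\<^sub>v v) \<le> real m * real d * b * eucl_norm v" by simp
qed (use b in auto)

section \<open>Adjoints and the C*-identity\<close>

lemma dim_mat_adjoint [simp]: "dim_row (mat_adjoint A) = dim_col A" "dim_col (mat_adjoint A) = dim_row A"
  by (auto simp: mat_adjoint_def)

lemma mat_adjoint_carrier [simp]: "A \<in> carrier_mat m d \<Longrightarrow> mat_adjoint A \<in> carrier_mat d m"
  by (auto simp: mat_adjoint_def)

lemma mat_adjoint_index:
  fixes A :: "complex mat"
  shows "A \<in> carrier_mat m d \<Longrightarrow> i < d \<Longrightarrow> j < m \<Longrightarrow> mat_adjoint A $$ (i, j) = cnj (A $$ (j, i))"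
  by (auto simp: mat_adjoint_def mat_of_rows_index)

lemma cscalar_prod_commute:
  fixes v :: "complex vec"
  shows "v \<in> carrier_vec d \<Longrightarrow> w \<in> carrier_vec d \<Longrightarrow> w \<bullet>c v = cnj (v \<bullet>c w)"
  by (auto simp: scalar_prod_def mult.commute)

lemma cscalar_prod_mat_adjoint:
  fixes A :: "complex mat"
  assumes A: "A \<in> carrier_mat m d" and x: "x \<in> carrier_vec m" and y: "y \<in> carrier_vec d"
  shows "(mat_adjoint A *\<^sub>v x) \<bullet>c y = x \<bullet>c (A *\<^sub>v y)"
proof -
  have "(mat_adjoint A *\<^sub>v x) \<bullet>c y = (\<Sum>i=0..<d. \<Sum>j=0..<m. cnj (A $$ (j, i)) * x $ j * cnj (y $ i))"
    using assms mat_adjoint_carrier[OF A]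
    by (auto simp: scalar_prod_def sum_distrib_right mat_adjoint_index[OF A] intro!: sum.cong)
  also have "\<dots> = (\<Sum>j=0..<m. \<Sum>i=0..<d. cnj (A $$ (j, i)) * x $ j * cnj (y $ i))"
    by (rule sum.swap)
  also have "\<dots> = x \<bullet>c (A *\<^sub>v y)"
    using assms by (auto simp: scalar_prod_def sum_distrib_left intro!: sum.cong)
  finally show ?thesis .
qed

lemma op_norm_mat_adjoint_le:
  assumes A: "A \<in> carrier_mat m d"
  shows "op_norm (mat_adjoint A) \<le> op_norm A"
proof (rule op_norm_le_cscalar_prod[OF mat_adjoint_carrier[OF A]])
  fix x y :: "complex vec"
  assume xy: "x \<in> carrier_vec m" "y \<in> carrier_vec d" "eucl_norm x = 1" "eucl_norm y = 1"
  have "cmod ((mat_adjoint A *\<^sub>v x) \<bullet>c y) \<le> eucl_norm x * eucl_norm (A *\<^sub>v y)"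
    unfolding cscalar_prod_mat_adjoint[OF A xy(1,2)] using A xy by (intro cscalar_prod_le) auto
  then show "cmod ((mat_adjoint A *\<^sub>v x) \<bullet>c y) \<le> op_norm A"
    using eucl_norm_mult_mat_vec_le[OF A xy(2)] xy by simp
qed simp

text \<open>The nontrivial half of the C*-identity: \<open>|A v|^2\<close> is the form of
  \<open>A^* A\<close> at \<open>v\<close>, and Cauchy-Schwarz bounds it.\<close>

lemma op_norm_sq_le_adjoint_mult:
  assumes A: "A \<in> carrier_mat m d"
  shows "(op_norm A)\<^sup>2 \<le> op_norm (mat_adjoint A * A)"
proof -
  have "op_norm A \<le> sqrt (op_norm (mat_adjoint A * A))"
  proof (rule op_norm_le[OF A])
    fix v :: "complex vec" assume v: "v \<in> carrier_vec d"
    have "complex_of_real ((eucl_norm (A *\<^sub>v v))\<^sup>2) = (mat_adjoint A *\<^sub>v (A *\<^sub>v v)) \<bullet>c v"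
      unfolding cscalar_prod_self[symmetric] using A v by (simp add: cscalar_prod_mat_adjoint)
    also have "\<dots> = ((mat_adjoint A * A) *\<^sub>v v) \<bullet>c v"
      using A v assoc_mult_mat_vec[OF mat_adjoint_carrier[OF A] A v] by simp
    finally have "(eucl_norm (A *\<^sub>v v))\<^sup>2 = cmod (((mat_adjoint A * A) *\<^sub>v v) \<bullet>c v)"
      by (metis norm_of_real abs_of_nonneg zero_le_power2)
    also have "\<dots> \<le> eucl_norm ((mat_adjoint A * A) *\<^sub>v v) * eucl_norm v"
      using v mult_carrier_mat[OF mat_adjoint_carrier[OF A] A]
      by (intro cscalar_prod_le[of _ d] mult_mat_vec_carrier)
    also have "\<dots> \<le> (op_norm (mat_adjoint A * A) * eucl_norm v) * eucl_norm v"
      using A v mat_adjoint_carrier[OF A] by (intro mult_right_mono eucl_norm_mult_mat_vec_le[of _ d d]) auto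
    finally have "eucl_norm (A *\<^sub>v v) \<le> sqrt (op_norm (mat_adjoint A * A) * (eucl_norm v)\<^sup>2)"
      by (simp add: real_le_rsqrt power2_eq_square mult.assoc)
    then show "eucl_norm (A *\<^sub>v v) \<le> sqrt (op_norm (mat_adjoint A * A)) * eucl_norm v"
      by (simp add: real_sqrt_mult)
  qed simp
  then have "(op_norm A)\<^sup>2 \<le> (sqrt (op_norm (mat_adjoint A * A)))\<^sup>2"
    by (intro power_mono) auto
  then show ?thesis by simp
qed

text \<open>Apply the previous inequality to \<open>A\<close> and to the self-adjoint
  \<open>A^* A\<close>: \<open>|A|^4 \<le> |A^* A A^* A| \<le> |A| |A A^* A|\<close>, then cancel
  \<open>|A|\<close>.\<close>

lemma op_norm_cube_le:
  assumes A: "A \<in> carrier_mat d d"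
  shows "op_norm A ^ 3 \<le> op_norm (A * mat_adjoint A * A)"
proof (cases "op_norm A = 0")
  case False
  let ?B = "mat_adjoint A"
  note B = mat_adjoint_carrier[OF A]
  have N: "op_norm A > 0" using False by (simp add: less_le)
  have BA: "?B * A \<in> carrier_mat d d" by (rule mult_carrier_mat[OF B A])
  have adj: "mat_adjoint (?B * A) = ?B * A"
  proof (rule eq_matI)
    fix i j assume ij: "i < dim_row (?B * A)" "j < dim_col (?B * A)"
    then have "mat_adjoint (?B * A) $$ (i, j) = cnj ((?B * A) $$ (j, i))"
      using BA by (intro mat_adjoint_index) auto
    also have "\<dots> = (?B * A) $$ (i, j)"
      using A B ij by (auto simp: mat_adjoint_index[OF A] scalar_prod_def mult.commute intro!: sum.cong)
    finally show "mat_adjoint (?B * A) $$ (i, j) = (?B * A) $$ (i, j)" .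
  qed (use A B in \<open>auto simp: mat_adjoint_def\<close>)
  have "(op_norm A)^4 = ((op_norm A)\<^sup>2)\<^sup>2" by simp
  also have "\<dots> \<le> (op_norm (?B * A))\<^sup>2"
    using op_norm_sq_le_adjoint_mult[OF A] by (rule power_mono) simp
  also have "\<dots> \<le> op_norm (mat_adjoint (?B * A) * (?B * A))"
    using A B by (intro op_norm_sq_le_adjoint_mult[of _ d d]) auto
  also have "mat_adjoint (?B * A) * (?B * A) = ?B * (A * ?B * A)"
    unfolding adj using assoc_mult_mat[OF B A BA] assoc_mult_mat[OF A B A] by simp
  also have "op_norm \<dots> \<le> op_norm ?B * op_norm (A * ?B * A)"
    using A B by (intro op_norm_mult_le[of _ d d _ d]) auto
  also have "\<dots> \<le> op_norm A * op_norm (A * ?B * A)"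
    using op_norm_mat_adjoint_le[OF A] by (intro mult_right_mono) auto
  finally have "op_norm A * op_norm A ^ 3 \<le> op_norm A * op_norm (A * ?B * A)"
    by (simp add: eval_nat_numeral)
  then show ?thesis using N by simp
qed simp

section \<open>Splitting off a hole\<close>

lemma holomorphic_on_Cauchy_integral_circlepath:
  assumes "continuous_on (sphere c \<rho>) f" "0 < \<rho>"
  shows "(\<lambda>z. contour_integral (circlepath c \<rho>) (\<lambda>w. f w / (w - z))) holomorphic_on - sphere c \<rho>"
proof -
  have cont: "continuous_on (path_image (circlepath c \<rho>)) f"
    using assms by simp
  \<comment> \<open>The trivial power \<open>^1\<close> puts the kernel in the shape of the general
    differentiation rule for \<open>1 / (w - z)^k\<close>.\<close>
  have int: "((\<lambda>w. f w / (w - z)^1) has_contour_integral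
      contour_integral (circlepath c \<rho>) (\<lambda>w. f w / (w - z))) (circlepath c \<rho>)"
    if "z \<in> UNIV - path_image (circlepath c \<rho>)" for z
    unfolding power_one_right
    by (intro has_contour_integral_integral contour_integrable_continuous_circlepath
        continuous_intros cont) (use that in auto)
  have leB: "norm (vector_derivative (circlepath c \<rho>) (at t)) \<le> 2 * pi * \<rho>" for t
    using assms by (simp add: vector_derivative_circlepath norm_mult)
  have "\<exists>D. ((\<lambda>z. contour_integral (circlepath c \<rho>) (\<lambda>w. f w / (w - z))) has_field_derivative D) (at z)"
    if "z \<in> - sphere c \<rho>" for z
    using Cauchy_next_derivative(2)[OF cont leB int, where w = z] that assms by fastforce
  then show ?thesis
    by (subst holomorphic_on_open) auto
qed

text \<open>The radial straight-line homotopy between the circles stays in the annulus: the distance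
  of its points from \<open>c\<close> is a convex combination of the two radii.\<close>

lemma contour_integral_circlepath_annulus:
  assumes f: "f holomorphic_on U" and U: "open U"
    and sub: "\<And>z. \<rho> \<le> dist c z \<Longrightarrow> dist c z \<le> \<sigma> \<Longrightarrow> z \<in> U" and \<rho>: "0 < \<rho>" "\<rho> \<le> \<sigma>"
  shows "contour_integral (circlepath c \<rho>) f = contour_integral (circlepath c \<sigma>) f"
proof (rule Cauchy_theorem_homotopic_loops[OF _ U f])
  show "homotopic_loops U (circlepath c \<rho>) (circlepath c \<sigma>)"
  proof (rule homotopic_loops_linear)
    fix t x :: real
    show "closed_segment (circlepath c \<rho> t) (circlepath c \<sigma> t) \<subseteq> U"
    proof
      fix z assume "z \<in> closed_segment (circlepath c \<rho> t) (circlepath c \<sigma> t)"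
      then obtain u where u: "0 \<le> u" "u \<le> 1" and
        z: "z = (1 - u) *\<^sub>R circlepath c \<rho> t + u *\<^sub>R circlepath c \<sigma> t"
        by (auto simp: closed_segment_def)
      have z': "z - c = of_real ((1 - u) * \<rho> + u * \<sigma>) * exp (2 * pi * \<i> * t)"
        unfolding z circlepath by (simp add: scaleR_conv_of_real algebra_simps)
      have "0 \<le> (1 - u) * \<rho> + u * \<sigma>" using u \<rho> by simp
      then have "dist c z = (1 - u) * \<rho> + u * \<sigma>"
        using arg_cong[OF z', of norm] by (simp add: dist_norm norm_minus_commute norm_mult del: of_real_add of_real_mult)
      moreover have "\<rho> \<le> (1 - u) * \<rho> + u * \<sigma>"
        using mult_left_mono[OF \<rho>(2) u(1)] by (simp add: algebra_simps)
      moreover have "(1 - u) * \<rho> + u * \<sigma> \<le> \<sigma>"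
        using mult_left_mono[OF \<rho>(2), of "1 - u"] u by (simp add: algebra_simps)
      ultimately show "z \<in> U" by (intro sub) auto
    qed
  qed auto
qed auto

text \<open>The difference quotient of \<open>f\<close> at \<open>z\<close> extends holomorphically
  across \<open>z\<close>, so its integrals over both circles agree. By the winding numbers 1 and 0,
  the term \<open>f z\<close> survives on the outer circle only.\<close>

lemma Cauchy_integral_formula_annulus:
  assumes f: "f holomorphic_on U" and U: "open U"
    and sub: "\<And>z. \<rho> \<le> dist c z \<Longrightarrow> dist c z \<le> \<sigma> \<Longrightarrow> z \<in> U" and \<rho>: "0 < \<rho>"
    and z: "\<rho> < dist c z" "dist c z < \<sigma>"
  shows "2 * pi * \<i> * f z = contour_integral (circlepath c \<sigma>) (\<lambda>w. f w / (w - z))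
      - contour_integral (circlepath c \<rho>) (\<lambda>w. f w / (w - z))"
proof -
  have zU: "z \<in> U" using sub z by simp
  define F where "F w = (if w = z then deriv f z else (f w - f z) / (w - z))" for w
  have F: "F holomorphic_on U"
    unfolding F_def using f U by (rule pole_lemma_open)
  have \<rho>\<sigma>: "\<rho> \<le> \<sigma>" using z by simp
  have fc: "continuous_on (sphere c s) f" if "\<rho> \<le> s" "s \<le> \<sigma>" for s
    using sub that by (intro holomorphic_on_imp_continuous_on holomorphic_on_subset[OF f]) auto
  have eq: "contour_integral (circlepath c s) F =
      contour_integral (circlepath c s) (\<lambda>w. f w / (w - z)) - f z * contour_integral (circlepath c s) (\<lambda>w. 1 / (w - z))"
    if s: "s = \<rho> \<or> s = \<sigma>" for s
  proof -
    have s': "0 < s" "\<rho> \<le> s" "s \<le> \<sigma>" "dist c z \<noteq> s" using s \<rho> z by auto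
    have "contour_integral (circlepath c s) F = contour_integral (circlepath c s) (\<lambda>w. f w / (w - z) - f z * (1 / (w - z)))"
      using s' by (intro contour_integral_cong) (auto simp: F_def diff_divide_distrib)
    also have "\<dots> = contour_integral (circlepath c s) (\<lambda>w. f w / (w - z)) - contour_integral (circlepath c s) (\<lambda>w. f z * (1 / (w - z)))"
      using s' by (intro contour_integral_diff contour_integrable_continuous_circlepath continuous_intros) (auto intro: fc)
    also have "contour_integral (circlepath c s) (\<lambda>w. f z * (1 / (w - z))) = f z * contour_integral (circlepath c s) (\<lambda>w. 1 / (w - z))"
      using s' by (intro contour_integral_lmul contour_integrable_continuous_circlepath continuous_intros) auto
    finally show ?thesis .
  qed
  have "contour_integral (circlepath c s) (\<lambda>w. 1 / (w - z)) = 2 * pi * \<i> * winding_number (circlepath c s) z"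
    if "s = \<rho> \<or> s = \<sigma>" for s
    using that \<rho> z by (subst winding_number_valid_path) auto
  moreover have "winding_number (circlepath c \<rho>) z = 0"
    using \<rho> z by (intro winding_number_zero_outside[of _ "cball c \<rho>"]) auto
  moreover have "winding_number (circlepath c \<sigma>) z = 1"
    using z by (intro winding_number_circlepath) (auto simp: dist_norm norm_minus_commute)
  ultimately have "contour_integral (circlepath c \<rho>) F = contour_integral (circlepath c \<rho>) (\<lambda>w. f w / (w - z))"
    "contour_integral (circlepath c \<sigma>) F = contour_integral (circlepath c \<sigma>) (\<lambda>w. f w / (w - z)) - f z * (2 * pi * \<i>)"
    by (simp_all add: eq)
  with contour_integral_circlepath_annulus[OF F U sub \<rho> \<rho>\<sigma>] show ?thesis
    by (simp add: algebra_simps)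
qed

text \<open>By compactness some \<open>e\<close>-neighbourhood of the circle lies in
  \<open>U\<close>, and the distance of a point to its radial projection is the difference of the
  radii. Capping \<open>\<delta>\<close> at \<open>r / 2\<close> keeps the inner radius
  positive.\<close>

lemma sphere_nbhd_annulus:
  fixes c :: complex
  assumes "open U" "sphere c r \<subseteq> U" "0 < r"
  obtains \<delta> where "0 < \<delta>" "\<delta> < r" "\<And>z. r - \<delta> \<le> dist c z \<Longrightarrow> dist c z \<le> r + \<delta> \<Longrightarrow> z \<in> U"
proof -
  obtain e where e: "e > 0" "(\<Union>x\<in>sphere c r. cball x e) \<subseteq> U"
    using compact_subset_open_imp_cball_epsilon_subset[OF compact_sphere assms(1,2)] by blast
  define \<delta> where "\<delta> = min e (r / 2)"
  have \<delta>: "0 < \<delta>" "\<delta> < r" "\<delta> \<le> e" using e assms by (auto simp: \<delta>_def)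
  show ?thesis
  proof (rule that[OF \<delta>(1,2)])
    fix z assume z: "r - \<delta> \<le> dist c z" "dist c z \<le> r + \<delta>"
    define t where "t = cmod (z - c)"
    have t: "t > 0" "\<bar>t - r\<bar> \<le> \<delta>" using z \<delta> by (auto simp: t_def dist_norm norm_minus_commute)
    define x where "x = c + of_real (r / t) * (z - c)"
    have "x \<in> sphere c r" using t assms(3) by (simp add: x_def dist_norm norm_mult norm_divide t_def)
    have "x - z = of_real (r / t - 1) * (z - c)" by (simp add: x_def algebra_simps)
    then have "dist x z = \<bar>r / t - 1\<bar> * t" by (simp add: dist_norm norm_mult t_def del: of_real_diff of_real_divide)
    then have "dist x z = \<bar>(r / t - 1) * t\<bar>" using t by (simp add: abs_mult)
    also have "(r / t - 1) * t = r - t" using t by (simp add: field_simps)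
    finally have "z \<in> cball x e" using t \<delta> by simp
    with \<open>x \<in> sphere c r\<close> show "z \<in> U" using e by blast
  qed
qed

text \<open>Laurent splitting: of the two Cauchy integrals bounding an annulus around the hole, the
  outer one extends into the hole, and the inner one extends to infinity, which is 0 in the variable
  \<open>1 / (z - c)\<close>. \<open>S\<close> need not be a disk, so that holes can be split off
  one at a time.\<close>

lemma analytic_on_split_hole:
  assumes f: "f analytic_on (S - ball c r)" and S: "sphere c r \<subseteq> S" and r: "0 < r"
  obtains g F where "g analytic_on S" "F analytic_on cball 0 (1 / r)"
    "\<And>z. z \<in> S - ball c r \<Longrightarrow> f z = g z + F (1 / (z - c))"
proof -
  obtain U where U: "open U" "S - ball c r \<subseteq> U" "f holomorphic_on U"
    using f by (auto simp: analytic_on_holomorphic)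
  have "sphere c r \<subseteq> U" using S U(2) by auto
  then obtain \<delta> where \<delta>: "0 < \<delta>" "\<delta> < r" and ann: "\<And>z. r - \<delta> \<le> dist c z \<Longrightarrow> dist c z \<le> r + \<delta> \<Longrightarrow> z \<in> U"
    using sphere_nbhd_annulus[OF U(1) _ r] by metis
  define \<rho> \<sigma> where "\<rho> = r - \<delta>" and "\<sigma> = r + \<delta>"
  have \<rho>: "0 < \<rho>" "\<rho> < r" "r < \<sigma>" using \<delta> by (auto simp: \<rho>_def \<sigma>_def)
  define I where "I s z = contour_integral (circlepath c s) (\<lambda>w. f w / (w - z)) / (2 * pi * \<i>)" for s z
  have fc: "continuous_on (sphere c s) f" if "\<rho> \<le> s" "s \<le> \<sigma>" for s
    using ann that unfolding \<rho>_def \<sigma>_def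
    by (intro holomorphic_on_imp_continuous_on holomorphic_on_subset[OF U(3)]) auto
  have I: "I s holomorphic_on - sphere c s" if "s = \<rho> \<or> s = \<sigma>" for s
    unfolding I_def using that \<rho> by (intro holomorphic_intros holomorphic_on_Cauchy_integral_circlepath fc) auto
  have f_eq: "f z = I \<sigma> z - I \<rho> z" if "\<rho> < dist c z" "dist c z < \<sigma>" for z
    using Cauchy_integral_formula_annulus[OF U(3,1) ann, of "r - \<delta>" c "r + \<delta>" z] that \<rho>
    by (simp add: I_def \<rho>_def \<sigma>_def field_simps)
  \<comment> \<open>The value 0 at \<open>u = 0\<close> is the limit of the inner Cauchy integral at
    infinity, so the singularity is removable.\<close>
  define F where "F u = (if u = 0 then 0 else - I \<rho> (c + 1 / u))" for u
  \<comment> \<open>Both formulas agree on the annulus by \<open>f_eq\<close>, which makes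
    \<open>g\<close> holomorphic across it.\<close>
  define g where "g z = (if z \<in> ball c \<sigma> then I \<sigma> z else f z + I \<rho> z)" for z
  have "F holomorphic_on ball 0 (1 / \<rho>)"
  proof (rule no_isolated_singularity')
    show "F holomorphic_on ball 0 (1 / \<rho>) - {0}"
    proof -
      have "(\<lambda>u. - I \<rho> (c + 1 / u)) holomorphic_on ball 0 (1 / \<rho>) - {0}"
        using \<rho> by (intro holomorphic_intros holomorphic_on_compose_gen[OF _ I, unfolded o_def])
          (auto simp: dist_norm norm_divide field_simps)
      then show ?thesis by (rule holomorphic_transform) (auto simp: F_def)
    qed
    fix z :: complex assume "z \<in> {0}"
    have "compact (f ` sphere c \<rho>)" using \<rho> by (intro compact_continuous_image fc) auto
    then obtain B where B: "\<And>w. w \<in> sphere c \<rho> \<Longrightarrow> cmod (f w) \<le> B" "B \<ge> 0"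
      by (metis compact_imp_bounded bounded_pos imageI less_le)
    \<comment> \<open>For \<open>|u| < 1 / (2 \<rho>)\<close> the point \<open>c + 1 / u\<close> has
      distance at least \<open>1 / (2 |u|)\<close> from the circle, so the integrand is at most
      \<open>2 B |u|\<close>; the remaining factor is the length of the circle over
      \<open>2 pi\<close>.\<close>
    have bound: "cmod (F u) \<le> 2 * B * \<rho> * cmod u" if u: "u \<in> ball 0 (1 / (2 * \<rho>)) - {0}" for u
    proof -
      have u': "u \<noteq> 0" "2 * \<rho> * cmod u < 1" using u \<rho> by (auto simp: field_simps)
      have "cmod (w - c) \<noteq> \<rho>" if w: "w = c + 1 / u" for w
      proof
        assume "cmod (w - c) = \<rho>"
        then have "1 / cmod u = \<rho>" by (simp add: w norm_divide)
        then show False using u' by (auto simp: field_simps)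
      qed
      then have off: "w - (c + 1 / u) \<noteq> 0" if "dist c w = \<rho>" for w
        using that by (auto simp: dist_norm norm_minus_commute)
      have "cmod (contour_integral (circlepath c \<rho>) (\<lambda>w. f w / (w - (c + 1 / u)))) \<le> (2 * B * cmod u) * (2 * pi * \<rho>)"
      proof (rule has_contour_integral_bound_circlepath)
        show ne: "cmod (f w / (w - (c + 1 / u))) \<le> 2 * B * cmod u" if w: "cmod (w - c) = \<rho>" for w
        proof -
          have "1 / (2 * cmod u) \<le> 1 / cmod u - \<rho>" using u' by (simp add: field_simps)
          also have "\<dots> \<le> cmod (w - (c + 1 / u))"
            using norm_triangle_ineq2[of "1 / u" "w - c"] w by (simp add: norm_divide norm_minus_commute algebra_simps)
          finally have *: "1 / (2 * cmod u) \<le> cmod (w - (c + 1 / u))" .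
          have "cmod (f w / (w - (c + 1 / u))) \<le> B / (1 / (2 * cmod u))"
            unfolding norm_divide using * B w u' by (intro frac_le) (auto simp: dist_norm norm_minus_commute)
          then show ?thesis by simp
        qed
        show "((\<lambda>w. f w / (w - (c + 1 / u))) has_contour_integral
            contour_integral (circlepath c \<rho>) (\<lambda>w. f w / (w - (c + 1 / u)))) (circlepath c \<rho>)"
          using u' \<rho> by (intro has_contour_integral_integral contour_integrable_continuous_circlepath continuous_intros)
            (use off in \<open>auto intro!: fc simp del: diff_add_eq_diff_diff_swap\<close>)
      qed (use B \<rho> in auto)
      then have "cmod (I \<rho> (c + 1 / u)) \<le> 2 * B * \<rho> * cmod u"
        by (simp add: I_def norm_divide norm_mult field_simps)
      then show ?thesis using u' by (simp add: F_def)
    qed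
    have "(F \<longlongrightarrow> 0) (at 0)"
    proof (rule Lim_null_comparison)
      show "\<forall>\<^sub>F u in at 0. norm (F u) \<le> 2 * B * \<rho> * cmod u"
        by (rule eventually_mono[OF eventually_at_in_open[of "ball 0 (1 / (2 * \<rho>))" 0]])
          (use bound \<rho> in auto)
      show "((\<lambda>u::complex. 2 * B * \<rho> * cmod u) \<longlongrightarrow> 0) (at 0)" by (auto intro!: tendsto_eq_intros)
    qed
    then show "(F \<longlongrightarrow> F z) (at z within ball 0 (1 / \<rho>))"
      using \<open>z \<in> {0}\<close> tendsto_mono[OF at_le[OF subset_UNIV], of F 0 0] by (simp add: F_def)
  qed auto
  moreover have "cball 0 (1 / r) \<subseteq> ball (0::complex) (1 / \<rho>)"
    using \<rho> frac_less2[of 1 1 \<rho> r] by (simp add: cball_subset_ball_iff)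
  ultimately have F: "F analytic_on cball 0 (1 / r)"
    unfolding analytic_on_holomorphic by (intro exI[of _ "ball 0 (1 / \<rho>)"]) auto
  have "g holomorphic_on ball c \<sigma> \<union> (U \<inter> - cball c \<rho>)"
  proof (rule holomorphic_on_Un)
    have "I \<sigma> holomorphic_on ball c \<sigma>" by (rule holomorphic_on_subset[OF I]) auto
    then show "g holomorphic_on ball c \<sigma>"
      by (rule holomorphic_transform) (simp add: g_def)
    have "(\<lambda>z. f z + I \<rho> z) holomorphic_on U \<inter> - cball c \<rho>"
      by (intro holomorphic_intros holomorphic_on_subset[OF I] holomorphic_on_subset[OF U(3)]) auto
    then show "g holomorphic_on U \<inter> - cball c \<rho>"
      by (rule holomorphic_transform) (use f_eq in \<open>auto simp: g_def\<close>)
  qed (use U in auto)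
  moreover have "S \<subseteq> ball c \<sigma> \<union> (U \<inter> - cball c \<rho>)"
  proof
    fix z assume "z \<in> S"
    show "z \<in> ball c \<sigma> \<union> (U \<inter> - cball c \<rho>)"
    proof (cases "dist c z < \<sigma>")
      case False
      then have "z \<in> S - ball c r" using \<open>z \<in> S\<close> \<rho> by simp
      then have "z \<in> U" using U(2) by blast
      then show ?thesis using False \<rho> by simp
    qed simp
  qed
  ultimately have g: "g analytic_on S"
    unfolding analytic_on_holomorphic using U(1)
    by (intro exI[of _ "ball c \<sigma> \<union> (U \<inter> - cball c \<rho>)"]) (auto intro: open_Un open_Int)
  have "f z = g z + F (1 / (z - c))" if "z \<in> S - ball c r" for z
    using that f_eq[of z] \<rho> r by (auto simp: F_def g_def)
  with g F show ?thesis by (rule that)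
qed

section \<open>The holomorphic functional calculus\<close>

lemma residue_sum:
  assumes "finite I" "open s" "z \<in> s" "\<And>i. i \<in> I \<Longrightarrow> f i holomorphic_on s - {z}"
  shows "residue (\<lambda>w. \<Sum>i\<in>I. f i w) z = (\<Sum>i\<in>I. residue (f i) z)"
  using assms(1,4)
proof (induction I rule: finite_induct)
  case (insert i I)
  have "residue (\<lambda>w. f i w + (\<Sum>i\<in>I. f i w)) z = residue (f i) z + residue (\<lambda>w. \<Sum>i\<in>I. f i w) z"
    using assms(2,3) insert.prems by (intro residue_add[of s] holomorphic_intros) auto
  then show ?case using insert by simp
qed (simp add: residue_const)

lemma dim_hol_calc [simp]: "dim_row (hol_calc f A) = dim_row A" "dim_col (hol_calc f A) = dim_row A"
  by (simp_all add: hol_calc_def)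

lemma hol_calc_carrier [simp]: "A \<in> carrier_mat d d \<Longrightarrow> hol_calc f A \<in> carrier_mat d d"
  by (simp add: hol_calc_def)

lemma hol_calc_index:
  assumes "A \<in> carrier_mat d d" "i < d" "j < d"
  shows "hol_calc f A $$ (i, j) = (\<Sum>\<mu>\<in>spectrum A. residue (\<lambda>z. f z * resolvent A z $$ (i, j)) \<mu>)"
  using assms by (simp add: hol_calc_def)

text \<open>Deleting the other eigenvalues from \<open>W\<close> leaves \<open>\<mu>\<close> as the
  only singularity, and the set stays open because the spectrum is finite. The rules for residues of
  sums and multiples are applied on this set.\<close>

lemma hol_calc_integrand:
  assumes A: "A \<in> carrier_mat d d" and ij: "i < d" "j < d"
    and f: "f holomorphic_on W" and W: "open W" "spectrum A \<subseteq> W" and \<mu>: "\<mu> \<in> spectrum A"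
  defines "s \<equiv> W - (spectrum A - {\<mu>})"
  shows "open s" "\<mu> \<in> s" "s \<subseteq> W"
    and "(\<lambda>z. f z * resolvent A z $$ (i, j)) holomorphic_on s - {\<mu>}"
proof -
  show "open s" "\<mu> \<in> s" "s \<subseteq> W"
    using W \<mu> card_finite_spectrum(1)[OF A] by (auto simp: s_def intro: open_Diff finite_imp_closed)
  show "(\<lambda>z. f z * resolvent A z $$ (i, j)) holomorphic_on s - {\<mu>}"
    by (intro holomorphic_intros holomorphic_on_subset[OF holomorphic_on_resolvent[OF A ij]]
        holomorphic_on_subset[OF f]) (auto simp: s_def)
qed

text \<open>Residues see only germs at the eigenvalues, so identities that hold just on
  \<open>W\<close>, such as the decomposition of \<open>f\<close>, can be used inside the
  calculus.\<close>

lemma hol_calc_cong: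
  assumes A: "A \<in> carrier_mat d d" and W: "open W" "spectrum A \<subseteq> W"
    and eq: "\<And>z. z \<in> W \<Longrightarrow> f z = g z"
  shows "hol_calc f A = hol_calc g A"
proof -
  have "residue (\<lambda>z. f z * resolvent A z $$ (i, j)) \<mu> = residue (\<lambda>z. g z * resolvent A z $$ (i, j)) \<mu>"
    if "\<mu> \<in> spectrum A" for \<mu> i j
  proof (rule residue_cong)
    have "\<forall>\<^sub>F z in at \<mu>. z \<in> W" using W that by (intro eventually_at_in_open') auto
    then show "\<forall>\<^sub>F z in at \<mu>. f z * resolvent A z $$ (i, j) = g z * resolvent A z $$ (i, j)"
      by eventually_elim (simp add: eq)
  qed simp
  then show ?thesis using A by (auto simp: hol_calc_def intro!: eq_matI sum.cong)
qed

lemma hol_calc_add: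
  assumes A: "A \<in> carrier_mat d d" and W: "open W" "spectrum A \<subseteq> W"
    and f: "f holomorphic_on W" and g: "g holomorphic_on W"
  shows "hol_calc (\<lambda>z. f z + g z) A = hol_calc f A + hol_calc g A"
proof (rule eq_matI)
  fix i j assume "i < dim_row (hol_calc f A + hol_calc g A)" "j < dim_col (hol_calc f A + hol_calc g A)"
  with A have ij: "i < d" "j < d" by (auto simp: hol_calc_def)
  have "residue (\<lambda>z. (f z + g z) * resolvent A z $$ (i, j)) \<mu> =
      residue (\<lambda>z. f z * resolvent A z $$ (i, j)) \<mu> + residue (\<lambda>z. g z * resolvent A z $$ (i, j)) \<mu>"
    if \<mu>: "\<mu> \<in> spectrum A" for \<mu>
    unfolding distrib_right
    by (rule residue_add[OF hol_calc_integrand(1,2,4)[OF A ij f W \<mu>] hol_calc_integrand(4)[OF A ij g W \<mu>]])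
  then show "hol_calc (\<lambda>z. f z + g z) A $$ (i, j) = (hol_calc f A + hol_calc g A) $$ (i, j)"
    using ij A hol_calc_carrier[OF A, of g] by (simp add: hol_calc_index[OF A ij] sum.distrib)
qed (use A in \<open>auto simp: hol_calc_def\<close>)

lemma hol_calc_cmult:
  assumes A: "A \<in> carrier_mat d d" and W: "open W" "spectrum A \<subseteq> W"
    and f: "f holomorphic_on W"
  shows "hol_calc (\<lambda>z. a * f z) A = a \<cdot>\<^sub>m hol_calc f A"
proof (rule eq_matI)
  fix i j assume "i < dim_row (a \<cdot>\<^sub>m hol_calc f A)" "j < dim_col (a \<cdot>\<^sub>m hol_calc f A)"
  with A have ij: "i < d" "j < d" by (auto simp: hol_calc_def)
  have "residue (\<lambda>z. a * f z * resolvent A z $$ (i, j)) \<mu> = a * residue (\<lambda>z. f z * resolvent A z $$ (i, j)) \<mu>"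
    if \<mu>: "\<mu> \<in> spectrum A" for \<mu>
    unfolding mult.assoc by (rule residue_lmul[OF hol_calc_integrand(1,2,4)[OF A ij f W \<mu>]])
  then show "hol_calc (\<lambda>z. a * f z) A $$ (i, j) = (a \<cdot>\<^sub>m hol_calc f A) $$ (i, j)"
    using ij A hol_calc_carrier[OF A, of f] by (simp add: hol_calc_index[OF A ij] sum_distrib_left)
qed (use A in \<open>auto simp: hol_calc_def\<close>)

section \<open>The resolvent identity and the normalisation of the calculus\<close>

lemma resolvent_eqn:
  assumes A: "A \<in> carrier_mat d d" and z: "z \<notin> spectrum A"
  shows "z \<cdot>\<^sub>m resolvent A z = 1\<^sub>m d + A * resolvent A z"
proof -
  define M where "M = z \<cdot>\<^sub>m 1\<^sub>m d - A"
  have M: "M \<in> carrier_mat d d" using A by (auto simp: M_def)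
  note R = resolvent_eq_adj[OF A z, folded M_def]
  have "M * resolvent A z = 1\<^sub>m d"
    unfolding R(3) using M adj_mat[OF M] R(1)
    by (subst mult_smult_distrib[of _ d d _ d]) (auto intro!: eq_matI)
  moreover have "M * resolvent A z = z \<cdot>\<^sub>m resolvent A z - A * resolvent A z"
    unfolding M_def using A R(2) by (subst minus_mult_distrib_mat[of _ d d _ _ d]) (auto simp: mult_smult_assoc_mat[of _ d d _ d])
  ultimately have *: "z \<cdot>\<^sub>m resolvent A z - A * resolvent A z = 1\<^sub>m d" by simp
  show ?thesis unfolding *[symmetric] using A R(2) by (intro eq_matI) auto
qed

lemma resolvent_eqn_index:
  assumes A: "A \<in> carrier_mat d d" and z: "z \<notin> spectrum A" and ij: "i < d" "j < d"
  shows "z * resolvent A z $$ (i, j) = (if i = j then 1 else 0) + (\<Sum>k<d. A $$ (i, k) * resolvent A z $$ (k, j))"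
  using arg_cong[OF resolvent_eqn[OF A z], of "\<lambda>M. M $$ (i, j)"] A ij resolvent_eq_adj(2)[OF A z]
  by (simp add: scalar_prod_def atLeast0LessThan)

text \<open>Substitute \<open>z R(z) = 1 + A R(z)\<close>: the identity contributes only a multiple
  of \<open>f\<close>, which has residue 0, and the constant entries of \<open>A\<close> come out of
  the residues.\<close>

lemma hol_calc_id_mult:
  assumes A: "A \<in> carrier_mat d d" and W: "open W" "spectrum A \<subseteq> W"
    and f: "f holomorphic_on W"
  shows "hol_calc (\<lambda>z. z * f z) A = A * hol_calc f A"
proof (rule eq_matI)
  fix i j assume "i < dim_row (A * hol_calc f A)" "j < dim_col (A * hol_calc f A)"
  with A have ij: "i < d" "j < d" by (auto simp: hol_calc_def)
  have "residue (\<lambda>z. z * f z * resolvent A z $$ (i, j)) \<mu> =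
      (\<Sum>k<d. A $$ (i, k) * residue (\<lambda>z. f z * resolvent A z $$ (k, j)) \<mu>)"
    if \<mu>: "\<mu> \<in> spectrum A" for \<mu>
  proof -
    define s where "s = W - (spectrum A - {\<mu>})"
    have R: "(\<lambda>z. f z * resolvent A z $$ (k, j)) holomorphic_on s - {\<mu>}" if "k < d" for k
      unfolding s_def by (rule hol_calc_integrand(4)[OF A that ij(2) f W \<mu>])
    note s = hol_calc_integrand(1-3)[OF A ij f W \<mu>, folded s_def]
    have "residue (\<lambda>z. z * f z * resolvent A z $$ (i, j)) \<mu> =
        residue (\<lambda>z. f z * (if i = j then 1 else 0) + (\<Sum>k<d. A $$ (i, k) * (f z * resolvent A z $$ (k, j)))) \<mu>"
    proof (rule residue_cong)
      have "\<forall>\<^sub>F z in at \<mu>. z \<in> s - {\<mu>}" using s by (intro eventually_at_in_open) auto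
      then show "\<forall>\<^sub>F z in at \<mu>. z * f z * resolvent A z $$ (i, j) =
          f z * (if i = j then 1 else 0) + (\<Sum>k<d. A $$ (i, k) * (f z * resolvent A z $$ (k, j)))"
      proof eventually_elim
        case (elim z)
        have "z * f z * resolvent A z $$ (i, j) = f z * (z * resolvent A z $$ (i, j))" by simp
        also have "\<dots> = f z * (if i = j then 1 else 0) + (\<Sum>k<d. A $$ (i, k) * (f z * resolvent A z $$ (k, j)))"
          using elim by (subst resolvent_eqn_index[OF A _ ij])
            (auto simp: s_def distrib_left sum_distrib_left mult.left_commute)
        finally show ?case .
      qed
    qed simp
    also have "\<dots> = residue (\<lambda>z. f z * (if i = j then 1 else 0)) \<mu> +
        residue (\<lambda>z. \<Sum>k<d. A $$ (i, k) * (f z * resolvent A z $$ (k, j))) \<mu>"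
      by (intro residue_add[OF s(1,2)] holomorphic_intros R holomorphic_on_subset[OF f]) (use s in auto)
    also have "residue (\<lambda>z. f z * (if i = j then 1 else 0)) \<mu> = 0"
      by (intro residue_holo[OF s(1,2)] holomorphic_intros holomorphic_on_subset[OF f s(3)])
    also have "residue (\<lambda>z. \<Sum>k<d. A $$ (i, k) * (f z * resolvent A z $$ (k, j))) \<mu> =
        (\<Sum>k<d. residue (\<lambda>z. A $$ (i, k) * (f z * resolvent A z $$ (k, j))) \<mu>)"
      by (intro residue_sum[OF _ s(1,2)] holomorphic_intros R) auto
    also have "\<dots> = (\<Sum>k<d. A $$ (i, k) * residue (\<lambda>z. f z * resolvent A z $$ (k, j)) \<mu>)"
      by (intro sum.cong refl residue_lmul[OF s(1,2)] R) auto
    finally show ?thesis by simp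
  qed
  then have "hol_calc (\<lambda>z. z * f z) A $$ (i, j) =
      (\<Sum>\<mu>\<in>spectrum A. \<Sum>k<d. A $$ (i, k) * residue (\<lambda>z. f z * resolvent A z $$ (k, j)) \<mu>)"
    by (simp add: hol_calc_index[OF A ij])
  also have "\<dots> = (\<Sum>k<d. A $$ (i, k) * hol_calc f A $$ (k, j))"
    by (subst sum.swap) (simp add: hol_calc_index[OF A _ ij(2)] sum_distrib_left)
  also have "\<dots> = (A * hol_calc f A) $$ (i, j)"
    using A ij hol_calc_carrier[OF A, of f] by (simp add: scalar_prod_def atLeast0LessThan)
  finally show "hol_calc (\<lambda>z. z * f z) A $$ (i, j) = (A * hol_calc f A) $$ (i, j)" .
qed (use A in \<open>auto simp: hol_calc_def\<close>)

lemma eucl_norm_index_le: "v \<in> carrier_vec d \<Longrightarrow> i < d \<Longrightarrow> cmod (v $ i) \<le> eucl_norm v"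
  unfolding eucl_norm_def by (rule member_le_L2_set) auto

lemma eigenvalue_norm_le:
  assumes A: "A \<in> carrier_mat d d" and \<mu>: "\<mu> \<in> spectrum A"
  shows "cmod \<mu> \<le> op_norm A"
proof -
  obtain v where v: "v \<in> carrier_vec d" "v \<noteq> 0\<^sub>v d" "A *\<^sub>v v = \<mu> \<cdot>\<^sub>v v"
    using \<mu> A by (auto simp: spectrum_def eigenvalue_def eigenvector_def)
  then have "eucl_norm v > 0" using eucl_norm_eq_0_iff[of v d] by (simp add: less_le)
  moreover have "cmod \<mu> * eucl_norm v \<le> op_norm A * eucl_norm v"
    using eucl_norm_mult_mat_vec_le[OF A v(1)] v(3) by (simp add: eucl_norm_smult)
  ultimately show ?thesis by simp
qed

text \<open>The column \<open>v\<close> solves \<open>z v = e_j + A v\<close>, hence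
  \<open>|z| |v| \<le> 1 + |A| |v|\<close>.\<close>

lemma resolvent_col_norm_le:
  assumes A: "A \<in> carrier_mat d d" and z: "op_norm A < cmod z" and j: "j < d"
  shows "eucl_norm (col (resolvent A z) j) \<le> 1 / (cmod z - op_norm A)"
proof -
  have z': "z \<notin> spectrum A" using eigenvalue_norm_le[OF A] z by force
  note R = resolvent_eq_adj(2)[OF A z']
  define v where "v = col (resolvent A z) j"
  have v: "v \<in> carrier_vec d" using R j by (auto simp: v_def)
  have "z \<cdot>\<^sub>v v = unit_vec d j + A *\<^sub>v v"
  proof (rule eq_vecI)
    fix i assume "i < dim_vec (unit_vec d j + A *\<^sub>v v)"
    then have i: "i < d" using A by simp
    have "(z \<cdot>\<^sub>v v) $ i = (z \<cdot>\<^sub>m resolvent A z) $$ (i, j)" using R i j by (simp add: v_def)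
    also have "\<dots> = (unit_vec d j + A *\<^sub>v v) $ i"
      unfolding resolvent_eqn[OF A z'] using R i j A by (simp add: v_def unit_vec_def)
    finally show "(z \<cdot>\<^sub>v v) $ i = (unit_vec d j + A *\<^sub>v v) $ i" .
  qed (use A v in auto)
  moreover have "eucl_norm (unit_vec d j) = 1"
    using j by (simp add: eucl_norm_def L2_set_def unit_vec_def if_distrib[of "\<lambda>x. x ^ 2"] if_distrib[of cmod] cong: if_cong)
  ultimately have "cmod z * eucl_norm v \<le> 1 + op_norm A * eucl_norm v"
    using eucl_norm_triangle[of "unit_vec d j" d "A *\<^sub>v v"] eucl_norm_mult_mat_vec_le[OF A v]
      mult_mat_vec_carrier[OF A v]
    by (simp add: eucl_norm_smult[symmetric])
  then show ?thesis using z by (simp add: v_def[symmetric] field_simps)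
qed

text \<open>Integrate over a circle of large radius \<open>\<rho>\<close> and replace the resolvent
  by \<open>(1 + A R(z)) / z\<close>. The first part gives the identity matrix exactly, the rest is
  \<open>O(1 / \<rho>)\<close>, and the left side does not depend on \<open>\<rho>\<close>.\<close>

lemma hol_calc_one:
  assumes A: "A \<in> carrier_mat d d"
  shows "hol_calc (\<lambda>_. 1) A = 1\<^sub>m d"
proof (rule eq_matI)
  fix i j assume "i < dim_row (1\<^sub>m d)" "j < dim_col (1\<^sub>m d)"
  then have ij: "i < d" "j < d" by auto
  let ?\<delta> = "if i = j then 1 else 0 :: complex"
  have bound: "cmod (hol_calc (\<lambda>_. 1) A $$ (i, j) - ?\<delta>) \<le> op_norm A / (\<rho> - op_norm A)"
    if \<rho>: "op_norm A < \<rho>" for \<rho>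
  proof -
    have \<rho>0: "0 < \<rho>" using \<rho> op_norm_nonneg[of A] by linarith
    have sp: "cmod \<mu> < \<rho>" if "\<mu> \<in> spectrum A" for \<mu> using eigenvalue_norm_le[OF A that] \<rho> by simp
    have R: "(\<lambda>z. resolvent A z $$ (k, j)) holomorphic_on - spectrum A" if "k < d" for k
      by (rule holomorphic_on_resolvent[OF A that ij(2)])
    have c: "continuous_on (sphere 0 \<rho>) (\<lambda>z. resolvent A z $$ (k, j))" if "k < d" for k
      using sp by (intro holomorphic_on_imp_continuous_on holomorphic_on_subset[OF R[OF that]]) fastforce
    have "hol_calc (\<lambda>_. 1) A $$ (i, j) = 1 / (2 * pi * \<i>) *
        contour_integral (circlepath 0 \<rho>) (\<lambda>z. 1 * resolvent A z $$ (i, j))"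
      using sp \<rho>0 by (intro hol_calc_contour_integral[OF A ij, of UNIV] winding_number_circlepath) force+
    also have "contour_integral (circlepath 0 \<rho>) (\<lambda>z. 1 * resolvent A z $$ (i, j)) =
        contour_integral (circlepath 0 \<rho>) (\<lambda>z. ?\<delta> * (1 / (z - 0)) + (\<Sum>k<d. A $$ (i, k) * resolvent A z $$ (k, j)) / z)"
    proof (rule contour_integral_cong)
      fix z assume "z \<in> path_image (circlepath 0 \<rho>)"
      then have z: "cmod z = \<rho>" using \<rho>0 by simp
      then have "z \<noteq> 0" "z \<notin> spectrum A" using \<rho>0 sp by force+
      then show "1 * resolvent A z $$ (i, j) = ?\<delta> * (1 / (z - 0)) + (\<Sum>k<d. A $$ (i, k) * resolvent A z $$ (k, j)) / z"
        using resolvent_eqn_index[OF A _ ij, of z] by (simp add: field_simps)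
    qed simp
    also have "\<dots> = contour_integral (circlepath 0 \<rho>) (\<lambda>z. ?\<delta> * (1 / (z - 0))) +
        contour_integral (circlepath 0 \<rho>) (\<lambda>z. (\<Sum>k<d. A $$ (i, k) * resolvent A z $$ (k, j)) / z)"
      using \<rho>0 by (intro contour_integral_add contour_integrable_continuous_circlepath continuous_intros)
        (auto intro!: c)
    also have "contour_integral (circlepath 0 \<rho>) (\<lambda>z. ?\<delta> * (1 / (z - 0))) = ?\<delta> * (2 * pi * \<i>)"
      using \<rho>0 contour_integral_circlepath[of \<rho> 0] by (subst contour_integral_lmul)
        (auto intro!: contour_integrable_continuous_circlepath continuous_intros)
    finally have "hol_calc (\<lambda>_. 1) A $$ (i, j) - ?\<delta> = 1 / (2 * pi * \<i>) *
        contour_integral (circlepath 0 \<rho>) (\<lambda>z. (\<Sum>k<d. A $$ (i, k) * resolvent A z $$ (k, j)) / z)"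
      by (simp add: field_simps)
    moreover have "cmod (contour_integral (circlepath 0 \<rho>) (\<lambda>z. (\<Sum>k<d. A $$ (i, k) * resolvent A z $$ (k, j)) / z))
        \<le> (op_norm A / (\<rho> - op_norm A) / \<rho>) * (2 * pi * \<rho>)"
    proof (rule has_contour_integral_bound_circlepath)
      show "((\<lambda>z. (\<Sum>k<d. A $$ (i, k) * resolvent A z $$ (k, j)) / z) has_contour_integral
          contour_integral (circlepath 0 \<rho>) (\<lambda>z. (\<Sum>k<d. A $$ (i, k) * resolvent A z $$ (k, j)) / z)) (circlepath 0 \<rho>)"
        using \<rho>0 by (intro has_contour_integral_integral contour_integrable_continuous_circlepath continuous_intros)
          (auto intro!: c)
      fix z :: complex assume "cmod (z - 0) = \<rho>"
      then have z: "cmod z = \<rho>" by simp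
      then have z': "z \<notin> spectrum A" using sp by force
      note Rz = resolvent_eq_adj(2)[OF A z']
      define v where "v = col (resolvent A z) j"
      have v: "v \<in> carrier_vec d" using Rz ij by (auto simp: v_def)
      have "(\<Sum>k<d. A $$ (i, k) * resolvent A z $$ (k, j)) = (A *\<^sub>v v) $ i"
        using A Rz ij by (simp add: v_def scalar_prod_def atLeast0LessThan)
      also have "cmod \<dots> \<le> eucl_norm (A *\<^sub>v v)"
        using A v ij by (intro eucl_norm_index_le[of _ d]) auto
      also have "\<dots> \<le> op_norm A * eucl_norm v" by (rule eucl_norm_mult_mat_vec_le[OF A v])
      also have "\<dots> \<le> op_norm A * (1 / (\<rho> - op_norm A))"
        using resolvent_col_norm_le[OF A _ ij(2), of z] z \<rho> by (intro mult_left_mono) (auto simp: v_def)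
      finally have "cmod (\<Sum>k<d. A $$ (i, k) * resolvent A z $$ (k, j)) \<le> op_norm A / (\<rho> - op_norm A)"
        by simp
      from divide_right_mono[OF this less_imp_le[OF \<rho>0]]
      show "cmod ((\<Sum>k<d. A $$ (i, k) * resolvent A z $$ (k, j)) / z) \<le> op_norm A / (\<rho> - op_norm A) / \<rho>"
        unfolding norm_divide z .
    qed (use \<rho> \<rho>0 in auto)
    moreover have "op_norm A / (\<rho> - op_norm A) / \<rho> * (2 * pi * \<rho>) = op_norm A / (\<rho> - op_norm A) * (2 * pi)"
      using \<rho>0 by simp
    ultimately show ?thesis by (simp add: norm_mult norm_divide pos_divide_le_eq)
  qed
  have "((\<lambda>\<rho>. op_norm A / (\<rho> - op_norm A)) \<longlongrightarrow> 0) at_top"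
    by real_asymp
  moreover have "\<forall>\<^sub>F \<rho> in at_top. cmod (hol_calc (\<lambda>_. 1) A $$ (i, j) - ?\<delta>) \<le> op_norm A / (\<rho> - op_norm A)"
    using eventually_gt_at_top[of "op_norm A"] by eventually_elim (rule bound)
  ultimately have "cmod (hol_calc (\<lambda>_. 1) A $$ (i, j) - ?\<delta>) \<le> 0"
    by (rule tendsto_lowerbound) simp
  then show "hol_calc (\<lambda>_. 1) A $$ (i, j) = 1\<^sub>m d $$ (i, j)" using ij by simp
qed (use A in \<open>auto simp: hol_calc_def\<close>)

lemma hol_calc_id:
  assumes A: "A \<in> carrier_mat d d"
  shows "hol_calc (\<lambda>z. z) A = A"
  using hol_calc_id_mult[OF A open_UNIV, of "\<lambda>_. 1"] hol_calc_one[OF A] A by simp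

lemma hol_calc_const:
  assumes A: "A \<in> carrier_mat d d"
  shows "hol_calc (\<lambda>_. a) A = a \<cdot>\<^sub>m 1\<^sub>m d"
  using hol_calc_cmult[OF A open_UNIV, of "\<lambda>_. 1" a] hol_calc_one[OF A] by simp

lemma hol_calc_diff_const_mult:
  assumes A: "A \<in> carrier_mat d d" and W: "open W" "spectrum A \<subseteq> W"
    and f: "f holomorphic_on W"
  shows "hol_calc (\<lambda>z. (z - a) * f z) A = (A - a \<cdot>\<^sub>m 1\<^sub>m d) * hol_calc f A"
proof -
  note F = hol_calc_carrier[OF A, of f]
  have "hol_calc (\<lambda>z. z * f z + (- a) * f z) A = A * hol_calc f A + (- a) \<cdot>\<^sub>m hol_calc f A"
    using f by (simp only: hol_calc_add[OF A W] hol_calc_id_mult[OF A W] hol_calc_cmult[OF A W] holomorphic_intros)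
  also have "\<dots> = A * hol_calc f A - (a \<cdot>\<^sub>m 1\<^sub>m d) * hol_calc f A"
    using A F by (subst mult_smult_assoc_mat[of _ d d _ d]) (auto intro!: eq_matI)
  also have "\<dots> = (A - a \<cdot>\<^sub>m 1\<^sub>m d) * hol_calc f A"
    using A F by (intro minus_mult_distrib_mat[symmetric, of _ d d _ _ d]) auto
  finally show ?thesis by (simp add: algebra_simps)
qed

section \<open>Multiplicativity of the calculus\<close>

abbreviation shift_mats :: "complex mat \<Rightarrow> complex list \<Rightarrow> complex mat \<Rightarrow> complex mat" where
  "shift_mats A as M \<equiv> foldr (\<lambda>a M. (A - a \<cdot>\<^sub>m 1\<^sub>m (dim_row A)) * M) as M"

text \<open>The innermost matrix factors out on the right, so a product that annihilates the
  identity annihilates every matrix.\<close>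

lemma shift_mats_mult:
  assumes A: "A \<in> carrier_mat d d" and M: "M \<in> carrier_mat d d"
  shows "shift_mats A as M \<in> carrier_mat d d" "shift_mats A as M = shift_mats A as (1\<^sub>m d) * M"
proof -
  have c: "shift_mats A as M \<in> carrier_mat d d" if "M \<in> carrier_mat d d" for as M
    using A that by (induction as) auto
  show "shift_mats A as M \<in> carrier_mat d d" by (rule c[OF M])
  show "shift_mats A as M = shift_mats A as (1\<^sub>m d) * M"
  proof (induction as)
    case (Cons a as)
    have "A - a \<cdot>\<^sub>m 1\<^sub>m d \<in> carrier_mat d d" using A by auto
    from assoc_mult_mat[OF this c[of "1\<^sub>m d" as] M] show ?case using A Cons by simp
  qed (use M in simp)
qed

text \<open>For \<open>f = 1\<close> this evaluates at \<open>A\<close> a polynomial given by its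
  roots. It relies on the rule for a single linear factor, as multiplicativity is still to be
  proved.\<close>

lemma hol_calc_prod_diff_mult:
  assumes A: "A \<in> carrier_mat d d" and W: "open W" "spectrum A \<subseteq> W"
    and f: "f holomorphic_on W"
  shows "(\<lambda>z. (\<Prod>a\<leftarrow>as. z - a) * f z) holomorphic_on W"
    and "hol_calc (\<lambda>z. (\<Prod>a\<leftarrow>as. z - a) * f z) A = shift_mats A as (hol_calc f A)"
proof (induction as)
  case (Cons a as)
  {
    case 1
    have "(\<lambda>z. (z - a) * ((\<Prod>a\<leftarrow>as. z - a) * f z)) holomorphic_on W"
      by (intro holomorphic_intros Cons.IH(1))
    then show ?case by (simp add: mult.assoc)
  next
    case 2
    show ?case
      using hol_calc_diff_const_mult[OF A W Cons.IH(1), of a] Cons.IH(2) A by (simp add: mult.assoc)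
  }
qed (use f in auto)

text \<open>The roots are listed with multiplicity and all of them are eigenvalues; in this form
  linear factors can be split off one by one.\<close>

lemma det_char_eq_prod_list:
  fixes A :: "complex mat"
  assumes A: "A \<in> carrier_mat d d"
  obtains as where "set as \<subseteq> spectrum A" "\<And>z. Determinant.det (z \<cdot>\<^sub>m 1\<^sub>m d - A) = (\<Prod>a\<leftarrow>as. z - a)"
proof -
  obtain as where as: "char_poly A = (\<Prod>a\<leftarrow>as. [:- a, 1:])"
    using char_poly_factorized[OF A] by blast
  have p: "poly (char_poly A) z = (\<Prod>a\<leftarrow>as. z - a)" for z
    unfolding as poly_prod_list by (simp add: o_def)
  have "- char_matrix A z = z \<cdot>\<^sub>m 1\<^sub>m d - A" for z
    using A by (auto simp: char_matrix_def intro!: eq_matI)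
  then have "Determinant.det (z \<cdot>\<^sub>m 1\<^sub>m d - A) = (\<Prod>a\<leftarrow>as. z - a)" for z
    using char_poly_matrix[OF A, of z] p by simp
  moreover have "set as \<subseteq> spectrum A"
    unfolding spectrum_root_char_poly[OF A] p by (auto simp: prod_list_zero_iff)
  ultimately show ?thesis using that by blast
qed

text \<open>Entries of the adjugate are polynomials in \<open>z\<close>, hence entire: the poles of
  the resolvent come from the determinant alone.\<close>

lemma holomorphic_on_adj_mat_char:
  assumes A: "A \<in> carrier_mat d d" and ij: "i < d" "j < d"
  shows "(\<lambda>z. adj_mat (z \<cdot>\<^sub>m 1\<^sub>m d - A) $$ (i, j)) holomorphic_on S"
proof -
  define M where "M z = z \<cdot>\<^sub>m 1\<^sub>m d - A" for z
  have M: "M z \<in> carrier_mat d d" for z unfolding M_def using A by auto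
  have "(\<lambda>z. Determinant.det (mat_delete (M z) j i)) holomorphic_on S"
  proof (rule holomorphic_on_det[where n = "d - 1"])
    show "mat_delete (M z) j i \<in> carrier_mat (d - 1) (d - 1)" for z
      using mat_delete_carrier[OF M] by simp
    fix k l assume kl: "k < d - 1" "l < d - 1"
    define k' l' where "k' = (if k < j then k else Suc k)" and "l' = (if l < i then l else Suc l)"
    have "k' < d" "l' < d" using kl by (auto simp: k'_def l'_def)
    then have "(\<lambda>z. mat_delete (M z) j i $$ (k, l)) = (\<lambda>z. z * (if k' = l' then 1 else 0) - A $$ (k', l'))"
      using A kl carrier_matD[OF M] by (auto simp: mat_delete_def fun_eq_iff k'_def l'_def M_def)
    then show "(\<lambda>z. mat_delete (M z) j i $$ (k, l)) holomorphic_on S"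
      by (auto intro!: holomorphic_intros)
  qed
  then have "(\<lambda>z. (-1) ^ (j + i) * Determinant.det (mat_delete (M z) j i)) holomorphic_on S"
    by (intro holomorphic_intros)
  moreover have "adj_mat (M z) $$ (i, j) = (-1) ^ (j + i) * Determinant.det (mat_delete (M z) j i)" for z
    using M[of z] ij by (simp add: adj_mat_def cofactor_def)
  ultimately show ?thesis by (simp add: M_def)
qed

text \<open>Cayley--Hamilton: multiplying by the characteristic polynomial removes all poles of the resolvent.\<close>

lemma hol_calc_char_poly_eq_0:
  assumes A: "A \<in> carrier_mat d d"
  shows "hol_calc (\<lambda>z. Determinant.det (z \<cdot>\<^sub>m 1\<^sub>m d - A)) A = 0\<^sub>m d d"
proof (rule eq_matI)
  fix i j assume "i < dim_row (0\<^sub>m d d)" "j < dim_col (0\<^sub>m d d)"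
  then have ij: "i < d" "j < d" by auto
  have "residue (\<lambda>z. Determinant.det (z \<cdot>\<^sub>m 1\<^sub>m d - A) * resolvent A z $$ (i, j)) \<mu> = 0" if "\<mu> \<in> spectrum A" for \<mu>
  proof -
    have "residue (\<lambda>z. Determinant.det (z \<cdot>\<^sub>m 1\<^sub>m d - A) * resolvent A z $$ (i, j)) \<mu> =
        residue (\<lambda>z. adj_mat (z \<cdot>\<^sub>m 1\<^sub>m d - A) $$ (i, j)) \<mu>"
    proof (rule residue_cong)
      have "\<forall>\<^sub>F z in at \<mu>. z \<in> UNIV - (spectrum A - {\<mu>}) - {\<mu>}"
        using card_finite_spectrum(1)[OF A] that
        by (intro eventually_at_in_open) (auto intro: open_Diff finite_imp_closed)
      then show "\<forall>\<^sub>F z in at \<mu>. Determinant.det (z \<cdot>\<^sub>m 1\<^sub>m d - A) * resolvent A z $$ (i, j) =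
          adj_mat (z \<cdot>\<^sub>m 1\<^sub>m d - A) $$ (i, j)"
      proof eventually_elim
        case (elim z)
        then have z: "z \<notin> spectrum A" by auto
        have "z \<cdot>\<^sub>m 1\<^sub>m d - A \<in> carrier_mat d d" using A by auto
        from adj_mat(1)[OF this] show ?case
          using resolvent_eq_adj(1,3)[OF A z] ij by simp
      qed
    qed simp
    also have "\<dots> = 0"
      by (rule residue_holo[OF open_UNIV]) (auto intro: holomorphic_on_adj_mat_char[OF A ij])
    finally show ?thesis .
  qed
  then show "hol_calc (\<lambda>z. Determinant.det (z \<cdot>\<^sub>m 1\<^sub>m d - A)) A $$ (i, j) = 0\<^sub>m d d $$ (i, j)"
    using ij by (simp add: hol_calc_index[OF A ij])
qed (use A in auto)

text \<open>With \<open>f = f(a) + (z - a) f\<^sub>1\<close>, the defect \<open>E f = (f g)(A) - f(A) g(A)\<close> satisfies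
  \<open>E f = (A - a) E f\<^sub>1\<close>. Running \<open>a\<close> through the eigenvalues gives \<open>E f = 0\<close> by Cayley--Hamilton.\<close>

lemma hol_calc_mult:
  assumes A: "A \<in> carrier_mat d d" and W: "open W" "spectrum A \<subseteq> W"
    and f: "f holomorphic_on W" and g: "g holomorphic_on W"
  shows "hol_calc (\<lambda>z. f z * g z) A = hol_calc f A * hol_calc g A"
proof -
  define E where "E f = hol_calc (\<lambda>z. f z * g z) A - hol_calc f A * hol_calc g A" for f
  note H = hol_calc_carrier[OF A]
  have E: "E f \<in> carrier_mat d d" for f
    unfolding E_def by (intro minus_carrier_mat mult_carrier_mat[OF H H])
  have step: "\<exists>f1. f1 holomorphic_on W \<and> E f = (A - a \<cdot>\<^sub>m 1\<^sub>m d) * E f1"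
    if f: "f holomorphic_on W" and a: "a \<in> spectrum A" for f a
  proof (intro exI conjI)
    define f1 where "f1 z = (if z = a then deriv f a else (f z - f a) / (z - a))" for z
    show f1: "f1 holomorphic_on W"
      unfolding f1_def using f W(1) by (rule pole_lemma_open)
    have f_eq: "f = (\<lambda>z. (z - a) * f1 z + f a)" by (auto simp: f1_def)
    have B: "A - a \<cdot>\<^sub>m 1\<^sub>m d \<in> carrier_mat d d" using A by auto
    have 1: "hol_calc f A = (A - a \<cdot>\<^sub>m 1\<^sub>m d) * hol_calc f1 A + f a \<cdot>\<^sub>m 1\<^sub>m d"
    proof -
      have "hol_calc f A = hol_calc (\<lambda>z. (z - a) * f1 z + f a) A" by (subst f_eq) (rule refl)
      also have "\<dots> = hol_calc (\<lambda>z. (z - a) * f1 z) A + hol_calc (\<lambda>_. f a) A"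
        by (intro hol_calc_add[OF A W] holomorphic_intros f1)
      finally show ?thesis by (simp add: hol_calc_diff_const_mult[OF A W f1] hol_calc_const[OF A])
    qed
    have 2: "hol_calc (\<lambda>z. f z * g z) A = (A - a \<cdot>\<^sub>m 1\<^sub>m d) * hol_calc (\<lambda>z. f1 z * g z) A + f a \<cdot>\<^sub>m hol_calc g A"
    proof -
      have "(\<lambda>z. f z * g z) = (\<lambda>z. (z - a) * (f1 z * g z) + f a * g z)"
        by (subst f_eq) (simp add: algebra_simps)
      then have "hol_calc (\<lambda>z. f z * g z) A = hol_calc (\<lambda>z. (z - a) * (f1 z * g z) + f a * g z) A" by simp
      also have "\<dots> = hol_calc (\<lambda>z. (z - a) * (f1 z * g z)) A + hol_calc (\<lambda>z. f a * g z) A"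
        by (intro hol_calc_add[OF A W] holomorphic_intros f1 g)
      finally show ?thesis
        using f1 g by (simp add: hol_calc_diff_const_mult[OF A W] hol_calc_cmult[OF A W] holomorphic_intros)
    qed
    let ?B = "A - a \<cdot>\<^sub>m 1\<^sub>m d" and ?F = "hol_calc f1 A" and ?G = "hol_calc g A" and ?P = "hol_calc (\<lambda>z. f1 z * g z) A"
    have "(?B * ?F + f a \<cdot>\<^sub>m 1\<^sub>m d) * ?G = ?B * ?F * ?G + f a \<cdot>\<^sub>m ?G"
      using B H[of f1] H[of g] by (subst add_mult_distrib_mat[of _ d d _ _ d]) (auto simp: mult_smult_assoc_mat[of _ d d _ d])
    also have "?B * ?F * ?G = ?B * (?F * ?G)" by (rule assoc_mult_mat[OF B H H])
    finally have "E f = (?B * ?P + f a \<cdot>\<^sub>m ?G) - (?B * (?F * ?G) + f a \<cdot>\<^sub>m ?G)"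
      unfolding E_def 1 2 by simp
    also have "\<dots> = ?B * ?P - ?B * (?F * ?G)"
      using B H[of f1] H[of g] A by (intro eq_matI) auto
    also have "\<dots> = ?B * E f1"
      unfolding E_def by (rule mult_minus_distrib_mat[symmetric, OF B H mult_carrier_mat[OF H H]])
    finally show "E f = ?B * E f1" .
  qed
  have iter: "\<exists>q. q holomorphic_on W \<and> E f = shift_mats A as (E q)" if "set as \<subseteq> spectrum A" for as
    using that f
  proof (induction as arbitrary: f)
    case (Cons a as)
    obtain f1 where f1: "f1 holomorphic_on W" "E f = (A - a \<cdot>\<^sub>m 1\<^sub>m d) * E f1"
      using step[OF Cons.prems(2)] Cons.prems(1) by auto
    obtain q where "q holomorphic_on W" "E f1 = shift_mats A as (E q)"
      using Cons.IH[OF _ f1(1)] Cons.prems(1) by auto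
    then show ?case using f1(2) A by auto
  qed auto
  obtain as where as: "set as \<subseteq> spectrum A" "\<And>z. Determinant.det (z \<cdot>\<^sub>m 1\<^sub>m d - A) = (\<Prod>a\<leftarrow>as. z - a)"
    using det_char_eq_prod_list[OF A] by blast
  \<comment> \<open>The product of the \<open>z - a\<close> is evaluated at \<open>A\<close> in two
    ways: factor by factor, and as the characteristic polynomial.\<close>
  have "shift_mats A as (1\<^sub>m d) = 0\<^sub>m d d"
    using hol_calc_prod_diff_mult(2)[OF A open_UNIV, of "\<lambda>_. 1" as] hol_calc_char_poly_eq_0[OF A]
    by (simp add: as(2) hol_calc_one[OF A])
  moreover obtain q where "E f = shift_mats A as (E q)" using iter[OF as(1)] by blast
  ultimately have "E f = 0\<^sub>m d d"
    using shift_mats_mult(2)[OF A E, of as q] left_mult_zero_mat[OF E, of d q] by simp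
  then have *: "hol_calc (\<lambda>z. f z * g z) A - hol_calc f A * hol_calc g A = 0\<^sub>m d d" by (simp add: E_def)
  show ?thesis
  proof (rule eq_matI)
    fix i j assume "i < dim_row (hol_calc f A * hol_calc g A)" "j < dim_col (hol_calc f A * hol_calc g A)"
    then show "hol_calc (\<lambda>z. f z * g z) A $$ (i, j) = (hol_calc f A * hol_calc g A) $$ (i, j)"
      using arg_cong[OF *, of "\<lambda>M. M $$ (i, j)"] A by simp
  qed (use A in auto)
qed

section \<open>Continuity of the calculus in the supremum norm\<close>

lemma residue_bound:
  assumes s: "open s" "\<mu> \<in> s" and R: "R holomorphic_on s - {\<mu>}"
  obtains C where "0 \<le> C" "\<And>f M. f holomorphic_on s \<Longrightarrow> (\<And>z. z \<in> s \<Longrightarrow> cmod (f z) \<le> M) \<Longrightarrow>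
    cmod (residue (\<lambda>z. f z * R z) \<mu>) \<le> C * M"
proof -
  obtain e where e: "e > 0" "cball \<mu> e \<subseteq> s" using s open_contains_cball by blast
  have "continuous_on (sphere \<mu> e) R"
    using e by (intro holomorphic_on_imp_continuous_on holomorphic_on_subset[OF R]) auto
  then have "bounded (R ` sphere \<mu> e)"
    by (intro compact_imp_bounded compact_continuous_image) auto
  then obtain B where B: "B > 0" "\<And>z. z \<in> sphere \<mu> e \<Longrightarrow> cmod (R z) \<le> B"
    by (auto simp: bounded_pos)
  show ?thesis
  proof (rule that)
    fix f M assume f: "f holomorphic_on s" "\<And>z. z \<in> s \<Longrightarrow> cmod (f z) \<le> M"
    have M: "0 \<le> M" using f(2)[OF s(2)] norm_ge_zero order_trans by blast
    have "((\<lambda>z. f z * R z) has_contour_integral 2 * pi * \<i> * residue (\<lambda>z. f z * R z) \<mu>) (circlepath \<mu> e)"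
      using f R by (intro base_residue[OF s e(1) _ e(2)] holomorphic_intros) (auto intro: holomorphic_on_subset)
    then have "cmod (2 * pi * \<i> * residue (\<lambda>z. f z * R z) \<mu>) \<le> (M * B) * (2 * pi * e)"
    proof (rule has_contour_integral_bound_circlepath)
      fix z assume "cmod (z - \<mu>) = e"
      then have "z \<in> sphere \<mu> e" "z \<in> s" using e by (auto simp: dist_norm norm_minus_commute)
      then show "cmod (f z * R z) \<le> M * B"
        unfolding norm_mult using f(2) B M by (intro mult_mono) auto
    qed (use M B e in auto)
    then show "cmod (residue (\<lambda>z. f z * R z) \<mu>) \<le> (B * e) * M"
      by (simp add: norm_mult mult_ac)
  qed (use B e in auto)
qed

text \<open>The constant depends on \<open>A\<close> and \<open>W\<close> but not on
  \<open>f\<close>. Its size is irrelevant: it serves to pass to limits of polynomials and to know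
  that the supremum in the extremal problem is finite.\<close>

lemma hol_calc_bounded:
  assumes A: "A \<in> carrier_mat d d" and W: "open W" "spectrum A \<subseteq> W"
  obtains C where "0 \<le> C" "\<And>f M. f holomorphic_on W \<Longrightarrow> 0 \<le> M \<Longrightarrow> (\<And>z. z \<in> W \<Longrightarrow> cmod (f z) \<le> M) \<Longrightarrow>
    op_norm (hol_calc f A) \<le> C * M"
proof -
  \<comment> \<open>Wrapping the bound into a predicate lets the constants be chosen as a function
    of the eigenvalue and the entry.\<close>
  define P where "P \<mu> i j C \<longleftrightarrow> 0 \<le> C \<and> (\<forall>f M. f holomorphic_on W \<longrightarrow> (\<forall>z\<in>W. cmod (f z) \<le> M) \<longrightarrow>
      cmod (residue (\<lambda>z. f z * resolvent A z $$ (i, j)) \<mu>) \<le> C * M)" for \<mu> i j C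
  have "\<exists>C. P \<mu> i j C" if \<mu>: "\<mu> \<in> spectrum A" and ij: "i < d" "j < d" for \<mu> i j
  proof -
    define s where "s = W - (spectrum A - {\<mu>})"
    note s = hol_calc_integrand[OF A ij holomorphic_on_const[of 1] W \<mu>, folded s_def, simplified]
    obtain C where "0 \<le> C" and C: "\<And>f M. f holomorphic_on s \<Longrightarrow> (\<And>z. z \<in> s \<Longrightarrow> cmod (f z) \<le> M) \<Longrightarrow>
        cmod (residue (\<lambda>z. f z * resolvent A z $$ (i, j)) \<mu>) \<le> C * M"
      using residue_bound[OF s(1,2,4)] by blast
    have "cmod (residue (\<lambda>z. f z * resolvent A z $$ (i, j)) \<mu>) \<le> C * M"
      if "f holomorphic_on W" "\<forall>z\<in>W. cmod (f z) \<le> M" for f M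
      using that(2) s(3) by (intro C holomorphic_on_subset[OF that(1)]) auto
    with \<open>0 \<le> C\<close> show ?thesis unfolding P_def by blast
  qed
  then obtain C where CP: "\<And>\<mu> i j. \<mu> \<in> spectrum A \<Longrightarrow> i < d \<Longrightarrow> j < d \<Longrightarrow> P \<mu> i j (C \<mu> i j)"
    by metis
  have C: "0 \<le> C \<mu> i j" "f holomorphic_on W \<Longrightarrow> \<forall>z\<in>W. cmod (f z) \<le> M \<Longrightarrow>
      cmod (residue (\<lambda>z. f z * resolvent A z $$ (i, j)) \<mu>) \<le> C \<mu> i j * M"
    if "\<mu> \<in> spectrum A" "i < d" "j < d" for \<mu> i j f M
    using CP[OF that] unfolding P_def by blast+
  define B where "B = (\<Sum>i<d. \<Sum>j<d. \<Sum>\<mu>\<in>spectrum A. C \<mu> i j)"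
  have B: "0 \<le> B" unfolding B_def by (intro sum_nonneg C) auto
  show ?thesis
  proof (rule that)
    fix f M assume f: "f holomorphic_on W" "0 \<le> M" "\<And>z. z \<in> W \<Longrightarrow> cmod (f z) \<le> M"
    have "op_norm (hol_calc f A) \<le> real d * real d * (B * M)"
    proof (rule op_norm_le_entries[OF hol_calc_carrier[OF A]])
      fix i j assume ij: "i < d" "j < d"
      have "cmod (hol_calc f A $$ (i, j)) \<le> (\<Sum>\<mu>\<in>spectrum A. C \<mu> i j * M)"
        unfolding hol_calc_index[OF A ij] using f ij by (intro sum_norm_le C) auto
      also have "\<dots> = (\<Sum>\<mu>\<in>spectrum A. C \<mu> i j) * M" by (simp add: sum_distrib_right)
      also have "(\<Sum>\<mu>\<in>spectrum A. C \<mu> i j) \<le> (\<Sum>j<d. \<Sum>\<mu>\<in>spectrum A. C \<mu> i j)"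
        using ij C(1) by (intro member_le_sum[of j _ "\<lambda>j. \<Sum>\<mu>\<in>spectrum A. C \<mu> i j"]) (auto intro!: sum_nonneg)
      also have "\<dots> \<le> B"
        unfolding B_def using ij C(1)
        by (intro member_le_sum[of i _ "\<lambda>i. \<Sum>j<d. \<Sum>\<mu>\<in>spectrum A. C \<mu> i j"]) (auto intro!: sum_nonneg)
      finally show "cmod (hol_calc f A $$ (i, j)) \<le> B * M" using f(2) by (simp add: mult_right_mono)
    qed (use B f in auto)
    then show "op_norm (hol_calc f A) \<le> (real d * real d * B) * M" by (simp add: mult.assoc)
  qed (use B in auto)
qed

section \<open>Von Neumann's inequality for harmonic functions\<close>

definition unity_root_pt :: "nat \<Rightarrow> nat \<Rightarrow> complex" where
  "unity_root_pt N j = cis (2 * pi * real j / real N)"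

lemma norm_unity_root_pt [simp]: "cmod (unity_root_pt N j) = 1"
  by (simp add: unity_root_pt_def)

lemma unity_root_pt_cnj_mult [simp]: "unity_root_pt N j * cnj (unity_root_pt N j) = 1"
  by (simp add: complex_norm_square[symmetric])

lemma unity_root_pt_power [simp]: "N > 0 \<Longrightarrow> unity_root_pt N j ^ N = 1"
  by (simp add: unity_root_pt_def Complex.DeMoivre cis_multiple_2pi)

text \<open>With \<open>w = cis (2 pi t / N)\<close> the sum is geometric in \<open>w\<close>, and
  \<open>w = 1\<close> exactly when \<open>N\<close> divides \<open>t\<close>.\<close>

lemma sum_unity_root_pt:
  assumes N: "N > 0"
  shows "(\<Sum>j<N. unity_root_pt N j ^ t) = (if N dvd t then of_nat N else 0)"
proof -
  define w where "w = cis (2 * pi * real t / real N)"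
  have w: "unity_root_pt N j ^ t = w ^ j" for j
    by (simp add: unity_root_pt_def w_def Complex.DeMoivre mult_ac)
  show ?thesis
  proof (cases "N dvd t")
    case True
    then obtain k where "t = N * k" by auto
    then have "2 * pi * real t / real N = 2 * pi * real k" using N by simp
    then have "w = 1" unfolding w_def using cis_multiple_2pi[of "real k"] by (simp only: Nats_subset_Ints[THEN subsetD] of_nat_in_Nats)
    then show ?thesis using True by (simp add: w)
  next
    case False
    have "w \<noteq> 1"
    proof
      assume "w = 1"
      then have "cos (2 * pi * real t / real N) = 1" by (simp add: w_def complex_eq_iff)
      then obtain k :: int where "2 * pi * real t / real N = of_int k * 2 * pi"
        by (auto simp: cos_one_2pi_int)
      then have "real t = of_int (k * int N)" using N by (simp add: field_simps)
      then have "int t = k * int N" by linarith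
      then show False using False by (metis dvd_triv_right int_dvd_int_iff)
    qed
    moreover have "w ^ N = 1" using N by (simp add: w_def Complex.DeMoivre cis_multiple_2pi)
    ultimately show ?thesis using False by (simp add: w geometric_sum)
  qed
qed

text \<open>For an \<open>N\<close>-th root of unity \<open>cnj w ^ k = w ^ (N - k)\<close>. The
  exponent \<open>s + (N - k)\<close> lies strictly between 0 and \<open>2 N\<close>, so
  divisibility by \<open>N\<close> forces it to be \<open>N\<close>.\<close>

lemma sum_unity_root_pt_cnj:
  assumes "s < N" "k < N"
  shows "(\<Sum>j<N. unity_root_pt N j ^ s * cnj (unity_root_pt N j) ^ k) = (if s = k then of_nat N else 0)"
proof -
  have N: "N > 0" using assms by simp
  have "unity_root_pt N j ^ s * cnj (unity_root_pt N j) ^ k = unity_root_pt N j ^ (s + (N - k))" for j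
  proof -
    have "k + (N - k) = N" using assms by simp
    then have "cnj (unity_root_pt N j) ^ k = cnj (unity_root_pt N j) ^ k * unity_root_pt N j ^ (k + (N - k))"
      using N by simp
    also have "\<dots> = (unity_root_pt N j * cnj (unity_root_pt N j)) ^ k * unity_root_pt N j ^ (N - k)"
      by (simp only: power_add power_mult_distrib mult_ac)
    finally show ?thesis by (simp add: power_add)
  qed
  moreover have "N dvd s + (N - k) \<longleftrightarrow> s = k"
  proof
    assume "N dvd s + (N - k)"
    then obtain q where q: "s + (N - k) = N * q" by auto
    have "N * 0 < N * q" "N * q < N * 2" unfolding q[symmetric] using assms by linarith+
    then have "q = 1" using N by simp
    then show "s = k" using q assms by simp
  qed (use assms in simp)
  ultimately show ?thesis using sum_unity_root_pt[OF N] by simp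
qed

lemma cscalar_prod_diff_left:
  fixes x :: "complex vec"
  assumes "x \<in> carrier_vec d" "x' \<in> carrier_vec d" "y \<in> carrier_vec d"
  shows "(x - x') \<bullet>c y = x \<bullet>c y - x' \<bullet>c y"
  using assms by (intro minus_scalar_prod_distrib) auto

lemma cscalar_prod_diff_right:
  fixes x :: "complex vec"
  assumes "x \<in> carrier_vec d" "y \<in> carrier_vec d" "y' \<in> carrier_vec d"
  shows "x \<bullet>c (y - y') = x \<bullet>c y - x \<bullet>c y'"
  using assms by (simp add: cscalar_prod_commute[of _ d x] cscalar_prod_commute[of "y - y'" d x]
      cscalar_prod_diff_left[of _ d] cscalar_prod_commute[of y d x] cscalar_prod_commute[of y' d x])

section \<open>The sampled Poisson kernel of a strict contraction\<close>

context
  fixes T :: "complex mat" and d :: nat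
  assumes T: "T \<in> carrier_mat d d" and T1: "op_norm T < 1"
begin

private definition pw :: "nat \<Rightarrow> complex vec \<Rightarrow> complex vec" where
  "pw k v = ((*\<^sub>v) T ^^ k) v"

private lemma pw_carrier [simp]: "v \<in> carrier_vec d \<Longrightarrow> pw k v \<in> carrier_vec d"
  unfolding pw_def using T by (induction k) (auto intro: mult_mat_vec_carrier)

private lemma dim_pw [simp]: "v \<in> carrier_vec d \<Longrightarrow> dim_vec (pw k v) = d"
  using pw_carrier by (rule carrier_vecD)

private lemma pw_0 [simp]: "pw 0 v = v"
  by (simp add: pw_def)

private lemma pw_Suc: "pw (Suc k) v = T *\<^sub>v pw k v"
  by (simp add: pw_def)

private lemma norm_pw_le: "v \<in> carrier_vec d \<Longrightarrow> eucl_norm (pw k v) \<le> op_norm T ^ k * eucl_norm v"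
proof (induction k)
  case (Suc k)
  then have "eucl_norm (pw (Suc k) v) \<le> op_norm T * eucl_norm (pw k v)"
    by (simp add: pw_Suc eucl_norm_mult_mat_vec_le[OF T])
  also have "\<dots> \<le> op_norm T * (op_norm T ^ k * eucl_norm v)"
    using Suc by (intro mult_left_mono) auto
  finally show ?case by simp
qed simp

private lemma pw_cscalar_tendsto_0:
  assumes "u \<in> carrier_vec d" "v \<in> carrier_vec d"
  shows "(\<lambda>N. pw N v \<bullet>c u) \<longlonglongrightarrow> 0" "(\<lambda>N. u \<bullet>c pw N v) \<longlonglongrightarrow> 0"
proof -
  have lim: "(\<lambda>N. op_norm T ^ N * (eucl_norm v * eucl_norm u)) \<longlonglongrightarrow> 0"
    using T1 by (intro tendsto_mult_left_zero LIMSEQ_power_zero) simp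
  have le: "cmod (pw N v \<bullet>c u) \<le> op_norm T ^ N * (eucl_norm v * eucl_norm u)" for N
  proof -
    have "cmod (pw N v \<bullet>c u) \<le> eucl_norm (pw N v) * eucl_norm u"
      using assms by (intro cscalar_prod_le[of _ d]) auto
    also have "\<dots> \<le> op_norm T ^ N * eucl_norm v * eucl_norm u"
      using assms by (intro mult_right_mono norm_pw_le) auto
    finally show ?thesis by (simp add: mult.assoc)
  qed
  show 1: "(\<lambda>N. pw N v \<bullet>c u) \<longlonglongrightarrow> 0"
    by (rule Lim_null_comparison[OF always_eventually lim]) (use le in auto)
  have "(\<lambda>N. cnj (pw N v \<bullet>c u)) \<longlonglongrightarrow> cnj 0" by (intro tendsto_cnj 1)
  moreover have "cnj (pw N v \<bullet>c u) = u \<bullet>c pw N v" for N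
    using assms by (intro cscalar_prod_commute[symmetric, of _ d]) auto
  ultimately show "(\<lambda>N. u \<bullet>c pw N v) \<longlonglongrightarrow> 0" by simp
qed

text \<open>The truncated Neumann series of \<open>(1 - w\<^sup>-\<^sup>1 T)\<^sup>-\<^sup>1 v\<close> for \<open>\<bar>w\<bar> = 1\<close>.\<close>

private definition neumann :: "nat \<Rightarrow> complex \<Rightarrow> complex vec \<Rightarrow> complex vec" where
  "neumann N w v = Matrix.vec d (\<lambda>i. \<Sum>k<N. cnj w ^ k * pw k v $ i)"

private lemma neumann_carrier [simp]: "neumann N w v \<in> carrier_vec d"
  by (simp add: neumann_def)

private lemma neumann_cscalar:
  assumes "v \<in> carrier_vec d" "u \<in> carrier_vec d"
  shows "neumann N w v \<bullet>c u = (\<Sum>k<N. cnj w ^ k * (pw k v \<bullet>c u))"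
proof -
  have "neumann N w v \<bullet>c u = (\<Sum>i=0..<d. \<Sum>k<N. cnj w ^ k * pw k v $ i * cnj (u $ i))"
    using assms by (simp add: scalar_prod_def neumann_def sum_distrib_right)
  also have "\<dots> = (\<Sum>k<N. \<Sum>i=0..<d. cnj w ^ k * pw k v $ i * cnj (u $ i))"
    by (rule sum.swap)
  also have "\<dots> = (\<Sum>k<N. cnj w ^ k * (pw k v \<bullet>c u))"
    using assms by (simp add: scalar_prod_def sum_distrib_left mult.assoc)
  finally show ?thesis .
qed

text \<open>Since \<open>cnj w ^ N = 1\<close>, shifting the sum by one replaces its first term
  \<open>v\<close> by \<open>pw N v\<close>. The truncated sum is thus the exact solution for the
  right-hand side \<open>v - pw N v\<close>, without remainder.\<close>

private lemma mult_neumann: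
  assumes v: "v \<in> carrier_vec d" and w: "w ^ N = 1"
  shows "cnj w \<cdot>\<^sub>v (T *\<^sub>v neumann N w v) = neumann N w v - (v - pw N v)"
proof (rule eq_vecI)
  fix i assume "i < dim_vec (neumann N w v - (v - pw N v))"
  then have i: "i < d" using pw_carrier[OF v, of N] by simp
  have wN: "cnj w ^ N = 1" using w by (metis complex_cnj_one complex_cnj_power)
  have "(cnj w \<cdot>\<^sub>v (T *\<^sub>v neumann N w v)) $ i = cnj w * (\<Sum>l<d. T $$ (i, l) * (\<Sum>k<N. cnj w ^ k * pw k v $ l))"
    using T i by (simp add: scalar_prod_def neumann_def atLeast0LessThan)
  also have "\<dots> = (\<Sum>l<d. \<Sum>k<N. cnj w ^ Suc k * (T $$ (i, l) * pw k v $ l))"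
    by (simp add: sum_distrib_left mult_ac)
  also have "\<dots> = (\<Sum>k<N. \<Sum>l<d. cnj w ^ Suc k * (T $$ (i, l) * pw k v $ l))"
    by (rule sum.swap)
  also have "\<dots> = (\<Sum>k<N. cnj w ^ Suc k * pw (Suc k) v $ i)"
    using T i carrier_vecD[OF pw_carrier[OF v]]
    by (intro sum.cong) (simp_all add: pw_Suc scalar_prod_def atLeast0LessThan sum_distrib_left)
  also have "\<dots> = (\<Sum>k<Suc N. cnj w ^ k * pw k v $ i) - v $ i"
    using v by (subst sum.lessThan_Suc_shift) simp
  also have "\<dots> = (neumann N w v - (v - pw N v)) $ i"
  proof -
    show ?thesis using i v by (simp add: neumann_def wN)
  qed
  finally show "(cnj w \<cdot>\<^sub>v (T *\<^sub>v neumann N w v)) $ i = (neumann N w v - (v - pw N v)) $ i" .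
qed (use T v pw_carrier[OF v, of N] in auto)

text \<open>The form of \<open>1 - T^* T\<close>, nonnegative for a contraction. Evaluated at the
  Neumann sums of \<open>x\<close> and \<open>y\<close> it is, up to truncation, the operator
  Poisson kernel of \<open>T\<close> at the point \<open>w\<close> of the unit circle.\<close>

private definition defect :: "complex vec \<Rightarrow> complex vec \<Rightarrow> complex" where
  "defect u v = u \<bullet>c v - (T *\<^sub>v u) \<bullet>c (T *\<^sub>v v)"

private lemma defect_self:
  assumes "u \<in> carrier_vec d"
  shows "0 \<le> Re (defect u u)"
proof -
  have eq: "defect u u = of_real ((eucl_norm u)\<^sup>2 - (eucl_norm (T *\<^sub>v u))\<^sup>2)"
    by (simp only: defect_def cscalar_prod_self of_real_diff)
  have "eucl_norm (T *\<^sub>v u) \<le> op_norm T * eucl_norm u" by (rule eucl_norm_mult_mat_vec_le[OF T assms])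
  also have "\<dots> \<le> eucl_norm u" using T1 by (simp add: mult_left_le_one_le)
  finally have "(eucl_norm (T *\<^sub>v u))\<^sup>2 \<le> (eucl_norm u)\<^sup>2" by (rule power_mono) simp
  then show "0 \<le> Re (defect u u)" unfolding eq by simp
qed

private lemma defect_commute:
  assumes "u \<in> carrier_vec d" "v \<in> carrier_vec d"
  shows "defect v u = cnj (defect u v)"
  unfolding defect_def using assms T
  by (simp add: cscalar_prod_commute[of u d v] cscalar_prod_commute[of "T *\<^sub>v u" d "T *\<^sub>v v"])

text \<open>Expand the nonnegative form at \<open>u - a v\<close>, where the phase \<open>a\<close>
  makes the cross term real and nonnegative. The arithmetic mean takes the place of the
  Cauchy-Schwarz product because it can be summed over the sample points.\<close>

private lemma norm_defect_le:
  assumes u: "u \<in> carrier_vec d" and v: "v \<in> carrier_vec d"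
  shows "cmod (defect u v) \<le> (Re (defect u u) + Re (defect v v)) / 2"
proof -
  \<comment> \<open>The value 1 in the degenerate case keeps \<open>cmod a = 1\<close>, as
    \<open>sgn 0 = 0\<close>.\<close>
  define a where "a = (if defect u v = 0 then 1 else sgn (defect u v))"
  have a: "cmod a = 1" "cnj a * defect u v = of_real (cmod (defect u v))"
  proof -
    have "cnj (defect u v) * defect u v = of_real ((cmod (defect u v))\<^sup>2)"
      by (subst complex_norm_square) (rule mult.commute)
    then have "defect u v \<noteq> 0 \<Longrightarrow> cnj (sgn (defect u v)) * defect u v = of_real (cmod (defect u v))"
      by (simp add: sgn_eq power2_eq_square)
    then show "cmod a = 1" "cnj a * defect u v = of_real (cmod (defect u v))"
      by (auto simp: a_def norm_sgn)
  qed
  have Tu: "T *\<^sub>v u \<in> carrier_vec d" and Tv: "T *\<^sub>v v \<in> carrier_vec d" using T u v by auto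
  have aa: "a * cnj a = 1" using a(1) by (simp add: complex_norm_square[symmetric])
  have "T *\<^sub>v (u - a \<cdot>\<^sub>v v) = T *\<^sub>v u - a \<cdot>\<^sub>v (T *\<^sub>v v)"
    using T u v by (subst mult_minus_distrib_mat_vec[of _ d d]) (auto simp: mult_mat_vec)
  then have "defect (u - a \<cdot>\<^sub>v v) (u - a \<cdot>\<^sub>v v) = defect u u - cnj a * defect u v - a * defect v u + a * cnj a * defect v v"
    unfolding defect_def using u v Tu Tv
    by (simp add: cscalar_prod_diff_left[of _ d] cscalar_prod_diff_right[of _ d] conjugate_smult_vec algebra_simps)
  then have "0 \<le> Re (defect u u - cnj a * defect u v - a * defect v u + a * cnj a * defect v v)"
    using defect_self[of "u - a \<cdot>\<^sub>v v"] u v by simp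
  moreover have "a * defect v u = of_real (cmod (defect u v))"
    using arg_cong[OF a(2), of cnj] by (simp add: defect_commute[OF u v])
  ultimately show ?thesis by (simp add: a(2) aa)
qed

text \<open>By \<open>mult_neumann\<close>, \<open>cnj w\<close> times \<open>T\<close> maps the
  Neumann sum of \<open>x\<close> to that sum minus \<open>x'\<close>, and the unimodular factor
  does not change the form. The product of the two sums cancels; each remaining term contains at
  most one sum, ready for Fourier orthogonality.\<close>

private lemma defect_neumann:
  assumes x: "x \<in> carrier_vec d" and y: "y \<in> carrier_vec d" and w: "w ^ N = 1" "cmod w = 1"
  defines "x' \<equiv> x - pw N x" and "y' \<equiv> y - pw N y"
  shows "defect (neumann N w x) (neumann N w y) =
    neumann N w x \<bullet>c y' + x' \<bullet>c neumann N w y - x' \<bullet>c y'"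
proof -
  let ?X = "neumann N w x" and ?Y = "neumann N w y"
  have c: "x' \<in> carrier_vec d" "y' \<in> carrier_vec d" using x y by (auto simp: x'_def y'_def)
  have TXY: "T *\<^sub>v ?X \<in> carrier_vec d" "T *\<^sub>v ?Y \<in> carrier_vec d" using T by auto
  have "w * cnj w = 1" using w(2) by (simp add: complex_norm_square[symmetric])
  then have "(T *\<^sub>v ?X) \<bullet>c (T *\<^sub>v ?Y) = (cnj w \<cdot>\<^sub>v (T *\<^sub>v ?X)) \<bullet>c (cnj w \<cdot>\<^sub>v (T *\<^sub>v ?Y))"
    using TXY by (simp add: conjugate_smult_vec mult.assoc[symmetric] mult.commute)
  also have "\<dots> = (?X - x') \<bullet>c (?Y - y')"
    unfolding x'_def y'_def mult_neumann[OF x w(1)] mult_neumann[OF y w(1)] ..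
  also have "\<dots> = ?X \<bullet>c ?Y - ?X \<bullet>c y' - x' \<bullet>c ?Y + x' \<bullet>c y'"
    using c by (simp add: cscalar_prod_diff_left[of _ d] cscalar_prod_diff_right[of _ d])
  finally show ?thesis by (simp add: defect_def)
qed

text \<open>The exact \<open>s\<close>-th Fourier coefficient of the sampled kernel. The first
  summand is the wanted coefficient of \<open>T^s\<close>; the other three are truncation errors
  that vanish as \<open>N\<close> grows.\<close>

private definition moment :: "nat \<Rightarrow> complex vec \<Rightarrow> complex vec \<Rightarrow> nat \<Rightarrow> complex" where
  "moment N x y s = pw s x \<bullet>c y - pw s x \<bullet>c pw N y + x \<bullet>c pw (N - s) y - pw N x \<bullet>c pw (N - s) y"

private lemma sum_defect_neumann:
  assumes x: "x \<in> carrier_vec d" and y: "y \<in> carrier_vec d" and s: "s < N"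
  shows "(\<Sum>j<N. unity_root_pt N j ^ s *
      defect (neumann N (unity_root_pt N j) x) (neumann N (unity_root_pt N j) y)) =
    of_nat N * moment N x y s"
proof -
  let ?w = "unity_root_pt N"
  define x' y' where "x' = x - pw N x" and "y' = y - pw N y"
  have c: "x' \<in> carrier_vec d" "y' \<in> carrier_vec d" using x y by (auto simp: x'_def y'_def)
  have N: "N > 0" using s by simp
  have 1: "(\<Sum>j<N. ?w j ^ s * (neumann N (?w j) x \<bullet>c y')) = of_nat N * (pw s x \<bullet>c y')"
  proof -
    have "(\<Sum>j<N. ?w j ^ s * (neumann N (?w j) x \<bullet>c y')) =
        (\<Sum>j<N. \<Sum>k<N. (?w j ^ s * cnj (?w j) ^ k) * (pw k x \<bullet>c y'))"
      by (simp add: neumann_cscalar[OF x c(2)] sum_distrib_left mult.assoc)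
    also have "\<dots> = (\<Sum>k<N. (\<Sum>j<N. ?w j ^ s * cnj (?w j) ^ k) * (pw k x \<bullet>c y'))"
      by (subst sum.swap) (simp add: sum_distrib_right)
    also have "\<dots> = (\<Sum>k<N. if s = k then of_nat N * (pw k x \<bullet>c y') else 0)"
      using s by (intro sum.cong) (auto simp: sum_unity_root_pt_cnj)
    finally show ?thesis using s by simp
  qed
  \<comment> \<open>The index \<open>k < N\<close> with \<open>N dvd s + k\<close> is
    \<open>N - s\<close>, except that for \<open>s = 0\<close> it is 0 and not \<open>N\<close>. The
    discrepancy is absorbed by the constant term in \<open>3\<close>, which also contributes only
    for \<open>s = 0\<close>.\<close>
  have 2: "(\<Sum>j<N. ?w j ^ s * (x' \<bullet>c neumann N (?w j) y)) =
      of_nat N * (if s = 0 then x' \<bullet>c y else x' \<bullet>c pw (N - s) y)"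
  proof -
    have "x' \<bullet>c neumann N (?w j) y = (\<Sum>k<N. ?w j ^ k * (x' \<bullet>c pw k y))" for j
      using y c by (simp add: cscalar_prod_commute[of "neumann N (?w j) y" d x']
          cscalar_prod_commute[of "pw k y" d x' for k] neumann_cscalar)
    then have "(\<Sum>j<N. ?w j ^ s * (x' \<bullet>c neumann N (?w j) y)) =
        (\<Sum>j<N. \<Sum>k<N. ?w j ^ (s + k) * (x' \<bullet>c pw k y))"
      by (simp add: sum_distrib_left mult.assoc power_add)
    also have "\<dots> = (\<Sum>k<N. (\<Sum>j<N. ?w j ^ (s + k)) * (x' \<bullet>c pw k y))"
      by (subst sum.swap) (simp add: sum_distrib_right)
    also have "\<dots> = (\<Sum>k<N. if k = (if s = 0 then 0 else N - s) then of_nat N * (x' \<bullet>c pw k y) else 0)"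
    proof (rule sum.cong)
      fix k assume k: "k \<in> {..<N}"
      have "N dvd s + k \<longleftrightarrow> k = (if s = 0 then 0 else N - s)"
      proof
        assume "N dvd s + k"
        then obtain q where q: "s + k = N * q" by auto
        have "N * q < N * 2" unfolding q[symmetric] using s k by simp
        then have "q = 0 \<or> q = 1" using N by auto
        then show "k = (if s = 0 then 0 else N - s)" using q s k by auto
      qed (use s in auto)
      then show "(\<Sum>j<N. ?w j ^ (s + k)) * (x' \<bullet>c pw k y) =
          (if k = (if s = 0 then 0 else N - s) then of_nat N * (x' \<bullet>c pw k y) else 0)"
        by (simp add: sum_unity_root_pt[OF N])
    qed simp
    finally show ?thesis using s N by (simp add: sum.delta)
  qed
  have 3: "(\<Sum>j<N. ?w j ^ s * (x' \<bullet>c y')) = of_nat N * (if s = 0 then x' \<bullet>c y' else 0)"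
  proof -
    have "N dvd s \<longleftrightarrow> s = 0" using s by (auto dest: dvd_imp_le)
    then show ?thesis unfolding sum_distrib_right[symmetric] sum_unity_root_pt[OF N] by simp
  qed
  have "(\<Sum>j<N. ?w j ^ s * defect (neumann N (?w j) x) (neumann N (?w j) y)) =
      (\<Sum>j<N. ?w j ^ s * (neumann N (?w j) x \<bullet>c y')) + (\<Sum>j<N. ?w j ^ s * (x' \<bullet>c neumann N (?w j) y))
      - (\<Sum>j<N. ?w j ^ s * (x' \<bullet>c y'))"
    using N by (simp add: defect_neumann[OF x y] x'_def y'_def algebra_simps sum.distrib sum_subtractf)
  also have "\<dots> = of_nat N * (pw s x \<bullet>c y' + (if s = 0 then x' \<bullet>c y - x' \<bullet>c y' else x' \<bullet>c pw (N - s) y))"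
    unfolding 1 2 3 by (simp add: algebra_simps)
  also have "\<dots> = of_nat N * moment N x y s"
    using x y by (simp add: moment_def x'_def y'_def cscalar_prod_diff_left[of _ d] cscalar_prod_diff_right[of _ d])
  finally show ?thesis .
qed

text \<open>Average the harmonic polynomial over the roots of unity with the kernel as weight. The
  total variation of the weight is at most the mean of the masses of the two diagonal kernels, each
  of which is at most \<open>N\<close> times a squared norm.\<close>

private lemma poly_von_Neumann_approx:
  assumes x: "x \<in> carrier_vec d" and y: "y \<in> carrier_vec d"
    and u: "\<And>w. cmod w = 1 \<Longrightarrow> cmod ((\<Sum>s<m. a s * w ^ s) + cnj (\<Sum>s<m. b s * w ^ s)) \<le> M"
    and N: "m < N"
  shows "cmod ((\<Sum>s<m. a s * moment N x y s) + cnj (\<Sum>s<m. b s * moment N y x s))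
    \<le> M * (((eucl_norm x)\<^sup>2 + (eucl_norm y)\<^sup>2) / 2)"
proof -
  let ?w = "unity_root_pt N"
  have N0: "N > 0" using N by simp
  have M: "0 \<le> M" by (rule order_trans[OF norm_ge_zero u[of 1]]) simp
  define B where "B x y j = defect (neumann N (?w j) x) (neumann N (?w j) y)" for x y j
  have avg: "(\<Sum>j<N. ?w j ^ s * B x y j) = of_nat N * moment N x y s"
    if "x \<in> carrier_vec d" "y \<in> carrier_vec d" "s < N" for x y s
    unfolding B_def by (rule sum_defect_neumann[OF that])
  have S: "(\<Sum>j<N. (\<Sum>s<m. a s * ?w j ^ s) * B x y j) = of_nat N * (\<Sum>s<m. a s * moment N x y s)"
    if "x \<in> carrier_vec d" "y \<in> carrier_vec d" for x y a
  proof -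
    have "(\<Sum>j<N. (\<Sum>s<m. a s * ?w j ^ s) * B x y j) = (\<Sum>s<m. a s * (\<Sum>j<N. ?w j ^ s * B x y j))"
      by (simp add: sum_distrib_left sum_distrib_right mult.assoc) (rule sum.swap)
    also have "\<dots> = (\<Sum>s<m. a s * (of_nat N * moment N x y s))"
      using N by (intro sum.cong) (auto simp: avg[OF that])
    finally show ?thesis by (simp add: sum_distrib_left mult_ac)
  qed
  have self: "(\<Sum>j<N. Re (B v v j)) \<le> real N * (eucl_norm v)\<^sup>2" if v: "v \<in> carrier_vec d" for v
  proof -
    have "(\<Sum>j<N. B v v j) = of_nat N * moment N v v 0" using avg[OF v v N0] by simp
    \<comment> \<open>For equal vectors and \<open>s = 0\<close> the two mixed truncation terms
      cancel; the one left has a favourable sign.\<close>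
    also have "moment N v v 0 = v \<bullet>c v - pw N v \<bullet>c pw N v" using v by (simp add: moment_def)
    also have "\<dots> = of_real ((eucl_norm v)\<^sup>2 - (eucl_norm (pw N v))\<^sup>2)"
      by (simp only: cscalar_prod_self of_real_diff)
    finally have "Re (\<Sum>j<N. B v v j) = real N * ((eucl_norm v)\<^sup>2 - (eucl_norm (pw N v))\<^sup>2)"
      by (simp del: of_real_diff of_real_power)
    then show ?thesis by (simp add: right_diff_distrib)
  qed
  have "of_nat N * ((\<Sum>s<m. a s * moment N x y s) + cnj (\<Sum>s<m. b s * moment N y x s)) =
      (\<Sum>j<N. (\<Sum>s<m. a s * ?w j ^ s) * B x y j) + cnj (\<Sum>j<N. (\<Sum>s<m. b s * ?w j ^ s) * B y x j)"
    unfolding S[OF x y] S[OF y x] by (simp add: distrib_left)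
  \<comment> \<open>The kernel is Hermitian, so conjugating the second sum swaps its vectors back:
    the analytic and the antianalytic part meet the same weight \<open>B x y j\<close>.\<close>
  also have "\<dots> = (\<Sum>j<N. ((\<Sum>s<m. a s * ?w j ^ s) + cnj (\<Sum>s<m. b s * ?w j ^ s)) * B x y j)"
    using defect_commute[of "neumann N (?w j) y" "neumann N (?w j) x" for j]
    by (simp add: B_def distrib_right sum.distrib)
  also have "cmod \<dots> \<le> (\<Sum>j<N. M * ((Re (B x x j) + Re (B y y j)) / 2))"
    unfolding B_def using M
    unfolding norm_mult by (intro sum_norm_le) (simp only: norm_mult, intro mult_mono u norm_defect_le, simp_all)
  also have "\<dots> = M * (((\<Sum>j<N. Re (B x x j)) + (\<Sum>j<N. Re (B y y j))) / 2)"
    by (simp add: sum_distrib_left[symmetric] sum_divide_distrib[symmetric] sum.distrib)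
  also have "\<dots> \<le> M * ((real N * (eucl_norm x)\<^sup>2 + real N * (eucl_norm y)\<^sup>2) / 2)"
    using M self[OF x] self[OF y] by (intro mult_left_mono) auto
  finally have "real N * cmod ((\<Sum>s<m. a s * moment N x y s) + cnj (\<Sum>s<m. b s * moment N y x s)) \<le>
      real N * (M * (((eucl_norm x)\<^sup>2 + (eucl_norm y)\<^sup>2) / 2))"
    unfolding norm_mult norm_of_nat by (simp only: distrib_left[symmetric] times_divide_eq_right mult.left_commute)
  then show ?thesis using N0 by simp
qed

text \<open>Let the number of sample points tend to infinity; the strict inequality
  \<open>op_norm T < 1\<close> removes the truncation errors.\<close>

lemma poly_von_Neumann:
  assumes x: "x \<in> carrier_vec d" "eucl_norm x = 1" and y: "y \<in> carrier_vec d" "eucl_norm y = 1"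
    and u: "\<And>w. cmod w = 1 \<Longrightarrow> cmod ((\<Sum>s<m. a s * w ^ s) + cnj (\<Sum>s<m. b s * w ^ s)) \<le> M"
  shows "cmod ((\<Sum>s<m. a s * (((*\<^sub>v) T ^^ s) x \<bullet>c y)) + cnj (\<Sum>s<m. b s * (((*\<^sub>v) T ^^ s) y \<bullet>c x))) \<le> M"
proof (rule tendsto_upperbound)
  have lim: "(\<lambda>N. moment N x y s) \<longlonglongrightarrow> pw s x \<bullet>c y - 0 + 0 - 0"
    if x: "x \<in> carrier_vec d" and y: "y \<in> carrier_vec d" for x y s
    unfolding moment_def
  proof (intro tendsto_intros pw_cscalar_tendsto_0)
    have sub: "filterlim (\<lambda>N. N - s) sequentially sequentially"
      by (rule filterlim_minus_const_nat_at_top)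
    show "(\<lambda>N. x \<bullet>c pw (N - s) y) \<longlonglongrightarrow> 0"
      by (rule filterlim_compose[OF pw_cscalar_tendsto_0(2)[OF x y] sub])
    have "(\<lambda>N. pw N x \<bullet>c pw (N - s) y) \<longlonglongrightarrow> 0"
    proof (rule Lim_null_comparison)
      show "(\<lambda>N. (op_norm T ^ N * eucl_norm x) * eucl_norm y) \<longlonglongrightarrow> 0"
        using T1 by (intro tendsto_mult_left_zero LIMSEQ_power_zero) simp
      have "cmod (pw N x \<bullet>c pw (N - s) y) \<le> (op_norm T ^ N * eucl_norm x) * eucl_norm y" for N
      proof -
        have "cmod (pw N x \<bullet>c pw (N - s) y) \<le> eucl_norm (pw N x) * eucl_norm (pw (N - s) y)"
          using x y by (intro cscalar_prod_le[of _ d]) auto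
        also have "\<dots> \<le> (op_norm T ^ N * eucl_norm x) * eucl_norm y"
        proof (rule mult_mono[OF norm_pw_le[OF x]])
          have "op_norm T ^ (N - s) * eucl_norm y \<le> 1 * eucl_norm y"
            using T1 by (intro mult_right_mono power_le_one) auto
          with norm_pw_le[OF y, of "N - s"] show "eucl_norm (pw (N - s) y) \<le> eucl_norm y" by simp
        qed auto
        finally show ?thesis .
      qed
      then show "\<forall>\<^sub>F N in sequentially. norm (pw N x \<bullet>c pw (N - s) y) \<le> (op_norm T ^ N * eucl_norm x) * eucl_norm y"
        by simp
    qed
    then show "(\<lambda>N. pw N x \<bullet>c pw (N - s) y) \<longlonglongrightarrow> 0" .
  qed (use x y in auto)
  show "(\<lambda>N. cmod ((\<Sum>s<m. a s * moment N x y s) + cnj (\<Sum>s<m. b s * moment N y x s))) \<longlonglongrightarrow>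
      cmod ((\<Sum>s<m. a s * (((*\<^sub>v) T ^^ s) x \<bullet>c y)) + cnj (\<Sum>s<m. b s * (((*\<^sub>v) T ^^ s) y \<bullet>c x)))"
    unfolding pw_def[symmetric] using lim[OF x(1) y(1)] lim[OF y(1) x(1)]
    by (intro tendsto_intros) simp_all
  show "\<forall>\<^sub>F N in sequentially. cmod ((\<Sum>s<m. a s * moment N x y s) + cnj (\<Sum>s<m. b s * moment N y x s)) \<le> M"
    using eventually_gt_at_top[of m]
  proof eventually_elim
    case (elim N)
    from poly_von_Neumann_approx[OF x(1) y(1) u elim] show ?case unfolding x(2) y(2) by simp
  qed
qed simp

end

section \<open>From polynomials in a contraction to functions analytic on a closed disk\<close>

lemma analytic_on_cball_poly_limit:
  assumes P: "P analytic_on cball (0::complex) \<rho>" and \<rho>: "0 < \<rho>"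
  obtains a where "uniform_limit (cball 0 \<rho>) (\<lambda>m w. \<Sum>s<m. a s * w ^ s) P sequentially"
proof -
  obtain U where U: "open U" "cball 0 \<rho> \<subseteq> U" "P holomorphic_on U"
    using P by (auto simp: analytic_on_holomorphic)
  obtain e where e: "e > 0" "(\<Union>x\<in>cball 0 \<rho>. cball x e) \<subseteq> U"
    using compact_subset_open_imp_cball_epsilon_subset[OF compact_cball U(1,2)] by blast
  have "ball 0 (\<rho> + e) \<subseteq> U"
  proof
    fix z :: complex assume z: "z \<in> ball 0 (\<rho> + e)"
    show "z \<in> U"
    proof (cases "cmod z \<le> \<rho>")
      case False
      define x where "x = of_real (\<rho> / cmod z) * z"
      have nz: "cmod z > 0" using False \<rho> by linarith
      have "x \<in> cball 0 \<rho>" using nz \<rho> by (simp add: x_def norm_mult norm_divide)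
      have "x - z = of_real (\<rho> / cmod z - 1) * z" by (simp add: x_def algebra_simps)
      then have "dist x z = \<bar>\<rho> / cmod z - 1\<bar> * cmod z"
        by (simp only: dist_norm norm_mult norm_of_real)
      also have "\<dots> = cmod z - \<rho>" using False nz by (simp add: field_simps abs_if)
      finally have "z \<in> cball x e" using z by simp
      with \<open>x \<in> cball 0 \<rho>\<close> show ?thesis using e by blast
    qed (use U in auto)
  qed
  then have hol: "P holomorphic_on ball 0 (\<rho> + e)" using U(3) holomorphic_on_subset by blast
  define a where "a n = (deriv ^^ n) P 0 / fact n" for n
  have sums: "(\<lambda>n. a n * w ^ n) sums P w" if "cmod w < \<rho> + e" for w
    using holomorphic_power_series[OF hol, of w] that by (simp add: a_def)
  \<comment> \<open>Convergence at a slightly larger radius gives absolute convergence at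
    \<open>\<rho>\<close>, the majorant for the M-test.\<close>
  have "summable (\<lambda>n. a n * of_real (\<rho> + e / 2) ^ n)"
    using sums[of "of_real (\<rho> + e / 2)"] e \<rho> by (simp add: sums_iff del: of_real_add)
  then have "summable (\<lambda>n. norm (a n * of_real \<rho> ^ n))"
    using e \<rho> by (rule_tac powser_insidea) (auto simp del: of_real_add)
  then have "uniform_limit (cball 0 \<rho>) (\<lambda>n x. \<Sum>i<n. a i * x ^ i) (\<lambda>x. suminf (\<lambda>i. a i * x ^ i)) sequentially"
    using \<rho> by (intro Weierstrass_m_test[where M = "\<lambda>n. norm (a n * of_real \<rho> ^ n)"])
      (auto simp: norm_mult norm_power intro!: mult_left_mono power_mono)
  also have "?this \<longleftrightarrow> uniform_limit (cball 0 \<rho>) (\<lambda>n x. \<Sum>i<n. a i * x ^ i) P sequentially"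
    using sums e by (intro uniform_limit_cong' refl) (auto simp: sums_iff)
  finally show ?thesis by (rule that)
qed

text \<open>Choose a phase \<open>a\<close> that makes the value at \<open>w\<close> a positive
  real. Then \<open>a (P + cnj Q)\<close> has the same real part as the analytic
  \<open>G = a P + cnj a Q\<close>, and the maximum principle applies to \<open>exp G\<close>, whose
  modulus is the exponential of that real part.\<close>

lemma harmonic_le_boundary:
  assumes P: "P analytic_on cball (0::complex) \<rho>" and Q: "Q analytic_on cball 0 \<rho>"
    and le: "\<And>w. cmod w = \<rho> \<Longrightarrow> cmod (P w + cnj (Q w)) \<le> M" and w: "cmod w \<le> \<rho>"
  shows "cmod (P w + cnj (Q w)) \<le> M"
proof (cases "P w + cnj (Q w) = 0")
  case True
  have "cmod (of_real \<rho>) = \<rho>" using w order_trans[OF norm_ge_zero w] by simp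
  from order_trans[OF norm_ge_zero le[OF this]] show ?thesis using True by simp
next
  case False
  define a where "a = cnj (sgn (P w + cnj (Q w)))"
  have a: "cmod a = 1" using False by (simp add: a_def norm_sgn)
  have aw: "a * (P w + cnj (Q w)) = of_real (cmod (P w + cnj (Q w)))"
  proof -
    have "cnj (P w + cnj (Q w)) * (P w + cnj (Q w)) = of_real ((cmod (P w + cnj (Q w)))\<^sup>2)"
      by (subst complex_norm_square) (rule mult.commute)
    then show ?thesis using False by (simp add: a_def sgn_eq power2_eq_square)
  qed
  define G where "G v = a * P v + cnj a * Q v" for v
  have Re_G: "Re (G v) = Re (a * (P v + cnj (Q v)))" for v
    by (simp add: G_def algebra_simps)
  have G: "(\<lambda>v. exp (G v)) holomorphic_on cball 0 \<rho>"
    unfolding G_def by (intro analytic_imp_holomorphic analytic_intros P Q)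
  have "cmod (exp (G w)) \<le> exp M"
  proof (rule maximum_modulus_frontier[of "\<lambda>v. exp (G v)" "cball 0 \<rho>"])
    show "(\<lambda>v. exp (G v)) holomorphic_on interior (cball 0 \<rho>)"
      by (rule holomorphic_on_subset[OF G interior_subset])
    show "continuous_on (closure (cball 0 \<rho>)) (\<lambda>v. exp (G v))"
      using holomorphic_on_imp_continuous_on[OF G] by simp
    show "w \<in> cball 0 \<rho>" using w by simp
    fix v :: complex assume "v \<in> frontier (cball 0 \<rho>)"
    then have v: "cmod v = \<rho>" by (simp add: frontier_cball)
    have "Re (G v) \<le> cmod (a * (P v + cnj (Q v)))" unfolding Re_G by (rule complex_Re_le_cmod)
    also have "\<dots> \<le> M" using le[OF v] by (simp add: norm_mult a)
    finally show "cmod (exp (G v)) \<le> exp M" by simp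
  qed simp
  then have "Re (G w) \<le> M" by simp
  then show ?thesis unfolding Re_G aw by simp
qed

lemma hol_calc_power_mult_vec:
  assumes A: "A \<in> carrier_mat d d" and W: "open W" "spectrum A \<subseteq> W"
    and \<tau>: "\<tau> holomorphic_on W" and x: "x \<in> carrier_vec d"
  shows "hol_calc (\<lambda>z. \<tau> z ^ s) A *\<^sub>v x = ((*\<^sub>v) (hol_calc \<tau> A) ^^ s) x"
proof (induction s)
  case 0
  then show ?case using x by (simp add: hol_calc_one[OF A])
next
  case (Suc s)
  have "hol_calc (\<lambda>z. \<tau> z * \<tau> z ^ s) A = hol_calc \<tau> A * hol_calc (\<lambda>z. \<tau> z ^ s) A"
    by (intro hol_calc_mult[OF A W] holomorphic_intros \<tau>)
  then show ?case
    using Suc x by (simp add: assoc_mult_mat_vec[OF hol_calc_carrier[OF A] hol_calc_carrier[OF A]])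
qed

text \<open>Bridges two formulations: von Neumann's inequality is stated for iterates of a matrix on
  vectors, the calculus for functions of \<open>z\<close>.\<close>

lemma hol_calc_poly_cscalar:
  assumes A: "A \<in> carrier_mat d d" and W: "open W" "spectrum A \<subseteq> W"
    and \<tau>: "\<tau> holomorphic_on W" and x: "x \<in> carrier_vec d" and y: "y \<in> carrier_vec d"
  shows "(hol_calc (\<lambda>z. \<Sum>s<m. a s * \<tau> z ^ s) A *\<^sub>v x) \<bullet>c y =
    (\<Sum>s<m. a s * (((*\<^sub>v) (hol_calc \<tau> A) ^^ s) x \<bullet>c y))"
proof (induction m)
  case 0
  have "hol_calc (\<lambda>_. 0) A *\<^sub>v x = 0\<^sub>v d"
    unfolding hol_calc_const[OF A] using x by (intro eq_vecI) (auto simp: scalar_prod_def)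
  then show ?case using y by simp
next
  case (Suc m)
  let ?F = "hol_calc (\<lambda>z. \<Sum>s<m. a s * \<tau> z ^ s) A" and ?G = "hol_calc (\<lambda>z. \<tau> z ^ m) A"
  have c: "?F \<in> carrier_mat d d" "?G \<in> carrier_mat d d" using A by auto
  have "hol_calc (\<lambda>z. (\<Sum>s<m. a s * \<tau> z ^ s) + a m * \<tau> z ^ m) A = ?F + hol_calc (\<lambda>z. a m * \<tau> z ^ m) A"
    by (intro hol_calc_add[OF A W] holomorphic_intros \<tau>)
  also have "hol_calc (\<lambda>z. a m * \<tau> z ^ m) A = a m \<cdot>\<^sub>m ?G"
    by (intro hol_calc_cmult[OF A W] holomorphic_intros \<tau>)
  finally have "hol_calc (\<lambda>z. \<Sum>s<Suc m. a s * \<tau> z ^ s) A *\<^sub>v x = ?F *\<^sub>v x + a m \<cdot>\<^sub>v (?G *\<^sub>v x)"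
    using c x by (simp add: add_mult_distrib_mat_vec[of _ d d] smult_mat_mult_mat_vec[of _ d d])
  also have "\<dots> \<bullet>c y = (?F *\<^sub>v x) \<bullet>c y + a m * ((?G *\<^sub>v x) \<bullet>c y)"
    using c x y by (subst add_scalar_prod_distrib[of _ d]) (auto intro!: mult_mat_vec_carrier)
  finally show ?case by (simp add: Suc hol_calc_power_mult_vec[OF A W \<tau> x])
qed

text \<open>Dividing \<open>hol_calc \<tau> A\<close> by \<open>\<rho>\<close> makes it a strict
  contraction; the powers of \<open>\<rho>\<close> move into the coefficients.\<close>

lemma hol_calc_von_Neumann_poly:
  assumes A: "A \<in> carrier_mat d d" and W: "open W" "spectrum A \<subseteq> W"
    and \<tau>: "\<tau> holomorphic_on W" and \<rho>: "op_norm (hol_calc \<tau> A) < \<rho>"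
    and le: "\<And>w. cmod w = \<rho> \<Longrightarrow> cmod ((\<Sum>s<m. a s * w ^ s) + cnj (\<Sum>s<m. b s * w ^ s)) \<le> M"
  shows "op_norm (hol_calc (\<lambda>z. \<Sum>s<m. a s * \<tau> z ^ s) A +
    mat_adjoint (hol_calc (\<lambda>z. \<Sum>s<m. b s * \<tau> z ^ s) A)) \<le> M"
proof -
  have \<rho>0: "0 < \<rho>" using \<rho> op_norm_nonneg order_le_less_trans by blast
  define \<sigma> where "\<sigma> z = of_real (inverse \<rho>) * \<tau> z" for z
  have \<sigma>: "\<sigma> holomorphic_on W" unfolding \<sigma>_def by (intro holomorphic_intros \<tau>)
  let ?T = "hol_calc \<sigma> A"
  have T: "?T \<in> carrier_mat d d" using A by simp
  have "?T = of_real (inverse \<rho>) \<cdot>\<^sub>m hol_calc \<tau> A"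
    unfolding \<sigma>_def by (rule hol_calc_cmult[OF A W \<tau>])
  then have "op_norm ?T \<le> inverse \<rho> * op_norm (hol_calc \<tau> A)"
    using op_norm_smult_le[OF hol_calc_carrier[OF A], of "of_real (inverse \<rho>)" \<tau>] \<rho>0
    by (simp add: norm_inverse)
  also have "\<dots> < inverse \<rho> * \<rho>" using \<rho> \<rho>0 by (intro mult_strict_left_mono) auto
  finally have T1: "op_norm ?T < 1" using \<rho>0 by simp
  define a' b' where "a' s = a s * of_real \<rho> ^ s" and "b' s = b s * of_real \<rho> ^ s" for s
  have u: "cmod ((\<Sum>s<m. a' s * w ^ s) + cnj (\<Sum>s<m. b' s * w ^ s)) \<le> M" if "cmod w = 1" for w
    using le[of "of_real \<rho> * w"] that \<rho>0
    by (simp add: a'_def b'_def norm_mult power_mult_distrib mult.assoc)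
  have \<tau>\<sigma>: "\<tau> z = of_real \<rho> * \<sigma> z" for z using \<rho>0 by (simp add: \<sigma>_def)
  have eq: "(\<lambda>z. \<Sum>s<m. a s * \<tau> z ^ s) = (\<lambda>z. \<Sum>s<m. a' s * \<sigma> z ^ s)"
    "(\<lambda>z. \<Sum>s<m. b s * \<tau> z ^ s) = (\<lambda>z. \<Sum>s<m. b' s * \<sigma> z ^ s)"
    unfolding a'_def b'_def \<tau>\<sigma> power_mult_distrib by (simp_all add: mult.assoc)
  let ?F = "hol_calc (\<lambda>z. \<Sum>s<m. a' s * \<sigma> z ^ s) A" and ?G = "hol_calc (\<lambda>z. \<Sum>s<m. b' s * \<sigma> z ^ s) A"
  have c: "?F \<in> carrier_mat d d" "?G \<in> carrier_mat d d" using A by auto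
  show ?thesis
    unfolding eq
  proof (rule op_norm_le_cscalar_prod)
    show "?F + mat_adjoint ?G \<in> carrier_mat d d"
      using mat_adjoint_carrier[OF c(2)] by (rule add_carrier_mat)
    show "0 \<le> M" by (rule order_trans[OF norm_ge_zero u[of 1]]) simp
    fix x y :: "complex vec"
    assume xy: "x \<in> carrier_vec d" "y \<in> carrier_vec d" "eucl_norm x = 1" "eucl_norm y = 1"
    have "((?F + mat_adjoint ?G) *\<^sub>v x) \<bullet>c y = (?F *\<^sub>v x) \<bullet>c y + (mat_adjoint ?G *\<^sub>v x) \<bullet>c y"
      using c mat_adjoint_carrier[OF c(2)] xy
      by (simp add: add_mult_distrib_mat_vec[of _ d d] add_scalar_prod_distrib[of _ d] mult_mat_vec_carrier[of _ d d])
    also have "(mat_adjoint ?G *\<^sub>v x) \<bullet>c y = cnj ((?G *\<^sub>v y) \<bullet>c x)"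
      unfolding cscalar_prod_mat_adjoint[OF c(2) xy(1,2)]
      using c xy by (intro cscalar_prod_commute[of _ d]) auto
    finally show "cmod (((?F + mat_adjoint ?G) *\<^sub>v x) \<bullet>c y) \<le> M"
      using poly_von_Neumann[OF T T1 xy(1,3,2,4) u] xy
      by (simp only: hol_calc_poly_cscalar[OF A W \<sigma>])
  qed
qed

lemma hol_calc_von_Neumann:
  assumes A: "A \<in> carrier_mat d d" and W: "open W" "spectrum A \<subseteq> W"
    and \<tau>: "\<tau> holomorphic_on W" "\<And>z. z \<in> W \<Longrightarrow> cmod (\<tau> z) \<le> \<rho>" and \<rho>: "op_norm (hol_calc \<tau> A) < \<rho>"
    and P: "P analytic_on cball 0 \<rho>" and Q: "Q analytic_on cball 0 \<rho>"
    and le: "\<And>w. cmod w = \<rho> \<Longrightarrow> cmod (P w + cnj (Q w)) \<le> M"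
  shows "op_norm (hol_calc (\<lambda>z. P (\<tau> z)) A + mat_adjoint (hol_calc (\<lambda>z. Q (\<tau> z)) A)) \<le> M"
proof (rule field_le_epsilon)
  fix e :: real assume e: "0 < e"
  have \<rho>0: "0 < \<rho>" using \<rho> op_norm_nonneg order_le_less_trans by blast
  obtain C where C: "0 \<le> C" "\<And>f M. f holomorphic_on W \<Longrightarrow> 0 \<le> M \<Longrightarrow> (\<And>z. z \<in> W \<Longrightarrow> cmod (f z) \<le> M) \<Longrightarrow>
      op_norm (hol_calc f A) \<le> C * M"
    using hol_calc_bounded[OF A W] by blast
  \<comment> \<open>The error consists of \<open>2 e'\<close> from perturbing the boundary bound and
    \<open>2 C e'\<close> from the two remainders under the calculus.\<close>
  define e' where "e' = e / (2 + 2 * C)"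
  have "e' * (2 + 2 * C) = e" using C(1) by (simp add: e'_def)
  then have e': "0 < e'" "2 * e' + 2 * (C * e') = e"
    using e C(1) by (simp add: e'_def, simp add: algebra_simps)
  obtain a where a: "uniform_limit (cball 0 \<rho>) (\<lambda>m w. \<Sum>s<m. a s * w ^ s) P sequentially"
    using analytic_on_cball_poly_limit[OF P \<rho>0] .
  obtain b where b: "uniform_limit (cball 0 \<rho>) (\<lambda>m w. \<Sum>s<m. b s * w ^ s) Q sequentially"
    using analytic_on_cball_poly_limit[OF Q \<rho>0] .
  obtain m where m: "\<forall>w\<in>cball 0 \<rho>. dist (\<Sum>s<m. a s * w ^ s) (P w) < e'"
    "\<forall>w\<in>cball 0 \<rho>. dist (\<Sum>s<m. b s * w ^ s) (Q w) < e'"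
    using eventually_happens'[OF sequentially_bot eventually_conj[OF uniform_limitD[OF a e'(1)] uniform_limitD[OF b e'(1)]]]
    by blast
  define p q where "p w = (\<Sum>s<m. a s * w ^ s)" and "q w = (\<Sum>s<m. b s * w ^ s)" for w
  have pq: "cmod (P w - p w) \<le> e'" "cmod (Q w - q w) \<le> e'" if "cmod w \<le> \<rho>" for w
    using bspec[OF m(1), of w] bspec[OF m(2), of w] that
    by (simp_all add: p_def q_def dist_norm norm_minus_commute)
  have main: "op_norm (hol_calc (\<lambda>z. p (\<tau> z)) A + mat_adjoint (hol_calc (\<lambda>z. q (\<tau> z)) A)) \<le> M + 2 * e'"
    unfolding p_def q_def
  proof (rule hol_calc_von_Neumann_poly[OF A W \<tau>(1) \<rho>], fold p_def q_def)
    fix w :: complex assume w: "cmod w = \<rho>"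
    have "p w + cnj (q w) = (P w + cnj (Q w)) - ((P w - p w) + cnj (Q w - q w))" by simp
    also have "cmod \<dots> \<le> cmod (P w + cnj (Q w)) + (cmod (P w - p w) + cmod (Q w - q w))"
      using norm_triangle_ineq4[of "P w + cnj (Q w)" "(P w - p w) + cnj (Q w - q w)"]
        norm_triangle_ineq[of "P w - p w" "cnj (Q w - q w)"] unfolding complex_mod_cnj by linarith
    also have "\<dots> \<le> M + 2 * e'" using le[OF w] pq[of w] w by simp
    finally show "cmod (p w + cnj (q w)) \<le> M + 2 * e'" .
  qed
  have hol: "(\<lambda>z. F (\<tau> z)) holomorphic_on W" if "F analytic_on cball 0 \<rho>" for F
  proof -
    have "\<tau> ` W \<subseteq> cball 0 \<rho>" using \<tau>(2) by auto
    from holomorphic_on_compose_gen[OF \<tau>(1) analytic_imp_holomorphic[OF that] this] show ?thesis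
      by (simp add: o_def)
  qed
  have p: "p analytic_on S" and q: "q analytic_on S" for S
    unfolding p_def q_def by (intro analytic_intros; simp)+
  have split: "hol_calc (\<lambda>z. F (\<tau> z)) A = hol_calc (\<lambda>z. G (\<tau> z)) A + hol_calc (\<lambda>z. F (\<tau> z) - G (\<tau> z)) A"
    if "F analytic_on cball 0 \<rho>" "G analytic_on cball 0 \<rho>" for F G
  proof -
    have "hol_calc (\<lambda>z. G (\<tau> z) + (F (\<tau> z) - G (\<tau> z))) A =
        hol_calc (\<lambda>z. G (\<tau> z)) A + hol_calc (\<lambda>z. F (\<tau> z) - G (\<tau> z)) A"
      by (rule hol_calc_add[OF A W hol[OF that(2)] holomorphic_on_diff[OF hol[OF that(1)] hol[OF that(2)]]])
    then show ?thesis by simp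
  qed
  have small: "op_norm (hol_calc (\<lambda>z. P (\<tau> z) - p (\<tau> z)) A) \<le> C * e'"
    "op_norm (hol_calc (\<lambda>z. Q (\<tau> z) - q (\<tau> z)) A) \<le> C * e'"
    using e'(1) \<tau>(2) pq
    by (auto intro!: C(2) holomorphic_on_diff hol[OF P] hol[OF p] hol[OF Q] hol[OF q])
  let ?p = "hol_calc (\<lambda>z. p (\<tau> z)) A" and ?q = "hol_calc (\<lambda>z. q (\<tau> z)) A"
  let ?P = "hol_calc (\<lambda>z. P (\<tau> z) - p (\<tau> z)) A" and ?Q = "hol_calc (\<lambda>z. Q (\<tau> z) - q (\<tau> z)) A"
  note c = hol_calc_carrier[OF A]
  note c' = mat_adjoint_carrier[OF c]
  have adj: "mat_adjoint (?q + ?Q) = mat_adjoint ?q + mat_adjoint ?Q"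
    using A by (intro eq_matI) (simp_all add: mat_adjoint_index[OF c] mat_adjoint_index[OF add_carrier_mat[OF c]])
  have eq: "hol_calc (\<lambda>z. P (\<tau> z)) A + mat_adjoint (hol_calc (\<lambda>z. Q (\<tau> z)) A) =
      (?p + mat_adjoint ?q) + (?P + mat_adjoint ?Q)"
    unfolding split[OF P p] split[OF Q q] adj using A by (intro eq_matI) auto
  have "op_norm ((?p + mat_adjoint ?q) + (?P + mat_adjoint ?Q))
      \<le> op_norm (?p + mat_adjoint ?q) + op_norm (?P + mat_adjoint ?Q)"
    by (rule op_norm_add_le[OF add_carrier_mat[OF c'] add_carrier_mat[OF c']])
  moreover have "op_norm (?P + mat_adjoint ?Q) \<le> op_norm ?P + op_norm (mat_adjoint ?Q)"
    by (rule op_norm_add_le[OF c c'])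
  moreover have "op_norm (mat_adjoint ?Q) \<le> op_norm ?Q" by (rule op_norm_mat_adjoint_le[OF c])
  ultimately show "op_norm (hol_calc (\<lambda>z. P (\<tau> z)) A + mat_adjoint (hol_calc (\<lambda>z. Q (\<tau> z)) A)) \<le> M + e"
    unfolding eq using main small e'(2) by linarith
qed

section \<open>The extremal argument\<close>

lemma quadratic_bound_of_cubic:
  fixes k p q :: real
  assumes "k ^ 3 \<le> p * k\<^sup>2 + q * k" "0 \<le> k" "0 \<le> p" "0 \<le> q"
  shows "k \<le> p / 2 + sqrt (p\<^sup>2 / 4 + q)"
proof (cases "k = 0")
  case False
  then have k: "0 < k" using assms by simp
  have "k * k\<^sup>2 \<le> k * (p * k + q)" using assms(1) by (simp add: power3_eq_cube power2_eq_square algebra_simps)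
  then have "k\<^sup>2 \<le> p * k + q" using k by simp
  then have "(k - p / 2)\<^sup>2 \<le> p\<^sup>2 / 4 + q" by (simp add: power2_eq_square algebra_simps)
  then have "k - p / 2 \<le> sqrt (p\<^sup>2 / 4 + q)" by (rule real_le_rsqrt)
  then show ?thesis by simp
qed (use assms in simp)

text \<open>The boundary of \<open>K\<close> is covered by the sets \<open>\<bar>\<tau>\<^sub>i\<bar> = \<rho>\<^sub>i\<close>, and each
  \<open>\<tau>\<^sub>i(A) / \<rho>\<^sub>i\<close> is a strict contraction. In the decomposition, \<open>P\<^sub>i\<close> and the conjugate of \<open>Q\<^sub>i\<close> are the analytic
  and the antianalytic part of \<open>f\<close> on the \<open>i\<close>-th circle, viewed in the variable \<open>w = \<tau>\<^sub>i(z)\<close>.\<close>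

locale contraction_cover =
  fixes A :: "complex mat" and d :: nat and W K :: "complex set"
    and I :: "'i set" and \<tau> :: "'i \<Rightarrow> complex \<Rightarrow> complex" and \<rho> :: "'i \<Rightarrow> real"
  assumes A: "A \<in> carrier_mat d d"
    and W: "open W" "spectrum A \<subseteq> W" "W \<subseteq> K"
    and K: "compact K"
    and I: "finite I" "2 \<le> card I"
    and \<tau>: "\<And>i. i \<in> I \<Longrightarrow> \<tau> i analytic_on K"
    and \<tau>_le: "\<And>i z. i \<in> I \<Longrightarrow> z \<in> K \<Longrightarrow> cmod (\<tau> i z) \<le> \<rho> i"
    and \<tau>_onto: "\<And>i w. i \<in> I \<Longrightarrow> cmod w = \<rho> i \<Longrightarrow> \<exists>z\<in>K. \<tau> i z = w"
    and op_norm_\<tau>: "\<And>i. i \<in> I \<Longrightarrow> op_norm (hol_calc (\<tau> i) A) < \<rho> i"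
    and frontier_K: "\<And>z. z \<in> frontier K \<Longrightarrow> \<exists>i\<in>I. cmod (\<tau> i z) = \<rho> i"
    and decompose: "\<And>f. f analytic_on K \<Longrightarrow> \<exists>P Q. (\<forall>i\<in>I. P i analytic_on cball 0 (\<rho> i) \<and> Q i analytic_on cball 0 (\<rho> i) \<and>
        (\<forall>z\<in>K. cmod (\<tau> i z) = \<rho> i \<longrightarrow> cnj (Q i (\<tau> i z)) = f z - P i (\<tau> i z))) \<and>
        (\<forall>z\<in>K. f z = (\<Sum>i\<in>I. P i (\<tau> i z)))"
begin

lemma holomorphic_W: "f analytic_on K \<Longrightarrow> f holomorphic_on W"
  using W(3) analytic_imp_holomorphic holomorphic_on_subset by blast

text \<open>Each index costs 1 in the triangle inequality, which is the origin of the factor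
  \<open>card I\<close> in the cubic inequality.\<close>

lemma hol_calc_sum_add_adjoint_le:
  assumes "finite J"
    and "\<And>i. i \<in> J \<Longrightarrow> F i holomorphic_on W" "\<And>i. i \<in> J \<Longrightarrow> G i holomorphic_on W"
    and "\<And>i. i \<in> J \<Longrightarrow> op_norm (hol_calc (F i) A + mat_adjoint (hol_calc (G i) A)) \<le> 1"
  shows "op_norm (hol_calc (\<lambda>z. \<Sum>i\<in>J. F i z) A + mat_adjoint (hol_calc (\<lambda>z. \<Sum>i\<in>J. G i z) A)) \<le> real (card J)"
  using assms
proof (induction J rule: finite_induct)
  case empty
  have "hol_calc (\<lambda>_. 0) A + mat_adjoint (hol_calc (\<lambda>_. 0) A) = 0\<^sub>m d d"
    unfolding hol_calc_const[OF A]
    by (intro eq_matI) (auto simp: mat_adjoint_index[of _ d d])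
  moreover have "op_norm (0\<^sub>m d d) \<le> 0"
  proof (rule op_norm_le[of _ d d])
    fix v :: "complex vec" assume "v \<in> carrier_vec d"
    then have "0\<^sub>m d d *\<^sub>v v = 0\<^sub>v d" by (intro eq_vecI) (auto simp: scalar_prod_def)
    then show "eucl_norm (0\<^sub>m d d *\<^sub>v v) \<le> 0 * eucl_norm v" by simp
  qed auto
  ultimately show ?case by simp
next
  case (insert i J)
  note c = hol_calc_carrier[OF A]
  note c' = mat_adjoint_carrier[OF c]
  have S: "hol_calc (\<lambda>z. \<Sum>i\<in>insert i J. H i z) A = hol_calc (H i) A + hol_calc (\<lambda>z. \<Sum>i\<in>J. H i z) A"
    if "\<And>j. j \<in> insert i J \<Longrightarrow> H j holomorphic_on W" for H
  proof -
    have "hol_calc (\<lambda>z. H i z + (\<Sum>i\<in>J. H i z)) A = hol_calc (H i) A + hol_calc (\<lambda>z. \<Sum>i\<in>J. H i z) A"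
      by (intro hol_calc_add[OF A W(1,2)] holomorphic_intros that) auto
    then show ?thesis using insert.hyps by simp
  qed
  let ?F = "hol_calc (F i) A" and ?G = "hol_calc (G i) A"
  let ?SF = "hol_calc (\<lambda>z. \<Sum>i\<in>J. F i z) A" and ?SG = "hol_calc (\<lambda>z. \<Sum>i\<in>J. G i z) A"
  have adj: "mat_adjoint (?G + ?SG) = mat_adjoint ?G + mat_adjoint ?SG"
    using A by (intro eq_matI) (simp_all add: mat_adjoint_index[OF c] mat_adjoint_index[OF add_carrier_mat[OF c]])
  have SF: "hol_calc (\<lambda>z. \<Sum>i\<in>insert i J. F i z) A = ?F + ?SF"
    by (rule S) (rule insert.prems(1))
  have SG: "hol_calc (\<lambda>z. \<Sum>i\<in>insert i J. G i z) A = ?G + ?SG"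
    by (rule S) (rule insert.prems(2))
  have "hol_calc (\<lambda>z. \<Sum>i\<in>insert i J. F i z) A + mat_adjoint (hol_calc (\<lambda>z. \<Sum>i\<in>insert i J. G i z) A) =
      (?F + mat_adjoint ?G) + (?SF + mat_adjoint ?SG)"
    unfolding SF SG adj using A by (intro eq_matI) auto
  moreover have "op_norm ((?F + mat_adjoint ?G) + (?SF + mat_adjoint ?SG))
      \<le> op_norm (?F + mat_adjoint ?G) + op_norm (?SF + mat_adjoint ?SG)"
    by (rule op_norm_add_le[OF add_carrier_mat[OF c'] add_carrier_mat[OF c']])
  moreover have "op_norm (?F + mat_adjoint ?G) + op_norm (?SF + mat_adjoint ?SG) \<le> 1 + real (card J)"
    using insert.prems by (intro add_mono insert.IH) simp_all
  ultimately show ?case using insert.hyps by simp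
qed

lemma analytic_comp_\<tau>:
  assumes "i \<in> I" "F analytic_on cball 0 (\<rho> i)"
  shows "(\<lambda>z. F (\<tau> i z)) analytic_on K"
  using analytic_on_compose_gen[OF \<tau>[OF assms(1)] assms(2)] \<tau>_le[OF assms(1)] by (simp add: o_def)

lemma exists_conjugate_companion:
  assumes f: "f analytic_on K" and f1: "\<And>z. z \<in> K \<Longrightarrow> cmod (f z) \<le> 1"
  obtains h where "h analytic_on K" "\<And>z. z \<in> K \<Longrightarrow> cmod (h z) \<le> real (card I) - 1"
    "op_norm (hol_calc f A + mat_adjoint (hol_calc h A)) \<le> real (card I)"
proof -
  obtain P Q where all: "\<forall>i\<in>I. P i analytic_on cball 0 (\<rho> i) \<and> Q i analytic_on cball 0 (\<rho> i) \<and>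
        (\<forall>z\<in>K. cmod (\<tau> i z) = \<rho> i \<longrightarrow> cnj (Q i (\<tau> i z)) = f z - P i (\<tau> i z))"
    and sum: "\<forall>z\<in>K. f z = (\<Sum>i\<in>I. P i (\<tau> i z))"
    using decompose[OF f] by (elim exE conjE)
  have PQ: "P i analytic_on cball 0 (\<rho> i)" "Q i analytic_on cball 0 (\<rho> i)"
    and Q: "z \<in> K \<Longrightarrow> cmod (\<tau> i z) = \<rho> i \<Longrightarrow> cnj (Q i (\<tau> i z)) = f z - P i (\<tau> i z)" if "i \<in> I" for i z
    using all that by simp_all
  have P: "f z = (\<Sum>i\<in>I. P i (\<tau> i z))" if "z \<in> K" for z
    using sum that by simp
  \<comment> \<open>Every point of the \<open>i\<close>-th circle is \<open>\<tau> i z\<close> for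
    some \<open>z\<close> in \<open>K\<close>, and there \<open>P i + cnj (Q i)\<close> takes the
    value \<open>f z\<close>.\<close>
  have bd: "cmod (P i w + cnj (Q i w)) \<le> 1" if "i \<in> I" "cmod w = \<rho> i" for i w
  proof -
    obtain z where "z \<in> K" "\<tau> i z = w" using \<tau>_onto[OF \<open>i \<in> I\<close> \<open>cmod w = \<rho> i\<close>] by auto
    then show ?thesis using Q[OF \<open>i \<in> I\<close> \<open>z \<in> K\<close>] f1[of z] that(2) by simp
  qed
  define h where "h z = (\<Sum>i\<in>I. Q i (\<tau> i z))" for z
  have an: "(\<lambda>z. P i (\<tau> i z)) analytic_on K" "(\<lambda>z. Q i (\<tau> i z)) analytic_on K" if "i \<in> I" for i
    using that PQ by (simp_all add: analytic_comp_\<tau>)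
  have h: "h analytic_on K" unfolding h_def by (intro analytic_intros an)
  have "hol_calc f A = hol_calc (\<lambda>z. \<Sum>i\<in>I. P i (\<tau> i z)) A"
    using W(3) P by (intro hol_calc_cong[OF A W(1,2)]) auto
  moreover have "op_norm (hol_calc (\<lambda>z. \<Sum>i\<in>I. P i (\<tau> i z)) A + mat_adjoint (hol_calc (\<lambda>z. \<Sum>i\<in>I. Q i (\<tau> i z)) A))
      \<le> real (card I)"
  proof (rule hol_calc_sum_add_adjoint_le[OF I(1)])
    fix i assume i: "i \<in> I"
    show "(\<lambda>z. P i (\<tau> i z)) holomorphic_on W" "(\<lambda>z. Q i (\<tau> i z)) holomorphic_on W"
      using an[OF i] by (simp_all add: holomorphic_W)
    show "op_norm (hol_calc (\<lambda>z. P i (\<tau> i z)) A + mat_adjoint (hol_calc (\<lambda>z. Q i (\<tau> i z)) A)) \<le> 1"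
    proof (rule hol_calc_von_Neumann[OF A W(1,2) holomorphic_W[OF \<tau>[OF i]] _ op_norm_\<tau>[OF i] PQ[OF i] bd[OF i]])
      show "cmod (\<tau> i z) \<le> \<rho> i" if "z \<in> W" for z
        using \<tau>_le[OF i] W(3) that by blast
    qed
  qed
  ultimately have S: "op_norm (hol_calc f A + mat_adjoint (hol_calc h A)) \<le> real (card I)"
    unfolding h_def by simp
  have "cmod (h z) \<le> real (card I) - 1" if z: "z \<in> K" for z
  proof (rule maximum_modulus_frontier[of h K, OF _ _ compact_imp_bounded[OF K] _ z])
    show "h holomorphic_on interior K"
      using analytic_imp_holomorphic[OF h] interior_subset by (rule holomorphic_on_subset)
    show "continuous_on (closure K) h"
      using K holomorphic_on_imp_continuous_on[OF analytic_imp_holomorphic[OF h]] by (simp add: compact_imp_closed)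
    fix z assume "z \<in> frontier K"
    then obtain i where i: "i \<in> I" "cmod (\<tau> i z) = \<rho> i" using frontier_K by blast
    have z: "z \<in> K" using \<open>z \<in> frontier K\<close> K by (simp add: compact_imp_closed frontier_def)
    \<comment> \<open>At this boundary point \<open>cnj (Q i)\<close> equals \<open>f - P i\<close>,
      the sum of the other \<open>P j\<close>. Regrouping pairs each \<open>P j\<close> with its own
      \<open>Q j\<close>, and the index \<open>i\<close> drops out; hence
      \<open>card I - 1\<close>.\<close>
    have "cnj (h z) = cnj (Q i (\<tau> i z)) + (\<Sum>j\<in>I - {i}. cnj (Q j (\<tau> j z)))"
      unfolding h_def using I(1) i by (simp add: sum.remove)
    also have "cnj (Q i (\<tau> i z)) = (\<Sum>j\<in>I - {i}. P j (\<tau> j z))"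
      using I(1) i Q[OF i(1) z] P[OF z] by (simp add: sum.remove)
    finally have "cnj (h z) = (\<Sum>j\<in>I - {i}. P j (\<tau> j z) + cnj (Q j (\<tau> j z)))"
      by (simp add: sum.distrib)
    then have "cmod (h z) = cmod (\<Sum>j\<in>I - {i}. P j (\<tau> j z) + cnj (Q j (\<tau> j z)))"
      using complex_mod_cnj[of "h z"] by simp
    also have "\<dots> \<le> (\<Sum>j\<in>I - {i}. 1)"
    proof (rule sum_norm_le)
      fix j assume "j \<in> I - {i}"
      then have j: "j \<in> I" by simp
      show "cmod (P j (\<tau> j z) + cnj (Q j (\<tau> j z))) \<le> 1"
        by (rule harmonic_le_boundary[OF PQ[OF j] bd[OF j] \<tau>_le[OF j z]])
    qed
    also have "\<dots> = real (card I) - 1" using I i by (simp add: card_Diff_singleton of_nat_diff)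
    finally show "cmod (h z) \<le> real (card I) - 1" .
  qed
  from that[OF h this S] show ?thesis .
qed

text \<open>Closed under products, so that \<open>f h f\<close>, suitably scaled, competes in the
  same extremal problem. Analyticity on all of the compact set \<open>K\<close> is what reflection
  in its boundary circles requires.\<close>

definition unit_fns :: "(complex \<Rightarrow> complex) set" where
  "unit_fns = {f. f analytic_on K \<and> (\<forall>z\<in>K. cmod (f z) \<le> 1)}"

text \<open>With \<open>M = f(A)\<close>, \<open>H = h(A)\<close> and \<open>S = M + H\<^sup>*\<close>, use \<open>M M\<^sup>* M = M S\<^sup>* M - M H M\<close> and \<open>M H M = (f h f)(A)\<close>.\<close>

lemma op_norm_cube_bound:
  assumes f: "f \<in> unit_fns"
    and k: "\<And>g. g \<in> unit_fns \<Longrightarrow> op_norm (hol_calc g A) \<le> k"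
  shows "op_norm (hol_calc f A) ^ 3 \<le> real (card I) * (op_norm (hol_calc f A))\<^sup>2 + (real (card I) - 1) * k"
proof -
  define n where "n = real (card I) - 1"
  have n: "1 \<le> n" using I(2) by (simp add: n_def)
  have f': "f analytic_on K" "\<And>z. z \<in> K \<Longrightarrow> cmod (f z) \<le> 1" using f by (auto simp: unit_fns_def)
  obtain h where h: "h analytic_on K" "\<And>z. z \<in> K \<Longrightarrow> cmod (h z) \<le> n"
    and S: "op_norm (hol_calc f A + mat_adjoint (hol_calc h A)) \<le> real (card I)"
    using exists_conjugate_companion[OF f'] unfolding n_def by blast
  define M H where "M = hol_calc f A" and "H = hol_calc h A"
  have MH: "M \<in> carrier_mat d d" "H \<in> carrier_mat d d" "mat_adjoint M \<in> carrier_mat d d" "mat_adjoint H \<in> carrier_mat d d"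
    unfolding M_def H_def by (auto intro!: mat_adjoint_carrier hol_calc_carrier A)
  \<comment> \<open>The bound \<open>n = card I - 1\<close> on \<open>h\<close> is at least 1
    because \<open>2 \<le> card I\<close>; dividing by it brings \<open>f h f\<close> back into the
    unit ball.\<close>
  define g where "g z = inverse (of_real n) * (f z * h z * f z)" for z
  have "g \<in> unit_fns"
  proof -
    have "cmod (g z) \<le> inverse n * (1 * n * 1)" if "z \<in> K" for z
      unfolding g_def norm_mult using f'(2)[OF that] h(2)[OF that] n
      by (intro mult_mono) (auto simp: norm_inverse)
    moreover have "g analytic_on K" unfolding g_def by (intro analytic_intros f' h)
    ultimately show ?thesis using n by (simp add: unit_fns_def)
  qed
  have fhf: "hol_calc (\<lambda>z. f z * h z * f z) A = M * H * M"
    using f' h unfolding M_def H_def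
    by (simp add: hol_calc_mult[OF A W(1,2)] holomorphic_W holomorphic_intros)
  have nz: "complex_of_real n \<noteq> 0" using n by simp
  have "hol_calc (\<lambda>z. of_real n * g z) A = of_real n \<cdot>\<^sub>m hol_calc g A"
    using \<open>g \<in> unit_fns\<close> by (intro hol_calc_cmult[OF A W(1,2)]) (auto simp: unit_fns_def intro: holomorphic_W)
  then have "M * H * M = of_real n \<cdot>\<^sub>m hol_calc g A"
    unfolding fhf[symmetric] using nz by (simp add: g_def mult.assoc[symmetric])
  then have "op_norm (M * H * M) \<le> n * op_norm (hol_calc g A)"
    using op_norm_smult_le[OF hol_calc_carrier[OF A], of "of_real n" g] n by simp
  also have "\<dots> \<le> n * k" using k[OF \<open>g \<in> unit_fns\<close>] n by (intro mult_left_mono) auto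
  finally have MHM: "op_norm (M * H * M) \<le> n * k" .
  define T where "T = M + mat_adjoint H"
  have T: "T \<in> carrier_mat d d" using MH by (auto simp: T_def)
  have adj: "mat_adjoint T = mat_adjoint M + H"
    unfolding T_def using MH
    by (intro eq_matI) (simp_all add: mat_adjoint_index[of _ d d] mat_adjoint_index[OF add_carrier_mat[OF MH(4)]])
  have aT: "mat_adjoint T \<in> carrier_mat d d" by (rule mat_adjoint_carrier[OF T])
  have "mat_adjoint M = mat_adjoint T + (-1) \<cdot>\<^sub>m H"
    unfolding adj using MH by (intro eq_matI) auto
  then have eq: "M * mat_adjoint M * M = M * mat_adjoint T * M + (-1) \<cdot>\<^sub>m (M * H * M)"
    using MH aT by (simp add: mult_add_distrib_mat[of _ d d _ d] add_mult_distrib_mat[of _ d d _ _ d]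
        mult_smult_distrib[of _ d d _ d] mult_smult_assoc_mat[of _ d d _ d])
  have 1: "op_norm (M * mat_adjoint M * M) \<le> op_norm (M * mat_adjoint T * M) + op_norm ((-1) \<cdot>\<^sub>m (M * H * M))"
    unfolding eq using MH aT by (intro op_norm_add_le[of _ d d]) auto
  have 2: "op_norm ((-1) \<cdot>\<^sub>m (M * H * M)) \<le> op_norm (M * H * M)"
    using MH op_norm_smult_le[of "M * H * M" d d "-1"] by simp
  have aT_le: "op_norm (mat_adjoint T) \<le> real (card I)"
    using op_norm_mat_adjoint_le[OF T] S unfolding T_def M_def H_def by linarith
  have "op_norm (M * mat_adjoint T * M) \<le> op_norm (M * mat_adjoint T) * op_norm M"
    by (rule op_norm_mult_le[OF mult_carrier_mat[OF MH(1) aT] MH(1)])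
  also have "\<dots> \<le> (op_norm M * op_norm (mat_adjoint T)) * op_norm M"
    by (rule mult_right_mono[OF op_norm_mult_le[OF MH(1) aT] op_norm_nonneg])
  also have "\<dots> \<le> (op_norm M * real (card I)) * op_norm M"
    by (intro mult_right_mono mult_left_mono aT_le op_norm_nonneg)
  finally have "op_norm (M * mat_adjoint M * M) \<le> op_norm M * real (card I) * op_norm M + n * k"
    using 1 2 MHM by linarith
  with op_norm_cube_le[OF MH(1)] show ?thesis
    unfolding M_def n_def by (simp add: power2_eq_square mult_ac)
qed

text \<open>The supremum \<open>k\<close> need not be attained, so the cubic inequality is proved
  for each competitor with \<open>k\<close> on the right. Taking cube roots gives a bound
  independent of the competitor, which then passes to \<open>k\<close> itself.\<close>

theorem op_norm_unit_fns_le: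
  assumes f: "f \<in> unit_fns"
  shows "op_norm (hol_calc f A) \<le> real (card I) / 2 + sqrt ((real (card I))\<^sup>2 / 4 + (real (card I) - 1))"
proof -
  let ?N = "(\<lambda>g. op_norm (hol_calc g A)) ` unit_fns"
  obtain C where C: "0 \<le> C" "\<And>f M. f holomorphic_on W \<Longrightarrow> 0 \<le> M \<Longrightarrow> (\<And>z. z \<in> W \<Longrightarrow> cmod (f z) \<le> M) \<Longrightarrow>
      op_norm (hol_calc f A) \<le> C * M"
    using hol_calc_bounded[OF A W(1,2)] by blast
  have "op_norm (hol_calc g A) \<le> C * 1" if "g \<in> unit_fns" for g
    using that W(3) by (intro C) (auto simp: unit_fns_def intro: holomorphic_W)
  then have bdd: "bdd_above ?N" by (auto simp: bdd_above_def)
  define k where "k = Sup ?N"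
  have le_k: "op_norm (hol_calc g A) \<le> k" if "g \<in> unit_fns" for g
    unfolding k_def using that bdd by (auto intro: cSup_upper)
  have k: "0 \<le> k" using le_k[OF f] order_trans[OF op_norm_nonneg] by blast
  define X where "X = real (card I) * k\<^sup>2 + (real (card I) - 1) * k"
  have "k \<le> root 3 X"
    unfolding k_def
  proof (rule cSup_least)
    fix t assume "t \<in> ?N"
    then obtain g where g: "g \<in> unit_fns" "t = op_norm (hol_calc g A)" by auto
    have t: "0 \<le> t" "t \<le> k" using g le_k by auto
    have "t ^ 3 \<le> real (card I) * t\<^sup>2 + (real (card I) - 1) * k"
      using op_norm_cube_bound[OF g(1) le_k] g(2) by simp
    also have "\<dots> \<le> X" unfolding X_def using t by (intro add_right_mono mult_left_mono power_mono) auto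
    finally have "root 3 (t ^ 3) \<le> root 3 X" by simp
    then show "t \<le> root 3 X" using t by (simp add: real_root_power_cancel)
  qed (use f in auto)
  then have "k ^ 3 \<le> root 3 X ^ 3" using k by (rule power_mono)
  also have "\<dots> = X" using k I(2) by (intro real_root_pow_pos2) (auto simp: X_def)
  finally have "k \<le> real (card I) / 2 + sqrt ((real (card I))\<^sup>2 / 4 + (real (card I) - 1))"
    using k I(2) by (intro quadratic_bound_of_cubic) (auto simp: X_def)
  with le_k[OF f] show ?thesis by simp
qed

text \<open>Normalising by \<open>M\<close> fails for \<open>M = 0\<close>; dividing by
  \<open>M + e\<close> and letting \<open>e\<close> tend to 0 treats all cases alike.\<close>

theorem op_norm_hol_calc_le:
  assumes f: "f analytic_on K" and M: "\<And>z. z \<in> K \<Longrightarrow> cmod (f z) \<le> M" and "0 \<le> M"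
  shows "op_norm (hol_calc f A) \<le> (real (card I) / 2 + sqrt ((real (card I))\<^sup>2 / 4 + (real (card I) - 1))) * M"
    (is "_ \<le> ?\<kappa> * M")
proof (rule tendsto_lowerbound)
  show "((\<lambda>e. ?\<kappa> * (M + e)) \<longlongrightarrow> ?\<kappa> * M) (at_right 0)"
    by (auto intro!: tendsto_eq_intros)
  show "\<forall>\<^sub>F e in at_right 0. op_norm (hol_calc f A) \<le> ?\<kappa> * (M + e)"
  proof (rule eventually_at_rightI[of 0 1])
    fix e :: real assume "e \<in> {0<..<1}"
    define m where "m = M + e"
    have m: "0 < m" "M \<le> m" using \<open>0 \<le> M\<close> \<open>e \<in> {0<..<1}\<close> by (auto simp: m_def)
    define g where "g z = inverse (of_real m) * f z" for z
    have g: "g analytic_on K" unfolding g_def by (intro analytic_intros f)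
    moreover have "cmod (g z) \<le> 1" if "z \<in> K" for z
      unfolding g_def norm_mult norm_inverse using M[OF that] m by (simp add: field_simps)
    ultimately have "g \<in> unit_fns" by (simp add: unit_fns_def)
    have "complex_of_real m \<noteq> 0" using m by simp
    then have "hol_calc f A = hol_calc (\<lambda>z. of_real m * g z) A" by (simp add: g_def mult.assoc[symmetric])
    also have "\<dots> = of_real m \<cdot>\<^sub>m hol_calc g A" by (intro hol_calc_cmult[OF A W(1,2)] holomorphic_W g)
    finally have "op_norm (hol_calc f A) \<le> m * op_norm (hol_calc g A)"
      using op_norm_smult_le[OF hol_calc_carrier[OF A], of "of_real m" g] m by simp
    also have "\<dots> \<le> m * ?\<kappa>" using op_norm_unit_fns_le[OF \<open>g \<in> unit_fns\<close>] m by (intro mult_left_mono) auto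
    finally show "op_norm (hol_calc f A) \<le> ?\<kappa> * (M + e)" by (simp add: m_def mult.commute)
  qed simp
qed simp

end

section \<open>Disks with holes\<close>

text \<open>Where \<open>\<tau> j z\<close> equals \<open>cnj \<sigma>\<close>, the value
  \<open>P (\<tau> j z)\<close> is the conjugate of this function: the two conjugations turn an
  antianalytic dependence into an analytic one.\<close>

lemma analytic_on_cnj_comp_cnj:
  assumes P: "P analytic_on cball 0 b" and \<sigma>: "\<sigma> analytic_on S"
    and le: "\<And>w. w \<in> S \<Longrightarrow> cmod (\<sigma> w) \<le> b"
  shows "(\<lambda>w. cnj (P (cnj (\<sigma> w)))) analytic_on S"
proof -
  obtain U where U: "open U" "cball 0 b \<subseteq> U" "P holomorphic_on U"
    using P by (auto simp: analytic_on_holomorphic)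
  have "cnj ` U = cnj -` U" by (auto intro: rev_image_eqI)
  then have "open (cnj ` U)"
    using open_vimage[OF U(1), of cnj] by (simp add: continuous_on_cnj)
  moreover have "cnj ` cnj ` U = U" by (simp add: image_image)
  ultimately have "cnj \<circ> P \<circ> cnj holomorphic_on cnj ` U"
    using U(3) by (intro holomorphic_on_compose_cnj_cnj) auto
  moreover have "cball 0 b \<subseteq> cnj ` U"
  proof
    fix w :: complex assume "w \<in> cball 0 b"
    then have "cnj w \<in> U" using U(2) by auto
    then show "w \<in> cnj ` U" by (rule rev_image_eqI) simp
  qed
  ultimately have "cnj \<circ> P \<circ> cnj analytic_on cball 0 b"
    using \<open>open (cnj ` U)\<close> by (auto simp: analytic_on_holomorphic)
  from analytic_on_compose_gen[OF \<sigma> this] le show ?thesis by (simp add: o_def)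
qed

text \<open>Otherwise the point dividing the segment from \<open>x\<close> to \<open>y\<close> in
  the ratio \<open>r : s\<close> lies in both disks. Strictness leaves room for enlarging the radii
  later.\<close>

lemma cball_disjoint_imp_dist:
  fixes x y :: complex
  assumes "cball x r \<inter> cball y s = {}" "0 < r" "0 < s"
  shows "r + s < dist x y"
proof (rule ccontr)
  assume "\<not> r + s < dist x y"
  then have D: "cmod (y - x) \<le> r + s" by (simp add: dist_norm norm_minus_commute)
  define t where "t = r / (r + s)"
  have t: "0 \<le> t" "t * (r + s) = r" "(1 - t) * (r + s) = s" "t \<le> 1" using assms by (auto simp: t_def field_simps)
  define p where "p = x + of_real t * (y - x)"
  have "x - p = - (of_real t * (y - x))" by (simp add: p_def)
  then have "dist x p = t * cmod (y - x)" using t by (simp add: dist_norm norm_mult)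
  also have "\<dots> \<le> r" using mult_left_mono[OF D t(1)] t by simp
  finally have 1: "p \<in> cball x r" by simp
  have "y - p = of_real (1 - t) * (y - x)" by (simp add: p_def algebra_simps)
  then have "dist y p = (1 - t) * cmod (y - x)" using t by (simp add: dist_norm norm_mult del: of_real_diff)
  also have "\<dots> \<le> s" using mult_left_mono[OF D, of "1 - t"] t by simp
  finally have "p \<in> cball y s" by simp
  with 1 assms(1) show False by blast
qed

lemma invertible_mat_inverse:
  fixes M :: "complex mat"
  assumes M: "M \<in> carrier_mat d d" and inv: "invertible_mat M"
  shows "the (mat_inverse M) \<in> carrier_mat d d" "M * the (mat_inverse M) = 1\<^sub>m d" "the (mat_inverse M) * M = 1\<^sub>m d"
proof -
  obtain B where B: "M * B = 1\<^sub>m (dim_row M)" "B * M = 1\<^sub>m (dim_row B)"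
    using inv by (auto simp: invertible_mat_def inverts_mat_def)
  have Bc: "B \<in> carrier_mat d d"
    using M arg_cong[OF B(1), of dim_col] arg_cong[OF B(2), of dim_col] by auto
  have "Determinant.det M * Determinant.det B = Determinant.det (M * B)" by (rule det_mult[OF M Bc, symmetric])
  then have "Determinant.det M \<noteq> 0" using B(1) by auto
  then obtain C where C: "mat_inverse M = Some C"
    using mat_inverse(1)[OF M] det_non_zero_imp_unit[OF M] by (meson not_None_eq)
  from mat_inverse(2)[OF M C] show "the (mat_inverse M) \<in> carrier_mat d d"
    "M * the (mat_inverse M) = 1\<^sub>m d" "the (mat_inverse M) * M = 1\<^sub>m d" by (simp_all add: C)
qed

text \<open>Separation is expressed by distances instead of disjointness: finitely many strict
  inequalities are stable under small changes of the radii, and the estimates below use them in this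
  form.\<close>

locale holed_disk =
  fixes n :: nat and R :: real and c :: "nat \<Rightarrow> complex" and r :: "nat \<Rightarrow> real"
  assumes R: "0 < R"
    and r: "\<And>i. i \<in> {1..n} \<Longrightarrow> 0 < r i"
    and inside: "\<And>i. i \<in> {1..n} \<Longrightarrow> cmod (c i) + r i < R"
    and sep: "\<And>i j. i \<in> {1..n} \<Longrightarrow> j \<in> {1..n} \<Longrightarrow> i \<noteq> j \<Longrightarrow> r i + r j < dist (c i) (c j)"
begin

definition closed_region :: "complex set" where
  "closed_region = cball 0 R - (\<Union>i\<in>{1..n}. ball (c i) (r i))"

definition \<tau> :: "nat \<Rightarrow> complex \<Rightarrow> complex" where
  "\<tau> i z = (if i = 0 then z else 1 / (z - c i))"

definition \<rho> :: "nat \<Rightarrow> real" where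
  "\<rho> i = (if i = 0 then R else 1 / r i)"

lemma cases_index:
  assumes "i \<in> {0..n}"
  obtains "i = 0" | "i \<noteq> 0" "i \<in> {1..n}"
  using assms by fastforce

lemma closed_regionD:
  assumes "z \<in> closed_region"
  shows "cmod z \<le> R" "i \<in> {1..n} \<Longrightarrow> r i \<le> cmod (z - c i)" "i \<in> {1..n} \<Longrightarrow> z \<noteq> c i"
proof -
  show "cmod z \<le> R" using assms by (simp add: closed_region_def)
  show 1: "r i \<le> cmod (z - c i)" if "i \<in> {1..n}"
    using assms that by (auto simp: closed_region_def dist_norm norm_minus_commute not_less)
  show "z \<noteq> c i" if "i \<in> {1..n}" using 1[OF that] r[OF that] by auto
qed

lemma closed_regionI:
  assumes "cmod z \<le> R" "\<And>i. i \<in> {1..n} \<Longrightarrow> r i \<le> cmod (z - c i)"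
  shows "z \<in> closed_region"
  using assms by (force simp: closed_region_def dist_norm norm_minus_commute not_less)

lemma punctured_diskI:
  assumes "cmod z < R" "\<And>i. i \<in> {1..n} \<Longrightarrow> r i < cmod (z - c i)"
  shows "z \<in> punctured_disk n R c r"
  using assms by (force simp: punctured_disk_def dist_norm norm_minus_commute)

lemma compact_closed_region: "compact closed_region"
  unfolding closed_region_def by (intro compact_diff compact_cball) auto

lemma open_punctured_disk: "open (punctured_disk n R c r)"
  unfolding punctured_disk_def by (intro open_Diff closed_UN) auto

lemma punctured_disk_subset: "punctured_disk n R c r \<subseteq> closed_region"
  unfolding punctured_disk_def closed_region_def by auto

lemma analytic_\<tau>: "i \<in> {0..n} \<Longrightarrow> \<tau> i analytic_on closed_region"
  unfolding \<tau>_def using closed_regionD(3) by (cases "i = 0") (auto intro!: analytic_intros)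

lemma norm_\<tau>_le:
  assumes "i \<in> {0..n}" "z \<in> closed_region"
  shows "cmod (\<tau> i z) \<le> \<rho> i"
  using assms(1)
proof (cases rule: cases_index)
  case 2
  then show ?thesis using closed_regionD(2)[OF assms(2), of i] r[of i]
    by (simp add: \<tau>_def \<rho>_def norm_divide frac_le)
qed (use closed_regionD(1)[OF assms(2)] in \<open>simp add: \<tau>_def \<rho>_def\<close>)

text \<open>\<open>c i + 1 / w\<close> inverts \<open>\<tau> i\<close>. By the triangle inequality,
  \<open>inside\<close> and \<open>sep\<close> keep the \<open>i\<close>-th circle within the outer
  disk and off the other holes.\<close>

lemma circle_point:
  assumes i: "i \<in> {1..n}" and w: "cmod w = 1 / r i"
  defines "z \<equiv> c i + 1 / w"
  shows "z \<in> closed_region" "\<tau> i z = w" "w \<noteq> 0"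
proof -
  show w0: "w \<noteq> 0" using w r[OF i] by auto
  then show "\<tau> i z = w" using i by (simp add: \<tau>_def z_def)
  have zi: "cmod (z - c i) = r i" using w by (simp add: z_def norm_divide)
  show "z \<in> closed_region"
  proof (rule closed_regionI)
    show "cmod z \<le> R" using norm_triangle_ineq[of "c i" "z - c i"] zi inside[OF i] by simp
    fix j assume j: "j \<in> {1..n}"
    show "r j \<le> cmod (z - c j)"
    proof (cases "i = j")
      case False
      then show ?thesis using sep[OF i j] norm_triangle_ineq4[of "z - c j" "z - c i"] zi by (simp add: dist_norm)
    qed (use zi in simp)
  qed
qed

lemma \<tau>_onto:
  assumes "i \<in> {0..n}" "cmod w = \<rho> i"
  shows "\<exists>z\<in>closed_region. \<tau> i z = w"
  using assms(1)
proof (cases rule: cases_index)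
  case 1
  have "w \<in> closed_region"
  proof (rule closed_regionI)
    show "cmod w \<le> R" using 1 assms(2) by (simp add: \<rho>_def)
    show "r i \<le> cmod (w - c i)" if "i \<in> {1..n}" for i
      using norm_triangle_ineq2[of w "c i"] inside[OF that] assms(2) 1 by (simp add: \<rho>_def)
  qed
  then show ?thesis using 1 by (auto simp: \<tau>_def)
next
  case 2
  then show ?thesis using circle_point[of i w] assms(2) by (auto simp: \<rho>_def)
qed

text \<open>If no inequality defining the region is an equality at \<open>z\<close>, then
  \<open>z\<close> lies in the open region and is interior.\<close>

lemma frontier_closed_region:
  assumes "z \<in> frontier closed_region"
  shows "\<exists>i\<in>{0..n}. cmod (\<tau> i z) = \<rho> i"
proof (rule ccontr)
  assume no: "\<not> (\<exists>i\<in>{0..n}. cmod (\<tau> i z) = \<rho> i)"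
  have z: "z \<in> closed_region"
    using assms compact_imp_closed[OF compact_closed_region] by (simp add: frontier_def)
  have "z \<in> punctured_disk n R c r"
  proof -
    have "cmod (\<tau> 0 z) \<noteq> \<rho> 0" using no by auto
    then have "cmod z \<noteq> R" by (simp add: \<tau>_def \<rho>_def)
    moreover have "cmod (z - c i) \<noteq> r i" if "i \<in> {1..n}" for i
    proof
      assume "cmod (z - c i) = r i"
      then have "cmod (\<tau> i z) = \<rho> i" using that by (simp add: \<tau>_def \<rho>_def norm_divide)
      with no that show False by auto
    qed
    ultimately show ?thesis
      using closed_regionD(1)[OF z] closed_regionD(2)[OF z]
      by (intro punctured_diskI) (metis order_le_less)+
  qed
  then have "z \<in> interior closed_region"
    using interior_maximal[OF punctured_disk_subset open_punctured_disk] by blast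
  then show False using assms by (simp add: frontier_def)
qed

section \<open>Laurent decomposition and reflection in the boundary circles\<close>

lemma split_holes:
  assumes "m \<le> n" "f analytic_on (cball 0 R - (\<Union>i\<in>{1..m}. ball (c i) (r i)))"
  shows "\<exists>P. P 0 analytic_on cball 0 R \<and> (\<forall>i\<in>{1..m}. P i analytic_on cball 0 (1 / r i)) \<and>
    (\<forall>z\<in>cball 0 R - (\<Union>i\<in>{1..m}. ball (c i) (r i)). f z = P 0 z + (\<Sum>i\<in>{1..m}. P i (1 / (z - c i))))"
  using assms
proof (induction m arbitrary: f)
  case 0
  then show ?case by (intro exI[of _ "\<lambda>_. f"]) auto
next
  case (Suc m)
  let ?S = "cball 0 R - (\<Union>i\<in>{1..m}. ball (c i) (r i))"
  have m: "Suc m \<in> {1..n}" using Suc.prems by simp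
  have eq: "cball 0 R - (\<Union>i\<in>{1..Suc m}. ball (c i) (r i)) = ?S - ball (c (Suc m)) (r (Suc m))"
    by (auto simp: atLeastAtMostSuc_conv)
  \<comment> \<open>Splitting off the next hole requires its circle to lie in the region left by the
    first \<open>m\<close> holes; this is where \<open>inside\<close> and \<open>sep\<close>
    enter.\<close>
  have sph: "sphere (c (Suc m)) (r (Suc m)) \<subseteq> ?S"
  proof
    fix z assume z: "z \<in> sphere (c (Suc m)) (r (Suc m))"
    have zc: "cmod (z - c (Suc m)) = r (Suc m)" using z by (simp add: dist_norm norm_minus_commute)
    have "cmod z \<le> R" using norm_triangle_ineq[of "c (Suc m)" "z - c (Suc m)"] zc inside[OF m] by simp
    moreover have "z \<notin> ball (c j) (r j)" if "j \<in> {1..m}" for j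
    proof -
      have "j \<in> {1..n}" "j \<noteq> Suc m" using that Suc.prems by auto
      then show ?thesis
        using sep[of j "Suc m"] m z dist_triangle[of "c j" "c (Suc m)" z] by (auto simp: dist_commute)
    qed
    ultimately show "z \<in> ?S" by auto
  qed
  obtain g F where g: "g analytic_on ?S" and F: "F analytic_on cball 0 (1 / r (Suc m))"
    and f: "\<And>z. z \<in> ?S - ball (c (Suc m)) (r (Suc m)) \<Longrightarrow> f z = g z + F (1 / (z - c (Suc m)))"
    using analytic_on_split_hole[OF Suc.prems(2)[unfolded eq] sph r[OF m]] by blast
  obtain P where P: "P 0 analytic_on cball 0 R" "\<forall>i\<in>{1..m}. P i analytic_on cball 0 (1 / r i)"
    "\<forall>z\<in>?S. g z = P 0 z + (\<Sum>i\<in>{1..m}. P i (1 / (z - c i)))"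
    using Suc.IH[OF Suc_leD[OF Suc.prems(1)] g] by (elim exE conjE)
  show ?case
    unfolding eq
  proof (intro exI[of _ "P(Suc m := F)"] conjI ballI)
    show "(P(Suc m := F)) 0 analytic_on cball 0 R" using P by simp
    show "(P(Suc m := F)) i analytic_on cball 0 (1 / r i)" if "i \<in> {1..Suc m}" for i
      using P(2) F that by (auto simp: le_Suc_eq)
    fix z assume z: "z \<in> ?S - ball (c (Suc m)) (r (Suc m))"
    have "(\<Sum>i\<in>{1..m}. (P(Suc m := F)) i (1 / (z - c i))) = (\<Sum>i\<in>{1..m}. P i (1 / (z - c i)))"
      by (intro sum.cong) auto
    then show "f z = (P(Suc m := F)) 0 z + (\<Sum>i\<in>{1..Suc m}. (P(Suc m := F)) i (1 / (z - c i)))"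
      using f[OF z] P(3) z by simp
  qed
qed

text \<open>On the \<open>i\<close>-th circle, complex conjugation is the reflection in that circle, which turns
  \<open>\<tau>\<^sub>j\<close> into the conjugate of an analytic function of \<open>w = \<tau>\<^sub>i(z)\<close>.\<close>

lemma reflect_\<tau>:
  assumes i: "i \<in> {0..n}" and j: "j \<in> {0..n}" and ij: "i \<noteq> j"
  obtains \<sigma> where "\<sigma> analytic_on cball 0 (\<rho> i)" "\<And>w. w \<in> cball 0 (\<rho> i) \<Longrightarrow> cmod (\<sigma> w) \<le> \<rho> j"
    "\<And>z. z \<in> closed_region \<Longrightarrow> cmod (\<tau> i z) = \<rho> i \<Longrightarrow> cnj (\<sigma> (\<tau> i z)) = \<tau> j z"
  using i
proof (cases rule: cases_index)
  case i0: 1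
  then have j: "j \<in> {1..n}" "j \<noteq> 0" using j ij by auto
  \<comment> \<open>On \<open>|z| = R\<close> one has \<open>z = R^2 / cnj z\<close>; inserting this
    into \<open>1 / (z - c j)\<close> and conjugating gives \<open>\<sigma>\<close>.\<close>
  define \<sigma> where "\<sigma> w = w / (of_real (R\<^sup>2) - cnj (c j) * w)" for w
  have den: "R * r j \<le> cmod (of_real (R\<^sup>2) - cnj (c j) * w)" if "cmod w \<le> R" for w
  proof -
    have "R * r j \<le> R * (R - cmod (c j))" using inside[OF j(1)] R by (intro mult_left_mono) auto
    also have "\<dots> \<le> R\<^sup>2 - cmod (c j) * cmod w"
      using mult_left_mono[OF that norm_ge_zero[of "c j"]] by (simp add: power2_eq_square algebra_simps)
    also have "\<dots> \<le> cmod (of_real (R\<^sup>2) - cnj (c j) * w)"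
      using norm_triangle_ineq2[of "of_real (R\<^sup>2)" "cnj (c j) * w"] by (simp add: norm_mult norm_power)
    finally show ?thesis .
  qed
  have pos: "0 < R * r j" using R r[OF j(1)] by simp
  have den0: "of_real (R\<^sup>2) - cnj (c j) * w \<noteq> 0" if "cmod w \<le> R" for w
    using den[OF that] pos by auto
  show ?thesis
  proof (rule that)
    show "\<sigma> analytic_on cball 0 (\<rho> i)"
      unfolding \<sigma>_def using den0 by (intro analytic_intros) (auto simp: \<rho>_def i0)
    show "cmod (\<sigma> w) \<le> \<rho> j" if "w \<in> cball 0 (\<rho> i)" for w
    proof -
      have w: "cmod w \<le> R" using that by (simp add: \<rho>_def i0)
      have "cmod (\<sigma> w) \<le> R / (R * r j)"
        unfolding \<sigma>_def norm_divide using den[OF w] w pos R by (intro frac_le) auto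
      then show ?thesis using R j by (simp add: \<rho>_def)
    qed
    fix z assume z: "z \<in> closed_region" "cmod (\<tau> i z) = \<rho> i"
    then have zR: "cmod z = R" by (simp add: \<tau>_def \<rho>_def i0)
    then have "z \<noteq> 0" using R by auto
    have "of_real (R\<^sup>2) = z * cnj z" unfolding zR[symmetric] by (rule complex_norm_square)
    then have "cnj (\<sigma> z) = cnj z / (cnj z * (z - c j))"
      unfolding \<sigma>_def by (simp add: algebra_simps)
    then show "cnj (\<sigma> (\<tau> i z)) = \<tau> j z"
      using \<open>z \<noteq> 0\<close> j by (simp add: \<tau>_def i0)
  qed
next
  case i1: 2
  have ri: "0 < r i" using r[OF i1(2)] .
  have mem: "cmod (of_real ((r i)\<^sup>2) * w) \<le> r i" if "w \<in> cball 0 (\<rho> i)" for w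
  proof -
    have "cmod w \<le> 1 / r i" using that i1 by (simp add: \<rho>_def)
    then have "(r i)\<^sup>2 * cmod w \<le> (r i)\<^sup>2 * (1 / r i)" by (intro mult_left_mono) auto
    then show ?thesis using ri by (simp add: norm_mult norm_power power2_eq_square)
  qed
  \<comment> \<open>On the \<open>i\<close>-th circle
    \<open>cnj (z - c i) = (r i)^2 / (z - c i)\<close>, so \<open>cnj z\<close> is an affine
    function of \<open>\<tau> i z\<close>.\<close>
  have refl: "cnj (c i) + of_real ((r i)\<^sup>2) * \<tau> i z = cnj z" if "z \<in> closed_region" "cmod (\<tau> i z) = \<rho> i" for z
  proof -
    have "1 / cmod (z - c i) = 1 / r i" using that(2) i1 by (simp add: \<tau>_def \<rho>_def norm_divide)
    then have "cmod (z - c i) = r i" by simp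
    then have "of_real ((r i)\<^sup>2) = (z - c i) * cnj (z - c i)" using complex_norm_square[of "z - c i"] by simp
    then show ?thesis using closed_regionD(3)[OF that(1) i1(2)] i1(1) by (simp add: \<tau>_def)
  qed
  from j show ?thesis
  proof (cases rule: cases_index)
    case j0: 1
    show ?thesis
    proof (rule that)
      show "(\<lambda>w. cnj (c i) + of_real ((r i)\<^sup>2) * w) analytic_on cball 0 (\<rho> i)" by (intro analytic_intros)
      show "cmod (cnj (c i) + of_real ((r i)\<^sup>2) * w) \<le> \<rho> j" if "w \<in> cball 0 (\<rho> i)" for w
        using norm_triangle_ineq[of "cnj (c i)" "of_real ((r i)\<^sup>2) * w"] mem[OF that] inside[OF i1(2)] j0
        by (simp add: \<rho>_def)
      show "cnj (cnj (c i) + of_real ((r i)\<^sup>2) * \<tau> i z) = \<tau> j z"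
        if "z \<in> closed_region" "cmod (\<tau> i z) = \<rho> i" for z
        unfolding refl[OF that] using j0 by (simp add: \<tau>_def)
    qed
  next
    case j1: 2
    \<comment> \<open>The affine map sends \<open>|w| \<le> 1 / r i\<close> into the mirror image of
      hole \<open>i\<close>, which by \<open>sep\<close> stays farther than \<open>r j\<close> from
      the conjugate of \<open>c j\<close>.\<close>
    have den: "r j \<le> cmod (cnj (c i) + of_real ((r i)\<^sup>2) * w - cnj (c j))" if "w \<in> cball 0 (\<rho> i)" for w
    proof -
      have "cmod (cnj (c i - c j)) = dist (c i) (c j)" by (simp only: complex_mod_cnj dist_norm)
      then have "cmod (cnj (c i) - cnj (c j)) = dist (c i) (c j)" by simp
      then show ?thesis
        using norm_triangle_ineq4[of "cnj (c i) + of_real ((r i)\<^sup>2) * w - cnj (c j)" "of_real ((r i)\<^sup>2) * w"]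
          mem[OF that] sep[OF i1(2) j1(2) ij] by (simp add: algebra_simps)
    qed
    have rj: "0 < r j" using r[OF j1(2)] .
    show ?thesis
    proof (rule that)
      show "(\<lambda>w. 1 / (cnj (c i) + of_real ((r i)\<^sup>2) * w - cnj (c j))) analytic_on cball 0 (\<rho> i)"
        using den rj by (intro analytic_intros) force
      show "cmod (1 / (cnj (c i) + of_real ((r i)\<^sup>2) * w - cnj (c j))) \<le> \<rho> j" if "w \<in> cball 0 (\<rho> i)" for w
        unfolding norm_divide norm_one using den[OF that] rj j1 by (simp add: \<rho>_def frac_le)
      show "cnj (1 / (cnj (c i) + of_real ((r i)\<^sup>2) * \<tau> i z - cnj (c j))) = \<tau> j z"
        if "z \<in> closed_region" "cmod (\<tau> i z) = \<rho> i" for z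
        unfolding refl[OF that] using j1 by (simp add: \<tau>_def)
    qed
  qed
qed

lemma decompose:
  assumes f: "f analytic_on closed_region"
  shows "\<exists>P Q. (\<forall>i\<in>{0..n}. P i analytic_on cball 0 (\<rho> i) \<and> Q i analytic_on cball 0 (\<rho> i) \<and>
      (\<forall>z\<in>closed_region. cmod (\<tau> i z) = \<rho> i \<longrightarrow> cnj (Q i (\<tau> i z)) = f z - P i (\<tau> i z))) \<and>
    (\<forall>z\<in>closed_region. f z = (\<Sum>i\<in>{0..n}. P i (\<tau> i z)))"
proof -
  obtain P where P: "P 0 analytic_on cball 0 R" "\<forall>i\<in>{1..n}. P i analytic_on cball 0 (1 / r i)"
    "\<forall>z\<in>closed_region. f z = P 0 z + (\<Sum>i\<in>{1..n}. P i (1 / (z - c i)))"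
    using split_holes[OF order_refl f[unfolded closed_region_def], folded closed_region_def]
    by (elim exE conjE)
  have Pan: "P i analytic_on cball 0 (\<rho> i)" if "i \<in> {0..n}" for i
    using that P(1,2) by (cases "i = 0") (auto simp: \<rho>_def)
  have sum: "f z = (\<Sum>i\<in>{0..n}. P i (\<tau> i z))" if "z \<in> closed_region" for z
  proof -
    have "(\<Sum>i\<in>{1..n}. P i (1 / (z - c i))) = (\<Sum>i\<in>{1..n}. P i (\<tau> i z))"
      by (intro sum.cong) (auto simp: \<tau>_def)
    then show ?thesis using P(3) that by (simp add: sum.atLeast_Suc_atMost[of 0] \<tau>_def)
  qed
  define reflects where "reflects i j q \<longleftrightarrow> q analytic_on cball 0 (\<rho> i) \<and>
      (\<forall>z\<in>closed_region. cmod (\<tau> i z) = \<rho> i \<longrightarrow> cnj (q (\<tau> i z)) = P j (\<tau> j z))" for i j q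
  have "\<exists>q. reflects i j q" if ij: "i \<in> {0..n}" "j \<in> {0..n}" "i \<noteq> j" for i j
  proof -
    obtain \<sigma> where \<sigma>: "\<sigma> analytic_on cball 0 (\<rho> i)" "\<And>w. w \<in> cball 0 (\<rho> i) \<Longrightarrow> cmod (\<sigma> w) \<le> \<rho> j"
      "\<And>z. z \<in> closed_region \<Longrightarrow> cmod (\<tau> i z) = \<rho> i \<Longrightarrow> cnj (\<sigma> (\<tau> i z)) = \<tau> j z"
      using reflect_\<tau>[OF ij] by blast
    show ?thesis
      by (rule exI[of _ "\<lambda>w. cnj (P j (cnj (\<sigma> w)))"])
        (use analytic_on_cnj_comp_cnj[OF Pan[OF ij(2)] \<sigma>(1,2)] \<sigma>(3) in \<open>simp add: reflects_def\<close>)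
  qed
  then obtain q where q: "\<And>i j. i \<in> {0..n} \<Longrightarrow> j \<in> {0..n} \<Longrightarrow> i \<noteq> j \<Longrightarrow> reflects i j (q i j)"
    by metis
  \<comment> \<open>On the \<open>i\<close>-th circle every other summand of \<open>f\<close> is the
    conjugate of the analytic \<open>q i j\<close>; together they make up
    \<open>f - P i\<close>.\<close>
  define Q where "Q i w = (\<Sum>j\<in>{0..n} - {i}. q i j w)" for i w
  have "Q i analytic_on cball 0 (\<rho> i)" if "i \<in> {0..n}" for i
    unfolding Q_def using q[OF that] by (intro analytic_intros) (auto simp: reflects_def)
  moreover have "cnj (Q i (\<tau> i z)) = f z - P i (\<tau> i z)"
    if "i \<in> {0..n}" "z \<in> closed_region" "cmod (\<tau> i z) = \<rho> i" for i z
  proof -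
    have "cnj (Q i (\<tau> i z)) = (\<Sum>j\<in>{0..n} - {i}. P j (\<tau> j z))"
      unfolding Q_def cnj_sum using q[OF that(1)] that by (intro sum.cong) (auto simp: reflects_def)
    also have "\<dots> = f z - P i (\<tau> i z)" using sum[OF that(2)] that(1) by (simp add: sum.remove)
    finally show ?thesis .
  qed
  ultimately show ?thesis using Pan sum by blast
qed

section \<open>Admissible matrices and their spectra\<close>

lemma spectrum_subset_punctured_disk:
  assumes A: "A \<in> carrier_mat d d" "op_norm A < R"
    and B: "\<And>i. i \<in> {1..n} \<Longrightarrow> B i \<in> carrier_mat d d"
      "\<And>i. i \<in> {1..n} \<Longrightarrow> B i * (A - c i \<cdot>\<^sub>m 1\<^sub>m d) = 1\<^sub>m d" "\<And>i. i \<in> {1..n} \<Longrightarrow> op_norm (B i) < inverse (r i)"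
  shows "spectrum A \<subseteq> punctured_disk n R c r"
proof
  fix \<mu> assume \<mu>: "\<mu> \<in> spectrum A"
  have "r i < cmod (\<mu> - c i)" if i: "i \<in> {1..n}" for i
  proof -
    obtain v where v: "v \<in> carrier_vec d" "v \<noteq> 0\<^sub>v d" "A *\<^sub>v v = \<mu> \<cdot>\<^sub>v v"
      using \<mu> A by (auto simp: spectrum_def eigenvalue_def eigenvector_def)
    have nv: "eucl_norm v > 0" using v eucl_norm_eq_0_iff[of v d] by (simp add: less_le)
    have "(c i \<cdot>\<^sub>m 1\<^sub>m d) *\<^sub>v v = c i \<cdot>\<^sub>v v"
      using v(1) by (simp add: smult_mat_mult_mat_vec[OF one_carrier_mat v(1)])
    then have "(A - c i \<cdot>\<^sub>m 1\<^sub>m d) *\<^sub>v v = (\<mu> - c i) \<cdot>\<^sub>v v"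
      using A v by (subst minus_mult_distrib_mat_vec[of _ d d]) (auto simp: left_diff_distrib intro!: eq_vecI)
    \<comment> \<open>For an eigenvector the left inverse gives
      \<open>v = (\<mu> - c i) B i v\<close>, whence
      \<open>1 \<le> |B i| |\<mu> - c i|\<close>.\<close>
    moreover have "v = B i *\<^sub>v ((A - c i \<cdot>\<^sub>m 1\<^sub>m d) *\<^sub>v v)"
    proof -
      have "A - c i \<cdot>\<^sub>m 1\<^sub>m d \<in> carrier_mat d d" using A by auto
      from assoc_mult_mat_vec[OF B(1)[OF i] this v(1)] show ?thesis using B(2)[OF i] v(1) by simp
    qed
    ultimately have "eucl_norm v \<le> op_norm (B i) * (cmod (\<mu> - c i) * eucl_norm v)"
      using eucl_norm_mult_mat_vec_le[OF B(1)[OF i], of "(\<mu> - c i) \<cdot>\<^sub>v v"] v by (simp add: eucl_norm_smult)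
    then have 1: "1 \<le> op_norm (B i) * cmod (\<mu> - c i)" using nv by simp
    then have "0 < cmod (\<mu> - c i)" by (cases "\<mu> = c i") auto
    then have "op_norm (B i) * cmod (\<mu> - c i) < inverse (r i) * cmod (\<mu> - c i)"
      using B(3)[OF i] by (intro mult_strict_right_mono) auto
    with 1 have "1 < inverse (r i) * cmod (\<mu> - c i)" by linarith
    then show ?thesis using r[OF i] by (simp add: field_simps)
  qed
  then show "\<mu> \<in> punctured_disk n R c r"
    using eigenvalue_norm_le[OF A(1) \<mu>] A(2) by (intro punctured_diskI) auto
qed

text \<open>The calculus turns \<open>(z - c i) \<tau> i = 1\<close> into a right inverse of
  \<open>A - c i\<close>, which must coincide with the left inverse \<open>B i\<close>. Thus norm
  conditions on the inverses become norm conditions on \<open>hol_calc (\<tau> i) A\<close>.\<close>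

theorem contraction_cover:
  assumes A: "A \<in> carrier_mat d d" "op_norm A < R"
    and B: "\<And>i. i \<in> {1..n} \<Longrightarrow> B i \<in> carrier_mat d d"
      "\<And>i. i \<in> {1..n} \<Longrightarrow> B i * (A - c i \<cdot>\<^sub>m 1\<^sub>m d) = 1\<^sub>m d" "\<And>i. i \<in> {1..n} \<Longrightarrow> op_norm (B i) < inverse (r i)"
    and n: "1 \<le> n"
  shows "contraction_cover A d (punctured_disk n R c r) closed_region {0..n} \<tau> \<rho>"
proof -
  note sp = spectrum_subset_punctured_disk[OF A B]
  have "op_norm (hol_calc (\<tau> i) A) < \<rho> i" if "i \<in> {0..n}" for i
    using that
  proof (cases rule: cases_index)
    case 1
    then have "\<tau> i = (\<lambda>z. z)" by (simp add: \<tau>_def fun_eq_iff)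
    then have "hol_calc (\<tau> i) A = A" using hol_calc_id[OF A(1)] by simp
    then show ?thesis using A(2) 1 by (simp add: \<rho>_def)
  next
    case 2
    note Bi = B[OF 2(2)]
    have hol: "\<tau> i holomorphic_on punctured_disk n R c r"
      using analytic_imp_holomorphic[OF analytic_\<tau>[OF that]] punctured_disk_subset by (rule holomorphic_on_subset)
    have "hol_calc (\<lambda>z. (z - c i) * \<tau> i z) A = hol_calc (\<lambda>_. 1) A"
      using closed_regionD(3)[OF _ 2(2)] punctured_disk_subset 2
      by (intro hol_calc_cong[OF A(1) open_punctured_disk sp]) (auto simp: \<tau>_def)
    then have eq: "(A - c i \<cdot>\<^sub>m 1\<^sub>m d) * hol_calc (\<tau> i) A = 1\<^sub>m d"
      using hol_calc_diff_const_mult[OF A(1) open_punctured_disk sp hol, of "c i"] by (simp add: hol_calc_one[OF A(1)])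
    have c: "A - c i \<cdot>\<^sub>m 1\<^sub>m d \<in> carrier_mat d d" using A by auto
    have "B i = B i * ((A - c i \<cdot>\<^sub>m 1\<^sub>m d) * hol_calc (\<tau> i) A)" using Bi(1) by (simp add: eq)
    also have "\<dots> = hol_calc (\<tau> i) A"
      using assoc_mult_mat[OF Bi(1) c hol_calc_carrier[OF A(1)]] Bi(2) left_mult_one_mat[OF hol_calc_carrier[OF A(1)]]
      by metis
    finally show ?thesis using Bi(3) 2 by (simp add: \<rho>_def inverse_eq_divide)
  qed
  then show ?thesis
    by (intro contraction_cover.intro A(1) open_punctured_disk sp punctured_disk_subset compact_closed_region
        analytic_\<tau> norm_\<tau>_le \<tau>_onto frontier_closed_region decompose) (use n in auto)
qed

end

text \<open>Geometry and norms enter through finitely many strict inequalities, which survive for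
  small \<open>e > 0\<close>. The numbers \<open>a\<close> and \<open>b i\<close> stand for the
  norms of the matrix and of its shifted inverses.\<close>

lemma holed_disk_shrink:
  fixes a :: real and b :: "nat \<Rightarrow> real"
  assumes "0 < R" and r: "\<And>i. i \<in> {1..n} \<Longrightarrow> r i > 0" and inside: "\<And>i. i \<in> {1..n} \<Longrightarrow> cmod (c i) + r i < R"
    and disj: "disjoint_family_on (\<lambda>i. cball (c i) (r i)) {1..n}"
    and a: "a < R" and b: "\<And>i. i \<in> {1..n} \<Longrightarrow> b i < inverse (r i)"
  obtains e where "0 < e" "holed_disk n (R - e) c (\<lambda>i. r i + e)" "a < R - e"
    "\<And>i. i \<in> {1..n} \<Longrightarrow> b i < inverse (r i + e)"
proof -
  have sep: "r i + r j < dist (c i) (c j)" if "i \<in> {1..n}" "j \<in> {1..n}" "i \<noteq> j" for i j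
    using that disj r by (intro cball_disjoint_imp_dist) (auto simp: disjoint_family_on_def)
  have 1: "\<forall>\<^sub>F e in at_right 0. x < R - e" if "x < R" for x
    by (rule order_tendstoD(1)[OF _ that]) (auto intro!: tendsto_eq_intros)
  have 2: "\<forall>\<^sub>F e in at_right 0. \<forall>i\<in>{1..n}. b i < inverse (r i + e)"
  proof (intro eventually_ball_finite ballI)
    fix i assume i: "i \<in> {1..n}"
    show "\<forall>\<^sub>F e in at_right 0. b i < inverse (r i + e)"
      by (rule order_tendstoD(1)[OF _ b[OF i]]) (use r[OF i] in \<open>auto intro!: tendsto_eq_intros\<close>)
  qed simp
  \<comment> \<open>\<open>e\<close> enters twice: the hole grows by \<open>e\<close> and the outer
    radius shrinks by \<open>e\<close>.\<close>
  have 3: "\<forall>\<^sub>F e in at_right 0. \<forall>i\<in>{1..n}. cmod (c i) + (r i + e) + e < R"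
  proof (intro eventually_ball_finite ballI)
    fix i assume i: "i \<in> {1..n}"
    show "\<forall>\<^sub>F e in at_right 0. cmod (c i) + (r i + e) + e < R"
      by (rule order_tendstoD(2)[OF _ inside[OF i]]) (auto intro!: tendsto_eq_intros)
  qed simp
  have 4: "\<forall>\<^sub>F e in at_right 0. \<forall>i\<in>{1..n}. \<forall>j\<in>{1..n}. i \<noteq> j \<longrightarrow> (r i + e) + (r j + e) < dist (c i) (c j)"
  proof (intro eventually_ball_finite ballI)
    fix i j assume i: "i \<in> {1..n}" and j: "j \<in> {1..n}"
    show "\<forall>\<^sub>F e in at_right 0. i \<noteq> j \<longrightarrow> (r i + e) + (r j + e) < dist (c i) (c j)"
    proof (cases "i = j")
      case False
      have "\<forall>\<^sub>F e in at_right 0. (r i + e) + (r j + e) < dist (c i) (c j)"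
        by (rule order_tendstoD(2)[OF _ sep[OF i j False]]) (auto intro!: tendsto_eq_intros)
      then show ?thesis by (rule eventually_mono) simp
    qed simp
  qed simp_all
  have "\<forall>\<^sub>F e in at_right 0. (0::real) < e" by (rule eventually_at_right_less)
  with 1[OF \<open>0 < R\<close>] 1[OF a] 2 3 4
  have "\<forall>\<^sub>F e in at_right 0. 0 < e \<and> holed_disk n (R - e) c (\<lambda>i. r i + e) \<and> a < R - e \<and>
      (\<forall>i\<in>{1..n}. b i < inverse (r i + e))"
  proof eventually_elim
    case (elim e)
    have "holed_disk n (R - e) c (\<lambda>i. r i + e)"
    proof
      show "0 < R - e" using elim by simp
      show "0 < r i + e" if "i \<in> {1..n}" for i using r[OF that] elim by simp
      show "cmod (c i) + (r i + e) < R - e" if "i \<in> {1..n}" for i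
      proof -
        have "cmod (c i) + (r i + e) + e < R" using elim that by blast
        then show ?thesis by simp
      qed
      show "r i + e + (r j + e) < dist (c i) (c j)" if "i \<in> {1..n}" "j \<in> {1..n}" "i \<noteq> j" for i j
        using elim that by blast
    qed
    with elim show ?case by simp
  qed
  from eventually_happens'[OF _ this] show ?thesis using that by auto
qed

theorem theorem2p3:
  fixes n :: nat and R :: real and c :: "nat \<Rightarrow> complex" and r :: "nat \<Rightarrow> real"
  assumes "n \<ge> 1" and "R > 0"
    and "\<And>i. i \<in> {1..n} \<Longrightarrow> r i > 0"
    and "\<And>i. i \<in> {1..n} \<Longrightarrow> cmod (c i) + r i < R"
    and "disjoint_family_on (\<lambda>i. cball (c i) (r i)) {1..n}"
  shows "spectral_constant n R c r \<le> ereal ((real n + 1) / 2 + sqrt ((real n + 1)\<^sup>2 / 4 + real n))"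
proof -
  let ?\<kappa> = "(real n + 1) / 2 + sqrt ((real n + 1)\<^sup>2 / 4 + real n)"
  have "is_spectral_bound n R c r ?\<kappa>"
    unfolding is_spectral_bound_def
  proof (intro ballI allI impI)
    fix A f
    assume "A \<in> BBC_class n R c r"
    then obtain d where A: "A \<in> carrier_mat d d" "op_norm A < R"
      and inv: "\<And>i. i \<in> {1..n} \<Longrightarrow> invertible_mat (A - c i \<cdot>\<^sub>m 1\<^sub>m d)"
      and norm_inv: "\<And>i. i \<in> {1..n} \<Longrightarrow> op_norm (the (mat_inverse (A - c i \<cdot>\<^sub>m 1\<^sub>m d))) < inverse (r i)"
      unfolding BBC_class_def by auto
    assume f: "f holomorphic_on punctured_disk n R c r" "bounded (f ` punctured_disk n R c r)"
    define B where "B i = the (mat_inverse (A - c i \<cdot>\<^sub>m 1\<^sub>m d))" for i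
    have AC: "A - c i \<cdot>\<^sub>m 1\<^sub>m d \<in> carrier_mat d d" for i using A by auto
    have B: "B i \<in> carrier_mat d d" "B i * (A - c i \<cdot>\<^sub>m 1\<^sub>m d) = 1\<^sub>m d" if "i \<in> {1..n}" for i
      unfolding B_def using invertible_mat_inverse[OF AC inv[OF that]] by auto
    obtain e where e: "0 < e" "holed_disk n (R - e) c (\<lambda>i. r i + e)" "op_norm A < R - e"
      "\<And>i. i \<in> {1..n} \<Longrightarrow> op_norm (B i) < inverse (r i + e)"
      \<comment> \<open>The smaller domain depends on \<open>A\<close>, which is harmless because
        the bound obtained on it depends on \<open>n\<close> only. Its closure lies in the original
        domain, where \<open>f\<close> is holomorphic and bounded.\<close>
      using holed_disk_shrink[OF assms(2-5) A(2), of "\<lambda>i. op_norm (B i)"] norm_inv unfolding B_def by blast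
    interpret D: holed_disk n "R - e" c "\<lambda>i. r i + e" by (rule e(2))
    interpret C: contraction_cover A d "punctured_disk n (R - e) c (\<lambda>i. r i + e)" D.closed_region "{0..n}" D.\<tau> D.\<rho>
      by (rule D.contraction_cover[OF A(1) e(3) B e(4) assms(1)])
    let ?D = "punctured_disk n R c r"
    have sub: "D.closed_region \<subseteq> ?D"
      using e(1) by (force simp: D.closed_region_def punctured_disk_def)
    have "open ?D" unfolding punctured_disk_def by (intro open_Diff closed_UN) auto
    then have fa: "f analytic_on D.closed_region" using f(1) sub by (auto simp: analytic_on_holomorphic)
    have bdd: "bdd_above ((\<lambda>z. cmod (f z)) ` ?D)" using f(2) by (force simp: bounded_iff bdd_above_def)
    have le: "cmod (f z) \<le> (SUP z\<in>?D. cmod (f z))" if "z \<in> D.closed_region" for z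
      using sub that bdd by (intro cSUP_upper) auto
    \<comment> \<open>The point \<open>R - e\<close> of the outer circle shows that the region is
      nonempty, hence that the supremum is nonnegative.\<close>
    have "cmod (of_real (R - e)) = D.\<rho> 0" using D.R by (simp add: D.\<rho>_def del: of_real_diff)
    then obtain z where "z \<in> D.closed_region" using D.\<tau>_onto[of 0] by auto
    then have nonneg: "0 \<le> (SUP z\<in>?D. cmod (f z))" using le[of z] order_trans[OF norm_ge_zero] by blast
    show "op_norm (hol_calc f A) \<le> ?\<kappa> * (SUP z\<in>?D. cmod (f z))"
      using C.op_norm_hol_calc_le[OF fa le nonneg] by (simp add: add.commute)
  qed
  then show ?thesis unfolding spectral_constant_def by (intro Inf_lower) auto
qed

end
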